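(* Let $n\ge 1$. The bigraded Hilbert series of the trivial component of $\mathcal C$ under the diagonal action of $B_n$ is $$H_{q,t}(\mathcal C^{B_n})=\sum_{\beta\in B_n}q^{\mathrm{fmaj}(\beta)}\,t^{\mathrm{fmaj}(\beta^{-1})}.$$
   Context: $B_n$ is the hyperoctahedral group of signed permutations of $[n]=\{1,\dots,n\}$, written in one-line notation $\beta=\beta(1)\cdots\beta(n)$, where each $\beta(i)$ is a nonzero integer and $\sigma(i):=|\beta(i)|$ defines a permutation of $[n]$; $\beta$ is extended by $\beta(-i)=-\beta(i)$, which defines products and inverses. A negative entry $-k$ is written $\bar k$. Let $R=\mathbb{Q}[x_1,\dots,x_n,y_1,\dots,y_n]$, bigraded by degree in the $x$'s and degree in the $y$'s. $B_n$ acts diagonally on $R$ by $\beta\cdot x_i=\pm x_{\sigma(i)}$ and $\beta\cdot y_i=\pm y_{\sigma(i)}$, the sign being that of $\beta(i)$. Let $\mathcal I_{B_n\times B_n}$ be the ideal of $R$ generated by the invariants without constant term of the action of $B_n\times B_n$ on $R$ (first factor acting on the $x$'s, second on the $y$'s); equivalently it is generated by $\sum_k x_k^{2j}$ and $\sum_k y_k^{2j}$, $1\le j\le n$. Put $\mathcal C=R/\mathcal I_{B_n\times B_n}$ with the induced bigrading and diagonal $B_n$-action, and let $\mathcal C^{B_n}$ be the subspace of elements fixed by all of $B_n$. For a bihomogeneous space $S=\bigoplus_{k,j} S_{k,j}$, $H_{q,t}(S)=\sum_{k,j\ge0}\dim(S_{k,j})q^kt^j$. Use the linear order $\bar 1\prec\bar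 2\prec\cdots\prec\bar n\prec 1\prec 2\prec\cdots\prec n$. Set $\mathrm{Des}(\beta)=\{i\in[n-1]\mid \beta(i)\succ\beta(i+1)\}$, $\mathrm{maj}(\beta)=\sum_{i\in \mathrm{Des}(\beta)}i$, $\mathrm{neg}(\beta)$ the number of negative entries of $\beta$, and $\mathrm{fmaj}(\beta)=2\,\mathrm{maj}(\beta)+\mathrm{neg}(\beta)$. *)

theory Defs
  imports
    "HOL-Library.Poly_Mapping"
    "HOL-Computational_Algebra.Formal_Power_Series"
    "HOL-Algebra.QuotRing"
    "HOL-Algebra.Embedded_Algebras"
begin

section \<open>Signed permutations\<close>

text \<open>
  A signed permutation is stored as the odd function on all integers determined by its one-line
  notation. Values outside $\{-n,\dots,n\}$ are fixed, so that each element of $B_n$ has exactly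
  one representative, the product is composition, and the inverse is the inverse
  function \<^term>\<open>inv_into UNIV\<close>.
\<close>

definition hyperoctahedral :: "nat \<Rightarrow> (int \<Rightarrow> int) set" where
  "hyperoctahedral n =
     {\<beta>. (\<forall>i. \<beta> (- i) = - \<beta> i) \<and>
          bij_betw (\<lambda>i. nat \<bar>\<beta> (int i)\<bar>) {1..n} {1..n} \<and>
          (\<forall>i. \<bar>i\<bar> > int n \<longrightarrow> \<beta> i = i)}"

text \<open>The order $\bar 1\prec\cdots\prec\bar n\prec 1\prec\cdots\prec n$ on nonzero integers.\<close>

definition neg_first_less :: "int \<Rightarrow> int \<Rightarrow> bool" where
  "neg_first_less a b \<longleftrightarrow>
     (a < 0 \<and> 0 < b) \<or> (a < 0 \<and> b < 0 \<and> \<bar>a\<bar> < \<bar>b\<bar>) \<or> (0 < a \<and> 0 < b \<and> a < b)"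

definition Des :: "nat \<Rightarrow> (int \<Rightarrow> int) \<Rightarrow> nat set" where
  "Des n \<beta> = {i \<in> {1..n - 1}. neg_first_less (\<beta> (int (i + 1))) (\<beta> (int i))}"

definition maj :: "nat \<Rightarrow> (int \<Rightarrow> int) \<Rightarrow> nat" where
  "maj n \<beta> = (\<Sum>i\<in>Des n \<beta>. i)"

definition neg :: "nat \<Rightarrow> (int \<Rightarrow> int) \<Rightarrow> nat" where
  "neg n \<beta> = card {i \<in> {1..n}. \<beta> (int i) < 0}"

definition fmaj :: "nat \<Rightarrow> (int \<Rightarrow> int) \<Rightarrow> nat" where
  "fmaj n \<beta> = 2 * maj n \<beta> + neg n \<beta>"


section \<open>The polynomial ring and the action\<close>

datatype var = X nat | Y nat

type_synonym monomial = "var \<Rightarrow>\<^sub>0 nat"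
type_synonym mpoly = "monomial \<Rightarrow>\<^sub>0 rat"

definition const :: "rat \<Rightarrow> mpoly" where
  "const c = Poly_Mapping.single 0 c"

definition variable :: "var \<Rightarrow> mpoly" where
  "variable v = Poly_Mapping.single (Poly_Mapping.single v 1) 1"

text \<open>$\mathbb Q[x_1,\dots,x_n,y_1,\dots,y_n]$\<close>

definition poly_ring :: "nat \<Rightarrow> mpoly ring" where
  "poly_ring n =
     \<lparr>carrier = {p. \<forall>m\<in>Poly_Mapping.keys p. Poly_Mapping.keys m \<subseteq> X ` {1..n} \<union> Y ` {1..n}},
      mult = (*), one = 1, zero = 0, add = (+)\<rparr>"

text \<open>The $\mathbb Q$-algebra endomorphism determined by the images of the variables.\<close>

definition substitute :: "(var \<Rightarrow> mpoly) \<Rightarrow> mpoly \<Rightarrow> mpoly" where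
  "substitute f p =
     (\<Sum>m\<in>Poly_Mapping.keys p. const (Poly_Mapping.lookup p m) *
        (\<Prod>v\<in>Poly_Mapping.keys m. f v ^ Poly_Mapping.lookup m v))"

text \<open>
  The action of \<open>(\<alpha>, \<gamma>)\<close> in $B_n\times B_n$; the diagonal action of \<open>\<beta>\<close> is \<open>act \<beta> \<beta>\<close>.
\<close>

fun signed_variable :: "(int \<Rightarrow> int) \<Rightarrow> (int \<Rightarrow> int) \<Rightarrow> var \<Rightarrow> mpoly" where
  "signed_variable \<alpha> \<gamma> (X i) =
     of_int (sgn (\<alpha> (int i))) * variable (X (nat \<bar>\<alpha> (int i)\<bar>))"
| "signed_variable \<alpha> \<gamma> (Y i) =
     of_int (sgn (\<gamma> (int i))) * variable (Y (nat \<bar>\<gamma> (int i)\<bar>))"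

definition act :: "(int \<Rightarrow> int) \<Rightarrow> (int \<Rightarrow> int) \<Rightarrow> mpoly \<Rightarrow> mpoly" where
  "act \<alpha> \<gamma> = substitute (signed_variable \<alpha> \<gamma>)"

definition bihomogeneous :: "nat \<Rightarrow> nat \<Rightarrow> nat \<Rightarrow> mpoly set" where
  "bihomogeneous n k j =
     {p \<in> carrier (poly_ring n). \<forall>m\<in>Poly_Mapping.keys p.
        (\<Sum>i=1..n. Poly_Mapping.lookup m (X i)) = k \<and>
        (\<Sum>i=1..n. Poly_Mapping.lookup m (Y i)) = j}"


section \<open>The quotient by the invariants\<close>

definition invariant_ideal :: "nat \<Rightarrow> mpoly set" where
  "invariant_ideal n =
     genideal (poly_ring n)
       {p \<in> carrier (poly_ring n). Poly_Mapping.lookup p 0 = 0 \<and>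
          (\<forall>\<alpha>\<in>hyperoctahedral n. \<forall>\<gamma>\<in>hyperoctahedral n. act \<alpha> \<gamma> p = p)}"

definition coinvariants :: "nat \<Rightarrow> mpoly set ring" where
  "coinvariants n = poly_ring n Quot invariant_ideal n"

text \<open>Elements of the quotient are cosets.\<close>

definition coset :: "nat \<Rightarrow> mpoly \<Rightarrow> mpoly set" where
  "coset n p = invariant_ideal n +>\<^bsub>poly_ring n\<^esub> p"

text \<open>
  The ideal is stable under the diagonal action, so the induced action on cosets is the
  elementwise image: \<open>act \<beta> \<beta> ` coset n p = coset n (act \<beta> \<beta> p)\<close>.
\<close>

definition diagonal_invariants :: "nat \<Rightarrow> mpoly set set" where
  "diagonal_invariants n =
     {c \<in> carrier (coinvariants n). \<forall>\<beta>\<in>hyperoctahedral n. act \<beta> \<beta> ` c = c}"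

definition bigraded_part :: "nat \<Rightarrow> nat \<Rightarrow> nat \<Rightarrow> mpoly set set" where
  "bigraded_part n k j = coset n ` bihomogeneous n k j"

text \<open>
  The copy of $\mathbb Q$ inside the quotient. Dimensions over this subfield are dimensions
  of rational vector spaces.
\<close>

definition scalars :: "nat \<Rightarrow> mpoly set set" where
  "scalars n = coset n ` range const"

text \<open>
  The Hilbert series of a bihomogeneous subspace \<open>S\<close>, in $\mathbb Z[[t]][[q]]$: the outer
  variable is \<open>q\<close> and the inner one is \<open>t\<close>.
\<close>

definition hilbert_series :: "nat \<Rightarrow> mpoly set set \<Rightarrow> int fps fps" where
  "hilbert_series n S =
     Abs_fps (\<lambda>k. Abs_fps (\<lambda>j.
       int (ring.dim (coinvariants n) (scalars n) (S \<inter> bigraded_part n k j))))"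

definition q :: "int fps fps" where
  "q = fps_X"

definition t :: "int fps fps" where
  "t = fps_const fps_X"

end

theory Submission
  imports Defs "HOL-Combinatorics.Permutations"
begin

text \<open>
  Let \<open>R\<close> be the polynomial ring, \<open>A\<close> its subring of invariants of $B_n\times B_n$, and $A_+$ the part
  of \<open>A\<close> without constant term. The operator \<open>p \<mapsto> \<Sum>\<beta>. \<beta> p\<close> (\<open>reynolds\<close>) is \<open>A\<close>-linear with values in
  the ring $R^{B_n}$ of diagonal invariants. Averaging therefore shows that an invariant coset has
  an invariant representative, and that an invariant element of the ideal $A_+R$ already lies in
  $A_+R^{B_n}$. Thus $\mathcal C^{B_n}=R^{B_n}/A_+R^{B_n}$, and the theorem follows once $R^{B_n}$ is
  known to be free over \<open>A\<close> with one basis element of bidegree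
  $(\mathrm{fmaj}(\beta),\mathrm{fmaj}(\beta^{-1}))$ for each \<open>\<beta>\<close>.

  The basis is of descent type. Put $f_i(\beta)=2\,\#\{j\in\mathrm{Des}(\beta)\mid j\ge i\}+[\beta(i)<0]$
  (\<open>flag\<close>); these numbers add up to \<open>fmaj \<beta>\<close>. The basis element \<open>basis_poly\<close> of \<open>\<beta>\<close> is the image
  under \<open>reynolds\<close> of the monomial with \<open>x\<close>-exponents $f_i(\beta)$ and \<open>y\<close>-exponents
  $f_{|\beta(i)|}(\beta^{-1})$.

  The averaged monomial $x^ay^b$ vanishes unless every $a_i+b_i$ is even, and otherwise depends only
  on the multiset of the pairs $(a_i,b_i)$, its diagram. Every such diagram arises from exactly one triple
  \<open>(\<beta>, l, m)\<close> as the diagram of $(f_i(\beta)+l_i,\;f_{|\beta(i)|}(\beta^{-1})+m_i)$, where \<open>l\<close> and \<open>m\<close> have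
  even entries, \<open>l\<close> decreases with \<open>i\<close>, and \<open>m\<close> decreases with $|\beta(i)|$: sorting the pairs
  lexicographically and then ranking the second entries recovers $|\beta|$, and the parity of the
  entries recovers the signs (\<open>decomposition_exists\<close>, \<open>decomposition_unique\<close>).

  Multiplying the basis element of \<open>\<beta>\<close> by the symmetrized monomial $x^ly^m$ gives averaged monomials
  in which \<open>l\<close> and \<open>m\<close> are rearranged independently. Order diagrams first by the sum of the squares of
  all entries and then by the sum of the products $a_ib_i$ (\<open>weight\<close> packs both numbers into one).
  Then the diagram of the triple is the unique largest one that occurs (\<open>leading_diagram\<close>). So the
  products are triangular with respect to the averaged monomials: induction on the weight gives
  spanning (\<open>reynolds_xy_mono_in_basis_span\<close>), and comparing coefficients at a monomial of maximal
  weight gives independence (\<open>basis_independent\<close>).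
\<close>

section \<open>Diagrams and the leading_diagram-term inequality\<close>

definition diagram :: "nat \<Rightarrow> (nat \<Rightarrow> nat) \<Rightarrow> (nat \<Rightarrow> nat) \<Rightarrow> (nat \<times> nat) multiset" where
  "diagram n f g = image_mset (\<lambda>i. (f i, g i)) (mset_set {1..n})"

definition quadrant_count :: "nat \<Rightarrow> (nat \<Rightarrow> nat) \<Rightarrow> (nat \<Rightarrow> nat) \<Rightarrow> nat \<Rightarrow> nat \<Rightarrow> nat" where
  "quadrant_count n f g s r = card {i \<in> {1..n}. s \<le> f i \<and> r \<le> g i}"

lemma card_diagram:
  "card {i \<in> {1..n}. P (f i, g i)} = size {#x \<in># diagram n f g. P x#}"
  by (simp add: diagram_def filter_mset_image_mset)

lemma sum_diagram: "(\<Sum>i = 1..n. h (f i, g i)) = (\<Sum>x\<in>#diagram n f g. h x)"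
  by (simp add: diagram_def sum_unfold_sum_mset image_mset.compositionality o_def)

text \<open>
  Inclusion-exclusion on the four quadrants with corners at or next to \<open>(s, r)\<close> recovers the
  multiplicity of the pair \<open>(s, r)\<close>.
\<close>

lemma diagram_eqI:
  assumes "\<And>s r. quadrant_count n f g s r = quadrant_count n f' g' s r"
  shows "diagram n f g = diagram n f' g'"
proof (rule multiset_eqI)
  fix x :: "nat \<times> nat"
  obtain s r where x: "x = (s, r)" by fastforce
  have *: "count (diagram n f g) (s, r) + quadrant_count n f g (Suc s) r + quadrant_count n f g s (Suc r)
      = quadrant_count n f g s r + quadrant_count n f g (Suc s) (Suc r)" for f g
  proof -
    have "count (diagram n f g) (s, r) = card {i \<in> {1..n}. f i = s \<and> g i = r}"
      using card_diagram[of n "\<lambda>x. x = (s, r)" f g] filter_eq_replicate_mset[of "(s, r)" "diagram n f g"]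
      by simp
    moreover have "{i \<in> {1..n}. s \<le> f i \<and> r \<le> g i} =
        {i \<in> {1..n}. f i = s \<and> g i = r} \<union>
         ({i \<in> {1..n}. Suc s \<le> f i \<and> r \<le> g i} \<union> {i \<in> {1..n}. s \<le> f i \<and> Suc r \<le> g i})"
      by auto
    moreover have "card ({i \<in> {1..n}. f i = s \<and> g i = r} \<union>
         ({i \<in> {1..n}. Suc s \<le> f i \<and> r \<le> g i} \<union> {i \<in> {1..n}. s \<le> f i \<and> Suc r \<le> g i}))
       = card {i \<in> {1..n}. f i = s \<and> g i = r} +
         card ({i \<in> {1..n}. Suc s \<le> f i \<and> r \<le> g i} \<union> {i \<in> {1..n}. s \<le> f i \<and> Suc r \<le> g i})"
      by (rule card_Un_disjoint) auto
    moreover have "{i \<in> {1..n}. Suc s \<le> f i \<and> r \<le> g i} \<inter> {i \<in> {1..n}. s \<le> f i \<and> Suc r \<le> g i}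
        = {i \<in> {1..n}. Suc s \<le> f i \<and> Suc r \<le> g i}" by auto
    ultimately show ?thesis
      unfolding quadrant_count_def
      using card_Un_Int[of "{i \<in> {1..n}. Suc s \<le> f i \<and> r \<le> g i}"
          "{i \<in> {1..n}. s \<le> f i \<and> Suc r \<le> g i}"] by simp
  qed
  from *[of f g] *[of f' g'] show "count (diagram n f g) x = count (diagram n f' g') x"
    unfolding x assms by linarith
qed

text \<open>
  Each entry is the number of positive thresholds below it, so a sum of products counts
  triples of an index and two thresholds.
\<close>

lemma sum_mult_quadrant_count:
  assumes "\<And>i. i \<in> {1..n} \<Longrightarrow> f i \<le> M \<and> g i \<le> M"
  shows "(\<Sum>i = 1..n. f i * g i) = (\<Sum>s = 1..M. \<Sum>r = 1..M. quadrant_count n f g s r)"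
proof -
  have ind: "x = (\<Sum>s = 1..M. of_bool (s \<le> x))" if "x \<le> M" for x :: nat
  proof -
    have "{1..M} \<inter> {s. s \<le> x} = {1..x}" using that by auto
    then show ?thesis by (simp add: sum.If_cases of_bool_def)
  qed
  have "(\<Sum>i = 1..n. f i * g i)
      = (\<Sum>i = 1..n. (\<Sum>s = 1..M. of_bool (s \<le> f i)) * (\<Sum>r = 1..M. of_bool (r \<le> g i)))"
    using assms ind by (intro sum.cong) auto
  also have "\<dots> = (\<Sum>i = 1..n. \<Sum>s = 1..M. \<Sum>r = 1..M. of_bool (s \<le> f i \<and> r \<le> g i))"
    by (simp only: sum_product) (simp add: of_bool_conj)
  also have "\<dots> = (\<Sum>s = 1..M. \<Sum>i = 1..n. \<Sum>r = 1..M. of_bool (s \<le> f i \<and> r \<le> g i))"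
    by (rule sum.swap)
  also have "\<dots> = (\<Sum>s = 1..M. \<Sum>r = 1..M. \<Sum>i = 1..n. of_bool (s \<le> f i \<and> r \<le> g i))"
    by (rule sum.cong[OF refl], rule sum.swap)
  also have "\<dots> = (\<Sum>s = 1..M. \<Sum>r = 1..M. quadrant_count n f g s r)"
  proof -
    have "(\<Sum>i = 1..n. of_bool (s \<le> f i \<and> r \<le> g i)) = quadrant_count n f g s r" for s r
    proof -
      have "{1..n} \<inter> {i. s \<le> f i \<and> r \<le> g i} = {i \<in> {1..n}. s \<le> f i \<and> r \<le> g i}" by auto
      then show ?thesis by (simp add: sum.If_cases of_bool_def quadrant_count_def)
    qed
    then show ?thesis by simp
  qed
  finally show ?thesis .
qed

text \<open>
  Pointwise comparison of quadrant counts is a dominance order on diagrams; summing over all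
  quadrants turns it into a comparison of numbers in which equality is only possible between
  equal diagrams. The equality of the marginals covers the quadrants with a zero threshold, which
  the sum of products does not see.
\<close>

lemma sum_mult_less_or_diagram_eq:
  assumes le: "\<And>s r. quadrant_count n f g s r \<le> quadrant_count n f' g' s r"
    and m0: "\<And>s. quadrant_count n f g s 0 = quadrant_count n f' g' s 0" "\<And>r. quadrant_count n f g 0 r = quadrant_count n f' g' 0 r"
  shows "(\<Sum>i = 1..n. f i * g i) < (\<Sum>i = 1..n. f' i * g' i) \<or>
    (\<Sum>i = 1..n. f i * g i) = (\<Sum>i = 1..n. f' i * g' i) \<and> diagram n f g = diagram n f' g'"
proof -
  define M where "M = (\<Sum>i = 1..n. f i + g i + f' i + g' i)"
  have M: "f i \<le> M \<and> g i \<le> M \<and> f' i \<le> M \<and> g' i \<le> M" if "i \<in> {1..n}" for i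
    using member_le_sum[of i "{1..n}" "\<lambda>i. f i + g i + f' i + g' i"] that
    unfolding M_def by simp
  note s1 = sum_mult_quadrant_count[of n f M g] and s2 = sum_mult_quadrant_count[of n f' M g']
  have leS: "(\<Sum>r = 1..M. quadrant_count n f g s r) \<le> (\<Sum>r = 1..M. quadrant_count n f' g' s r)" for s
    by (rule sum_mono) (rule le)
  have le: "(\<Sum>i = 1..n. f i * g i) \<le> (\<Sum>i = 1..n. f' i * g' i)"
    using s1 s2 M leS by (simp add: sum_mono)
  moreover have "diagram n f g = diagram n f' g'"
    if eq: "(\<Sum>i = 1..n. f i * g i) = (\<Sum>i = 1..n. f' i * g' i)"
  proof (rule diagram_eqI)
    fix s r
    have eq': "(\<Sum>s = 1..M. \<Sum>r = 1..M. quadrant_count n f g s r) = (\<Sum>s = 1..M. \<Sum>r = 1..M. quadrant_count n f' g' s r)"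
      using s1 s2 M eq by simp
    consider "s = 0" | "r = 0" | "s > M \<or> r > M" | "s \<in> {1..M}" "r \<in> {1..M}" by force
    then show "quadrant_count n f g s r = quadrant_count n f' g' s r"
    proof cases
      case 3
      then have "{i \<in> {1..n}. s \<le> f i \<and> r \<le> g i} = {}" "{i \<in> {1..n}. s \<le> f' i \<and> r \<le> g' i} = {}"
        using M by fastforce+
      then show ?thesis by (simp only: quadrant_count_def)
    next
      case 4
      have "(\<Sum>r = 1..M. quadrant_count n f g s r) = (\<Sum>r = 1..M. quadrant_count n f' g' s r)"
        using sum_mono_inv[OF eq' leS 4(1)] by simp
      from sum_mono_inv[OF this assms(1) 4(2)] show ?thesis by simp
    qed (simp_all add: m0)
  qed
  ultimately show ?thesis by linarith
qed

text \<open>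
  When \<open>f\<close> and \<open>g\<close> increase together, the superlevel sets \<open>{s \<le> f}\<close> and \<open>{r \<le> g}\<close> are nested,
  so they meet in the largest set that their sizes permit.
\<close>

lemma quadrant_count_comonotone_le:
  assumes co: "\<And>i j. i \<in> {1..n} \<Longrightarrow> j \<in> {1..n} \<Longrightarrow> f i < f j \<Longrightarrow> g i \<le> g j"
    and m: "quadrant_count n f h 0 r = quadrant_count n f g 0 r"
  shows "quadrant_count n f h s r \<le> quadrant_count n f g s r"
proof -
  let ?F = "{i \<in> {1..n}. s \<le> f i}" and ?G = "{i \<in> {1..n}. r \<le> g i}" and ?H = "{i \<in> {1..n}. r \<le> h i}"
  have q: "quadrant_count n f g s r = card (?F \<inter> ?G)" "quadrant_count n f h s r = card (?F \<inter> ?H)"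
    unfolding quadrant_count_def by (auto intro!: arg_cong[where f = card])
  have c: "card ?H = card ?G" using m by (simp add: quadrant_count_def)
  have "?F \<subseteq> ?G \<or> ?G \<subseteq> ?F"
  proof (rule ccontr)
    assume "\<not> (?F \<subseteq> ?G \<or> ?G \<subseteq> ?F)"
    then obtain i j where "i \<in> {1..n}" "j \<in> {1..n}" "s \<le> f i" "\<not> r \<le> g i" "r \<le> g j" "\<not> s \<le> f j" by blast
    then show False using co[of j i] by linarith
  qed
  then show ?thesis
  proof
    assume "?F \<subseteq> ?G"
    then have "?F \<inter> ?G = ?F" by blast
    moreover have "card (?F \<inter> ?H) \<le> card ?F" by (rule card_mono) auto
    ultimately show ?thesis unfolding q by simp
  next
    assume "?G \<subseteq> ?F"
    then have "?F \<inter> ?G = ?G" by blast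
    moreover have "card (?F \<inter> ?H) \<le> card ?H" by (rule card_mono) auto
    ultimately show ?thesis unfolding q using c by simp
  qed
qed

lemma quadrant_count_bij:
  assumes "bij_betw p {1..n} {1..n}"
  shows "quadrant_count n f (\<lambda>i. g (p i)) 0 r = quadrant_count n f' g 0 r"
proof -
  have "bij_betw p {i \<in> {1..n}. r \<le> g (p i)} {i \<in> {1..n}. r \<le> g i}"
  proof (rule bij_betw_imageI)
    show "inj_on p {i \<in> {1..n}. r \<le> g (p i)}"
      using assms unfolding bij_betw_def by (auto intro: inj_on_subset)
    have "p ` {1..n} = {1..n}" using assms by (simp add: bij_betw_def)
    then show "p ` {i \<in> {1..n}. r \<le> g (p i)} = {i \<in> {1..n}. r \<le> g i}"
    proof (intro subset_antisym subsetI)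
      fix x assume img: "p ` {1..n} = {1..n}" and x: "x \<in> {i \<in> {1..n}. r \<le> g i}"
      then have "x \<in> p ` {1..n}" by simp
      then obtain y where "y \<in> {1..n}" "x = p y" by blast
      then show "x \<in> p ` {i \<in> {1..n}. r \<le> g (p i)}" using x by blast
    qed blast
  qed
  then show ?thesis by (simp add: quadrant_count_def bij_betw_same_card)
qed

lemma rearrangement:
  assumes co: "\<And>i j. i \<in> {1..n} \<Longrightarrow> j \<in> {1..n} \<Longrightarrow> f i < f j \<Longrightarrow> g i \<le> g j"
    and p: "bij_betw p {1..n} {1..n}"
  shows "(\<Sum>i = 1..n. f i * g (p i)) < (\<Sum>i = 1..n. f i * g i) \<or>
    (\<Sum>i = 1..n. f i * g (p i)) = (\<Sum>i = 1..n. f i * g i) \<and>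
      diagram n f (\<lambda>i. g (p i)) = diagram n f g"
proof (rule sum_mult_less_or_diagram_eq)
  show "quadrant_count n f (\<lambda>i. g (p i)) s r \<le> quadrant_count n f g s r" for s r
    by (rule quadrant_count_comonotone_le[OF co quadrant_count_bij[OF p]])
qed (auto simp: quadrant_count_bij[OF p], simp add: quadrant_count_def)

text \<open>
  The set \<open>S\<close> picks elements by \<open>a\<close> and breaks ties by \<open>b\<close>, while \<open>S'\<close> breaks ties arbitrarily. An
  element of \<open>S' - S\<close> is replaced by one of \<open>S - S'\<close>, which has the same \<open>a\<close> and at least the
  same \<open>b\<close>. This can only lose an element of the intersection with \<open>R'\<close> if the two also agree in
  \<open>b\<close>; they are then indistinguishable, and performing the same exchange in \<open>R'\<close> restores the count.
\<close>

lemma exchange_upper_set: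
  fixes a b :: "'a \<Rightarrow> nat"
  assumes I: "finite I" "S \<subseteq> I" "S' \<subseteq> I" "R' \<subseteq> I" "card S' = card S"
    and up: "\<And>i j. i \<in> S' \<Longrightarrow> j \<in> I - S' \<Longrightarrow> a j \<le> a i"
      "\<And>i j. i \<in> R' \<Longrightarrow> j \<in> I - R' \<Longrightarrow> b j \<le> b i"
      "\<And>i j. i \<in> S \<Longrightarrow> j \<in> I - S \<Longrightarrow> a j \<le> a i \<and> (a i = a j \<longrightarrow> b j \<le> b i)"
  shows "\<exists>R''\<subseteq>I. card R'' = card R' \<and> card (S' \<inter> R') \<le> card (S \<inter> R'') \<and>
    (\<forall>i\<in>R''. \<forall>j\<in>I - R''. b j \<le> b i)"
  using assms(3-7)
proof (induction "card (S - S')" arbitrary: S' R')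
  case 0
  have "finite S" "finite S'" using finite_subset[OF _ I(1)] I(2) 0(2) by auto
  then have "S \<subseteq> S'" using 0(1) by auto
  then have "S = S'" using 0(4) \<open>finite S'\<close> by (simp add: card_subset_eq)
  then show ?case using 0(3,6) by blast
next
  case (Suc k)
  have fin: "finite S" "finite S'" "finite R'" using finite_subset[OF _ I(1)] I(2) Suc(3,4) by auto
  from Suc(2) have "S - S' \<noteq> {}" by (metis card.empty nat.distinct(1))
  then obtain i where i: "i \<in> S" "i \<notin> S'" by blast
  have "\<not> S' \<subseteq> S"
    using card_subset_eq[OF fin(1), of S'] Suc(5) i by blast
  then obtain j where j: "j \<in> S'" "j \<notin> S" by blast
  have inI: "i \<in> I" "j \<in> I" using i j I(2) Suc(3) by auto
  have aij: "a i = a j" using Suc(6)[of j i] up(3)[of i j] i j inI by auto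
  have bij: "b j \<le> b i" using up(3)[of i j] i j inI aij by auto
  let ?S = "insert i (S' - {j})"
  have neq: "i \<noteq> j" using i j by blast
  have 1: "k = card (S - ?S)"
  proof -
    have "S - ?S = (S - S') - {i}" using i j by blast
    then show ?thesis using Suc(2) i fin by simp
  qed
  have 2: "?S \<subseteq> I" using inI Suc(3) by blast
  have 3: "card ?S = card S" using card.remove[OF fin(2) j(1)] i fin Suc(5) by simp
  have 4: "a y \<le> a x" if "x \<in> ?S" "y \<in> I - ?S" for x y
    using that Suc(6)[of x y] Suc(6)[of x i] Suc(6)[of j y] aij i j inI by auto
  show ?case
  proof (cases "j \<in> R' \<and> i \<notin> R'")
    case False
    have "card (S' \<inter> R') \<le> card (?S \<inter> R')"
    proof (cases "j \<in> R'")
      case True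
      then have "i \<in> R'" using False by blast
      then have "?S \<inter> R' = insert i ((S' \<inter> R') - {j})" using i neq by blast
      then show ?thesis using card.remove[of "S' \<inter> R'" j] True i j fin by simp
    next
      case False
      then have "S' \<inter> R' \<subseteq> ?S \<inter> R'" by blast
      then show ?thesis using fin by (intro card_mono) auto
    qed
    with Suc(1)[OF 1 2 Suc(4) 3 4 Suc(7)] show ?thesis by force
  next
    case True
    have bb: "b i = b j" using Suc(7)[of j i] True bij inI by auto
    let ?R = "insert i (R' - {j})"
    have r1: "?R \<subseteq> I" using inI Suc(4) by blast
    have r2: "b y \<le> b x" if "x \<in> ?R" "y \<in> I - ?R" for x y
      using that Suc(7)[of x y] Suc(7)[of x i] Suc(7)[of j y] bb True inI by auto
    have r3: "card ?R = card R'" using card.remove[of R' j] True fin by simp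
    have "?S \<inter> ?R = insert i ((S' \<inter> R') - {j})" using i neq True by blast
    then have "card (?S \<inter> ?R) = card (S' \<inter> R')" using card.remove[of "S' \<inter> R'" j] True i j fin by simp
    with Suc(1)[OF 1 2 r1 3 4 r2] r3 show ?thesis by force
  qed
qed

text \<open>
  The pairs \<open>(a i, b i)\<close> are listed in lexicographically decreasing order and \<open>\<sigma>\<close> standardizes the
  second entries. The condition is symmetric under exchanging the two components and replacing
  \<open>\<sigma>\<close> by its inverse.
\<close>

definition compatible :: "nat \<Rightarrow> (nat \<Rightarrow> nat) \<Rightarrow> (nat \<Rightarrow> nat) \<Rightarrow> (nat \<Rightarrow> nat) \<Rightarrow> bool" where
  "compatible n \<sigma> a b \<longleftrightarrow> (\<forall>i\<in>{1..n}. \<forall>j\<in>{1..n}.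
     (i < j \<longrightarrow> a j \<le> a i \<and> (a i = a j \<longrightarrow> \<sigma> i < \<sigma> j)) \<and>
     (\<sigma> i < \<sigma> j \<longrightarrow> b j \<le> b i \<and> (b i = b j \<longrightarrow> i < j)))"

text \<open>
  Among all ways to break ties in choosing a given number of largest \<open>a\<close> and a given number of
  largest \<open>b\<close>, following the index order and the order of \<open>\<sigma>\<close> gives the largest overlap. The
  exchange lemma first replaces \<open>S'\<close> by \<open>S\<close> and \<open>R'\<close> by some \<open>R''\<close>. Each element of \<open>R - R''\<close> then
  precedes each element of \<open>R'' - R\<close>, so the initial segment \<open>S\<close> contains the former whenever
  it contains the latter.
\<close>

lemma card_Int_le_initial_segments:
  assumes cp: "compatible n \<sigma> a b"
    and sub: "S \<subseteq> {1..n}" "S' \<subseteq> {1..n}" "R \<subseteq> {1..n}" "R' \<subseteq> {1..n}"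
    and card: "card S' = card S" "card R' = card R"
    and S': "\<And>i j. i \<in> S' \<Longrightarrow> j \<in> {1..n} - S' \<Longrightarrow> a j \<le> a i"
    and R': "\<And>i j. i \<in> R' \<Longrightarrow> j \<in> {1..n} - R' \<Longrightarrow> b j \<le> b i"
    and S: "\<And>i j. i \<in> S \<Longrightarrow> j \<in> {1..n} - S \<Longrightarrow> i < j"
    and R: "\<And>i j. i \<in> R \<Longrightarrow> j \<in> {1..n} - R \<Longrightarrow> \<sigma> i < \<sigma> j"
  shows "card (S' \<inter> R') \<le> card (S \<inter> R)"
proof -
  have ups: "a j \<le> a i \<and> (a i = a j \<longrightarrow> b j \<le> b i)" if "i \<in> S" "j \<in> {1..n} - S" for i j
    using S[OF that] cp that sub unfolding compatible_def by (meson Diff_iff subsetD)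
  have "\<exists>R''\<subseteq>{1..n}. card R'' = card R' \<and> card (S' \<inter> R') \<le> card (S \<inter> R'') \<and>
      (\<forall>i\<in>R''. \<forall>j\<in>{1..n} - R''. b j \<le> b i)"
    by (rule exchange_upper_set[of _ S S' R' a b]; (fact S' R' ups sub card | simp add: ups)?)
  then obtain R'' where R'': "R'' \<subseteq> {1..n}" "card R'' = card R'" "card (S' \<inter> R') \<le> card (S \<inter> R'')"
      "\<And>i j. i\<in>R'' \<Longrightarrow> j\<in>{1..n} - R'' \<Longrightarrow> b j \<le> b i"
    by meson
  have fin: "finite S" "finite R" "finite R''" using sub R'' finite_subset by blast+
  have lt: "i < j" if ij: "i \<in> R - R''" "j \<in> R'' - R" for i j
  proof -
    have inI: "i \<in> {1..n}" "j \<in> {1..n}" using ij sub R''(1) by auto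
    have "\<sigma> i < \<sigma> j" using R ij inI by blast
    moreover have "b i \<le> b j" using R''(4) ij inI by blast
    ultimately show ?thesis using cp inI unfolding compatible_def by (meson order_antisym)
  qed
  have cRR: "card (R - R'') = card (R'' - R)"
    using R''(2) card(2) fin by (metis card_le_sym_Diff diff_is_0_eq' le_antisym order_refl)
  show ?thesis
  proof (cases "(R'' - R) \<inter> S = {}")
    case True
    then have "S \<inter> R'' \<subseteq> S \<inter> R" by blast
    then have "card (S \<inter> R'') \<le> card (S \<inter> R)" using fin by (intro card_mono) auto
    then show ?thesis using R''(3) by linarith
  next
    case False
    then obtain j where j: "j \<in> R'' - R" "j \<in> S" by blast
    have "i \<in> S" if "i \<in> R - R''" for i
      using lt[OF that j(1)] S[OF j(2), of i] that sub by fastforce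
    then have e: "S \<inter> R = (S \<inter> R \<inter> R'') \<union> (R - R'')" by blast
    have "card (S \<inter> R) = card (S \<inter> R \<inter> R'') + card (R - R'')"
      using fin by (subst e, intro card_Un_disjoint) auto
    also have "\<dots> \<ge> card (S \<inter> R'')"
    proof -
      have "S \<inter> R'' \<subseteq> (S \<inter> R \<inter> R'') \<union> (R'' - R)" by blast
      then have "card (S \<inter> R'') \<le> card ((S \<inter> R \<inter> R'') \<union> (R'' - R))"
        using fin by (intro card_mono) auto
      also have "\<dots> \<le> card (S \<inter> R \<inter> R'') + card (R'' - R)" by (rule card_Un_le)
      finally show ?thesis using cRR by simp
    qed
    finally show ?thesis using R''(3) by linarith
  qed
qed

text \<open>
  A lexicographic comparison of two numbers coded as one: the second sum is at most the
  first, hence smaller than the gap between consecutive squares.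
\<close>

definition weight :: "nat \<Rightarrow> (nat \<Rightarrow> nat) \<Rightarrow> (nat \<Rightarrow> nat) \<Rightarrow> nat" where
  "weight n a b = (\<Sum>i = 1..n. (a i)\<^sup>2 + (b i)\<^sup>2)\<^sup>2 + (\<Sum>i = 1..n. a i * b i)"

lemma weight_less:
  assumes "(\<Sum>i = 1..n. (a i)\<^sup>2 + (b i)\<^sup>2) < (\<Sum>i = 1..n. (a' i)\<^sup>2 + (b' i)\<^sup>2)"
  shows "weight n a b < weight n a' b'"
proof -
  let ?P = "\<Sum>i = 1..n. (a i)\<^sup>2 + (b i)\<^sup>2" and ?P' = "\<Sum>i = 1..n. (a' i)\<^sup>2 + (b' i)\<^sup>2"
  have "x * y \<le> x\<^sup>2 + y\<^sup>2" for x y :: nat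
    by (cases "x \<le> y") (auto simp: power2_eq_square intro: trans_le_add2 trans_le_add1 mult_le_mono)
  then have "(\<Sum>i = 1..n. a i * b i) \<le> ?P" by (intro sum_mono) simp
  moreover have "(Suc ?P)\<^sup>2 \<le> ?P'\<^sup>2" using assms by (intro power_mono) auto
  ultimately show ?thesis unfolding weight_def by (simp add: power2_eq_square)
qed

lemma weight_diagram:
  assumes "diagram n a b = diagram n a' b'"
  shows "weight n a b = weight n a' b'"
  using sum_diagram[of "\<lambda>x. (fst x)\<^sup>2 + (snd x)\<^sup>2" a b n] sum_diagram[of "\<lambda>x. (fst x)\<^sup>2 + (snd x)\<^sup>2" a' b' n]
   sum_diagram[of "\<lambda>x. fst x * snd x" a b n] sum_diagram[of "\<lambda>x. fst x * snd x" a' b' n] assms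
  unfolding weight_def by simp

lemma diagram_entry:
  assumes "diagram n a b = diagram n a' b'" "i \<in> {1..n}"
  shows "\<exists>j\<in>{1..n}. a i = a' j \<and> b i = b' j"
proof -
  have "(a i, b i) \<in># diagram n a' b'" 
    unfolding assms(1)[symmetric] unfolding diagram_def using assms(2) by auto
  then show ?thesis unfolding diagram_def by auto
qed

text \<open>
  By the rearrangement inequality the sum of squares is maximal only if \<open>l \<circ> p\<close> is arranged like \<open>a\<close>
  and \<open>m \<circ> p'\<close> like \<open>b\<close>; then only the treatment of ties is left open. Superlevel sets of the
  two coordinates are then chosen by size of \<open>a\<close> and of \<open>b\<close>, and those of the distinguished
  arrangement are initial segments, so all its quadrant counts are at least as large.
\<close>

lemma leading_diagram:
  assumes cp: "compatible n \<sigma> a b" and inj: "inj_on \<sigma> {1..n}"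
    and l: "\<And>i j. i \<in> {1..n} \<Longrightarrow> j \<in> {1..n} \<Longrightarrow> i < j \<Longrightarrow> l j \<le> l i"
    and m: "\<And>i j. i \<in> {1..n} \<Longrightarrow> j \<in> {1..n} \<Longrightarrow> \<sigma> i < \<sigma> j \<Longrightarrow> m j \<le> m i"
    and p: "bij_betw p {1..n} {1..n}" and p': "bij_betw p' {1..n} {1..n}"
  shows "weight n (\<lambda>i. a i + l (p i)) (\<lambda>i. b i + m (p' i)) < weight n (\<lambda>i. a i + l i) (\<lambda>i. b i + m i) \<or>
    diagram n (\<lambda>i. a i + l (p i)) (\<lambda>i. b i + m (p' i)) = diagram n (\<lambda>i. a i + l i) (\<lambda>i. b i + m i)"
proof -
  let ?A = "\<lambda>i. a i + l i" and ?B = "\<lambda>i. b i + m i"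
  let ?A' = "\<lambda>i. a i + l (p i)" and ?B' = "\<lambda>i. b i + m (p' i)"
  have coa: "l i \<le> l j" if "i \<in> {1..n}" "j \<in> {1..n}" "a i < a j" for i j
  proof (cases i j rule: linorder_cases)
    case less
    then show ?thesis using cp that unfolding compatible_def by (meson linorder_not_less)
  qed (use that l in auto)
  have cob: "m i \<le> m j" if "i \<in> {1..n}" "j \<in> {1..n}" "b i < b j" for i j
  proof (cases "\<sigma> i" "\<sigma> j" rule: linorder_cases)
    case less
    then show ?thesis using cp that unfolding compatible_def by (meson linorder_not_less)
  next
    case equal
    then show ?thesis using inj that by (auto dest: inj_onD)
  qed (use that m in auto)
  note ra = rearrangement[of n a l p, OF coa p] and rb = rearrangement[of n b m p', OF cob p']
  have sq: "(\<Sum>i = 1..n. (l (p i))\<^sup>2) = (\<Sum>i = 1..n. (l i)\<^sup>2)" "(\<Sum>i = 1..n. (m (p' i))\<^sup>2) = (\<Sum>i = 1..n. (m i)\<^sup>2)"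
    using sum.reindex_bij_betw[OF p, of "\<lambda>i. (l i)\<^sup>2"] sum.reindex_bij_betw[OF p', of "\<lambda>i. (m i)\<^sup>2"] by auto
  have psi: "(\<Sum>i = 1..n. (a i + f i)\<^sup>2 + (b i + g i)\<^sup>2) = (\<Sum>i = 1..n. (a i)\<^sup>2 + (b i)\<^sup>2)
     + (\<Sum>i = 1..n. (f i)\<^sup>2) + (\<Sum>i = 1..n. (g i)\<^sup>2) + 2 * (\<Sum>i = 1..n. a i * f i) + 2 * (\<Sum>i = 1..n. b i * g i)"
    for f g
    by (simp add: power2_sum sum.distrib sum_distrib_left algebra_simps)
  show ?thesis
  proof (cases "(\<Sum>i = 1..n. a i * l (p i)) = (\<Sum>i = 1..n. a i * l i) \<and>
       (\<Sum>i = 1..n. b i * m (p' i)) = (\<Sum>i = 1..n. b i * m i)")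
    case False
    then have "(\<Sum>i = 1..n. (?A' i)\<^sup>2 + (?B' i)\<^sup>2) < (\<Sum>i = 1..n. (?A i)\<^sup>2 + (?B i)\<^sup>2)"
      unfolding psi sq using ra rb by linarith
    then show ?thesis by (intro disjI1 weight_less)
  next
    case True
    then have da: "diagram n a (\<lambda>i. l (p i)) = diagram n a l" and db: "diagram n b (\<lambda>i. m (p' i)) = diagram n b m"
      using ra rb by auto
    have imp: "quadrant_count n ?A' ?B' s 0 = quadrant_count n ?A ?B s 0" "quadrant_count n ?A' ?B' 0 s = quadrant_count n ?A ?B 0 s" for s
      using card_diagram[of n "\<lambda>x. s \<le> fst x + snd x" a l] card_diagram[of n "\<lambda>x. s \<le> fst x + snd x" a "\<lambda>i. l (p i)"]
       card_diagram[of n "\<lambda>x. s \<le> fst x + snd x" b m] card_diagram[of n "\<lambda>x. s \<le> fst x + snd x" b "\<lambda>i. m (p' i)"] da db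
      unfolding quadrant_count_def by auto
    have al: "l (p i) \<le> l (p j)" if "i \<in> {1..n}" "j \<in> {1..n}" "a i < a j" for i j
      using diagram_entry[OF da that(1)] diagram_entry[OF da that(2)] that(3) coa by metis
    have bl: "m (p' i) \<le> m (p' j)" if "i \<in> {1..n}" "j \<in> {1..n}" "b i < b j" for i j
      using diagram_entry[OF db that(1)] diagram_entry[OF db that(2)] that(3) cob by metis
    have le: "quadrant_count n ?A' ?B' s r \<le> quadrant_count n ?A ?B s r" for s r
    proof -
      let ?S = "{i \<in> {1..n}. s \<le> ?A i}" and ?S' = "{i \<in> {1..n}. s \<le> ?A' i}"
      let ?R = "{i \<in> {1..n}. r \<le> ?B i}" and ?R' = "{i \<in> {1..n}. r \<le> ?B' i}"
      have qe: "quadrant_count n ?A' ?B' s r = card (?S' \<inter> ?R')" "quadrant_count n ?A ?B s r = card (?S \<inter> ?R)"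
        unfolding quadrant_count_def by (auto intro!: arg_cong[where f = card])
      show ?thesis unfolding qe
      proof (rule card_Int_le_initial_segments[OF cp])
        show "card ?S' = card ?S" "card ?R' = card ?R" using imp[of s] imp[of r] unfolding quadrant_count_def by auto
        show "a j \<le> a i" if "i \<in> ?S'" "j \<in> {1..n} - ?S'" for i j
          using al[of i j] that by (cases "a i < a j") auto
        show "b j \<le> b i" if "i \<in> ?R'" "j \<in> {1..n} - ?R'" for i j
          using bl[of i j] that by (cases "b i < b j") auto
        show "i < j" if "i \<in> ?S" "j \<in> {1..n} - ?S" for i j
        proof (rule ccontr)
          assume "\<not> i < j"
          then consider "j < i" | "i = j" by linarith
          then have "?A i \<le> ?A j"
          proof cases
            case 1
            then have "a i \<le> a j" using cp that unfolding compatible_def by blast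
            then show ?thesis using l[of j i] that 1 by simp
          qed simp
          then show False using that by auto
        qed
        show "\<sigma> i < \<sigma> j" if "i \<in> ?R" "j \<in> {1..n} - ?R" for i j
        proof (rule ccontr)
          assume "\<not> \<sigma> i < \<sigma> j"
          then consider "\<sigma> j < \<sigma> i" | "\<sigma> i = \<sigma> j" by linarith
          then have "?B i \<le> ?B j"
          proof cases
            case 1
            then have "b i \<le> b j" using cp that unfolding compatible_def by blast
            then show ?thesis using m[of j i] that 1 by simp
          next
            case 2
            then have "i = j" using inj that by (auto dest: inj_onD)
            then show ?thesis by simp
          qed
          then show False using that by auto
        qed
      qed auto
    qed
    have "(\<Sum>i = 1..n. ?A' i * ?B' i) < (\<Sum>i = 1..n. ?A i * ?B i) \<or> diagram n ?A' ?B' = diagram n ?A ?B"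
      using sum_mult_less_or_diagram_eq[OF le imp] by blast
    moreover have "(\<Sum>i = 1..n. (?A' i)\<^sup>2 + (?B' i)\<^sup>2) = (\<Sum>i = 1..n. (?A i)\<^sup>2 + (?B i)\<^sup>2)"
      unfolding psi sq using True by simp
    ultimately show ?thesis unfolding weight_def by auto
  qed
qed

section \<open>Signed permutations and flag vectors\<close>

definition abs_perm :: "(int \<Rightarrow> int) \<Rightarrow> nat \<Rightarrow> nat" where
  "abs_perm \<beta> i = nat \<bar>\<beta> (int i)\<bar>"

lemma
  assumes "\<beta> \<in> hyperoctahedral n"
  shows hyper_odd: "\<beta> (- z) = - \<beta> z"
    and hyper_bij: "bij_betw (abs_perm \<beta>) {1..n} {1..n}"
    and hyper_out: "\<bar>z\<bar> > int n \<Longrightarrow> \<beta> z = z"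
  using assms unfolding hyperoctahedral_def abs_perm_def[abs_def] by auto

lemma hyper_zero: "\<beta> \<in> hyperoctahedral n \<Longrightarrow> \<beta> 0 = 0"
  using hyper_odd[of \<beta> n 0] by simp

lemma abs_perm_abs: "\<beta> \<in> hyperoctahedral n \<Longrightarrow> abs_perm \<beta> (nat \<bar>z\<bar>) = nat \<bar>\<beta> z\<bar>"
  using hyper_odd[of \<beta> n z] by (cases "z \<ge> 0") (auto simp: abs_perm_def)

lemma abs_perm_in: "\<beta> \<in> hyperoctahedral n \<Longrightarrow> i \<in> {1..n} \<Longrightarrow> abs_perm \<beta> i \<in> {1..n}"
  using hyper_bij by (rule bij_betw_apply)

lemma abs_perm_inj: "\<beta> \<in> hyperoctahedral n \<Longrightarrow> inj_on (abs_perm \<beta>) {1..n}"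
  using hyper_bij by (rule bij_betw_imp_inj_on)

lemma hyper_nonzero: "\<beta> \<in> hyperoctahedral n \<Longrightarrow> i \<in> {1..n} \<Longrightarrow> \<beta> (int i) \<noteq> 0"
  using abs_perm_in[of \<beta> n i] by (auto simp: abs_perm_def)

lemma hyperI:
  assumes "\<And>z. \<beta> (- z) = - \<beta> z" "bij_betw (abs_perm \<beta>) {1..n} {1..n}" "\<And>z. \<bar>z\<bar> > int n \<Longrightarrow> \<beta> z = z"
  shows "\<beta> \<in> hyperoctahedral n"
  using assms unfolding hyperoctahedral_def abs_perm_def[abs_def] by auto

lemma hyper_eqI:
  assumes "\<beta> \<in> hyperoctahedral n" "\<gamma> \<in> hyperoctahedral n"
    and "\<And>i. i \<in> {1..n} \<Longrightarrow> \<beta> (int i) = \<gamma> (int i)"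
  shows "\<beta> = \<gamma>"
proof
  fix z
  have nonneg: "\<beta> (int i) = \<gamma> (int i)" for i
  proof -
    consider "i = 0" | "i \<in> {1..n}" | "int i > int n" by force
    then show ?thesis
    proof cases
      case 3
      then show ?thesis using hyper_out[OF assms(1)] hyper_out[OF assms(2)] by simp
    qed (use assms hyper_zero[OF assms(1)] hyper_zero[OF assms(2)] in auto)
  qed
  show "\<beta> z = \<gamma> z"
  proof (cases "z \<ge> 0")
    case True
    then show ?thesis using nonneg[of "nat z"] by simp
  next
    case False
    then show ?thesis using nonneg[of "nat (- z)"] hyper_odd[OF assms(1), of z] hyper_odd[OF assms(2), of z]
      by simp
  qed
qed

lemma abs_perm_comp: "\<beta> \<in> hyperoctahedral n \<Longrightarrow> abs_perm (\<beta> \<circ> \<gamma>) i = abs_perm \<beta> (abs_perm \<gamma> i)"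
  using abs_perm_abs[of \<beta> n "\<gamma> (int i)"] by (simp add: abs_perm_def)

lemma hyper_id: "id \<in> hyperoctahedral n"
  by (rule hyperI) (auto simp: abs_perm_def[abs_def] bij_betw_def)

lemma hyper_comp:
  assumes "\<beta> \<in> hyperoctahedral n" "\<gamma> \<in> hyperoctahedral n"
  shows "\<beta> \<circ> \<gamma> \<in> hyperoctahedral n"
proof (rule hyperI)
  have "bij_betw (abs_perm \<beta> \<circ> abs_perm \<gamma>) {1..n} {1..n}"
    using hyper_bij assms by (blast intro: bij_betw_trans)
  moreover have "abs_perm \<beta> \<circ> abs_perm \<gamma> = abs_perm (\<beta> \<circ> \<gamma>)" using abs_perm_comp[OF assms(1)] by (simp add: fun_eq_iff)
  ultimately show "bij_betw (abs_perm (\<beta> \<circ> \<gamma>)) {1..n} {1..n}" by simp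
  show "(\<beta> \<circ> \<gamma>) (- z) = - (\<beta> \<circ> \<gamma>) z" for z
    using hyper_odd[OF assms(1)] hyper_odd[OF assms(2)] by simp
  show "(\<beta> \<circ> \<gamma>) z = z" if "\<bar>z\<bar> > int n" for z
    using hyper_out[OF assms(1) that] hyper_out[OF assms(2) that] by simp
qed

lemma hyper_bij_UNIV:
  assumes G: "\<beta> \<in> hyperoctahedral n"
  shows "bij \<beta>"
proof (rule bijI)
  have inside: "nat \<bar>\<beta> z\<bar> \<in> {1..n}" if "nat \<bar>z\<bar> \<in> {1..n}" for z
    using abs_perm_in[OF G that] abs_perm_abs[OF G] by metis
  have cases: "nat \<bar>z\<bar> \<in> {1..n} \<or> z = 0 \<or> \<bar>z\<bar> > int n" for z by auto
  show "inj \<beta>"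
  proof (rule injI)
    fix z w assume eq: "\<beta> z = \<beta> w"
    show "z = w"
    proof (cases "nat \<bar>z\<bar> \<in> {1..n} \<and> nat \<bar>w\<bar> \<in> {1..n}")
      case True
      have "abs_perm \<beta> (nat \<bar>z\<bar>) = abs_perm \<beta> (nat \<bar>w\<bar>)" using abs_perm_abs[OF G] eq by simp
      then have "nat \<bar>z\<bar> = nat \<bar>w\<bar>" using abs_perm_inj[OF G] True by (auto dest: inj_onD)
      then have "z = w \<or> w = - z" by linarith
      moreover have "\<beta> z \<noteq> 0" using inside[of z] True by auto
      ultimately show ?thesis using eq hyper_odd[OF G, of z] by auto
    next
      case False
      then show ?thesis using cases[of z] cases[of w] inside[of z] inside[of w] eq
          hyper_out[OF G, of z] hyper_out[OF G, of w] hyper_zero[OF G] by auto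
    qed
  qed
  show "surj \<beta>"
  proof (rule surjI[of _ "\<lambda>y. SOME z. \<beta> z = y"])
    fix y
    have "\<exists>z. \<beta> z = y"
    proof (cases "nat \<bar>y\<bar> \<in> {1..n}")
      case True
      then have "nat \<bar>y\<bar> \<in> abs_perm \<beta> ` {1..n}" using hyper_bij[OF G] by (simp add: bij_betw_def)
      then obtain i where "abs_perm \<beta> i = nat \<bar>y\<bar>" by auto
      then have "\<beta> (int i) = y \<or> \<beta> (int i) = - y" unfolding abs_perm_def by linarith
      then show ?thesis using hyper_odd[OF G, of "int i"] by (metis minus_minus)
    next
      case False
      then show ?thesis using cases[of y] hyper_zero[OF G] hyper_out[OF G, of y] by blast
    qed
    then show "\<beta> (SOME z. \<beta> z = y) = y" by (rule someI_ex)
  qed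
qed

abbreviation hinv :: "(int \<Rightarrow> int) \<Rightarrow> int \<Rightarrow> int" where
  "hinv \<beta> \<equiv> inv_into UNIV \<beta>"

lemma inv_hyper:
  assumes "\<beta> \<in> hyperoctahedral n"
  shows "hinv \<beta> (\<beta> z) = z" "\<beta> (hinv \<beta> z) = z"
  using hyper_bij_UNIV[OF assms] by (auto simp: bij_is_inj bij_is_surj surj_f_inv_f)

lemma
  assumes G: "\<beta> \<in> hyperoctahedral n"
  shows hyper_inv: "hinv \<beta> \<in> hyperoctahedral n"
    and abs_perm_inv: "abs_perm (hinv \<beta>) (abs_perm \<beta> i) = i"
    and abs_perm_inv': "i \<in> {1..n} \<Longrightarrow> abs_perm \<beta> (abs_perm (hinv \<beta>) i) = i"
proof -
  note I = inv_hyper[OF G]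
  have odd: "hinv \<beta> (- z) = - hinv \<beta> z" for z
    using I(1)[of "- hinv \<beta> z"] hyper_odd[OF G, of "hinv \<beta> z"] I(2)[of z] by simp
  have *: "abs_perm (hinv \<beta>) (abs_perm \<beta> i) = i" for i
  proof -
    have "abs_perm \<beta> i = nat (\<beta> (int i)) \<or> abs_perm \<beta> i = nat (- \<beta> (int i))" unfolding abs_perm_def by linarith
    then have "int (abs_perm \<beta> i) = \<beta> (int i) \<or> int (abs_perm \<beta> i) = - \<beta> (int i)" unfolding abs_perm_def by linarith
    then show ?thesis using odd[of "\<beta> (int i)"] I(1)[of "int i"] unfolding abs_perm_def[of "hinv \<beta>"] by auto
  qed
  have **: "abs_perm \<beta> (abs_perm (hinv \<beta>) i) = i \<and> abs_perm (hinv \<beta>) i \<in> {1..n}" if "i \<in> {1..n}" for i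
  proof -
    have "i \<in> abs_perm \<beta> ` {1..n}" using that hyper_bij[OF G] by (simp add: bij_betw_def)
    then show ?thesis using * by auto
  qed
  show "hinv \<beta> \<in> hyperoctahedral n"
  proof (rule hyperI)
    show "hinv \<beta> (- z) = - hinv \<beta> z" for z by (rule odd)
    show "bij_betw (abs_perm (hinv \<beta>)) {1..n} {1..n}"
      by (rule bij_betw_byWitness[where f' = "abs_perm \<beta>"]) (use * ** abs_perm_in[OF G] in blast)+
    show "hinv \<beta> z = z" if "\<bar>z\<bar> > int n" for z
      using I(1)[of z] hyper_out[OF G that] by simp
  qed
  show "abs_perm (hinv \<beta>) (abs_perm \<beta> i) = i" by (rule *)
  show "abs_perm \<beta> (abs_perm (hinv \<beta>) i) = i" if "i \<in> {1..n}" using ** that by blast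
qed

lemma inv_neg_iff:
  assumes G: "\<beta> \<in> hyperoctahedral n" and i: "i \<in> {1..n}"
  shows "hinv \<beta> (int (abs_perm \<beta> i)) < 0 \<longleftrightarrow> \<beta> (int i) < 0"
proof (cases "\<beta> (int i) < 0")
  case True
  then have "int (abs_perm \<beta> i) = - \<beta> (int i)" by (simp add: abs_perm_def)
  then have "hinv \<beta> (int (abs_perm \<beta> i)) = - int i"
    using hyper_odd[OF hyper_inv[OF G], of "\<beta> (int i)"] inv_hyper(1)[OF G] by simp
  then show ?thesis using True i by simp
next
  case False
  then have "int (abs_perm \<beta> i) = \<beta> (int i)" by (simp add: abs_perm_def)
  then show ?thesis using inv_hyper(1)[OF G] False by simp
qed

lemma finite_hyperoctahedral: "finite (hyperoctahedral n)"
proof -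
  let ?F = "\<lambda>\<beta>::int \<Rightarrow> int. restrict (\<lambda>i. \<beta> (int i)) {1..n}"
  have "inj_on ?F (hyperoctahedral n)"
  proof (rule inj_onI)
    fix \<beta> \<gamma> assume G: "\<beta> \<in> hyperoctahedral n" "\<gamma> \<in> hyperoctahedral n" and eq: "?F \<beta> = ?F \<gamma>"
    show "\<beta> = \<gamma>"
    proof (rule hyper_eqI[OF G])
      fix i assume "i \<in> {1..n}"
      then show "\<beta> (int i) = \<gamma> (int i)" using fun_cong[OF eq, of i] by simp
    qed
  qed
  moreover have "?F ` hyperoctahedral n \<subseteq> {1..n} \<rightarrow>\<^sub>E {- int n..int n}"
  proof (intro image_subsetI PiE_I)
    fix \<beta> i assume "\<beta> \<in> hyperoctahedral n" "i \<in> {1..n}"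
    then show "?F \<beta> i \<in> {- int n..int n}" using abs_perm_in[of \<beta> n i] by (auto simp: abs_perm_def)
  qed auto
  then have "finite (?F ` hyperoctahedral n)"
    by (rule finite_subset) (intro finite_PiE; simp)
  ultimately show ?thesis by (rule finite_imageD[rotated])
qed

definition signed_perm :: "nat \<Rightarrow> (nat \<Rightarrow> nat) \<Rightarrow> (nat \<Rightarrow> bool) \<Rightarrow> int \<Rightarrow> int" where
  "signed_perm n p e z = (if 1 \<le> \<bar>z\<bar> \<and> \<bar>z\<bar> \<le> int n
     then sgn z * (if e (nat \<bar>z\<bar>) then - 1 else 1) * int (p (nat \<bar>z\<bar>)) else z)"

lemma
  assumes p: "bij_betw p {1..n} {1..n}"
  shows signed_perm_hyper: "signed_perm n p e \<in> hyperoctahedral n"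
    and abs_perm_signed_perm: "i \<in> {1..n} \<Longrightarrow> abs_perm (signed_perm n p e) i = p i"
    and signed_perm_neg: "i \<in> {1..n} \<Longrightarrow> signed_perm n p e (int i) < 0 \<longleftrightarrow> e i"
proof -
  have *: "p i \<in> {1..n}" if "i \<in> {1..n}" for i using p that by (rule bij_betw_apply)
  show pmp: "abs_perm (signed_perm n p e) i = p i" if "i \<in> {1..n}" for i
    using that by (auto simp: abs_perm_def signed_perm_def abs_mult)
  show "signed_perm n p e (int i) < 0 \<longleftrightarrow> e i" if "i \<in> {1..n}" for i
    using that *[of i] by (auto simp: signed_perm_def)
  show "signed_perm n p e \<in> hyperoctahedral n"
  proof (rule hyperI)
    show "bij_betw (abs_perm (signed_perm n p e)) {1..n} {1..n}"
      using p pmp by (subst bij_betw_cong[of _ _ p]) auto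
  qed (auto simp: signed_perm_def)
qed

definition flag :: "nat \<Rightarrow> (int \<Rightarrow> int) \<Rightarrow> nat \<Rightarrow> nat" where
  "flag n \<beta> i = 2 * card {j \<in> Des n \<beta>. i \<le> j} + (if \<beta> (int i) < 0 then 1 else 0)"

lemma odd_flag: "odd (flag n \<beta> i) \<longleftrightarrow> \<beta> (int i) < 0"
  by (simp add: flag_def)

lemma Des_subset: "Des n \<beta> \<subseteq> {1..n - 1}"
  by (auto simp: Des_def)

lemma sum_flag: "(\<Sum>i = 1..n. flag n \<beta> i) = fmaj n \<beta>"
proof -
  have fin: "finite (Des n \<beta>)" using finite_subset[OF Des_subset] by simp
  have "(\<Sum>i = 1..n. card {j \<in> Des n \<beta>. i \<le> j}) = (\<Sum>i = 1..n. \<Sum>j\<in>Des n \<beta>. if i \<le> j then 1 else 0)"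
    using fin by (simp add: sum.If_cases Int_def)
  also have "\<dots> = (\<Sum>j\<in>Des n \<beta>. \<Sum>i = 1..n. if i \<le> j then 1 else 0)" by (rule sum.swap)
  also have "\<dots> = maj n \<beta>" unfolding maj_def
  proof (rule sum.cong[OF refl])
    fix j assume "j \<in> Des n \<beta>"
    then have "{1..n} \<inter> {i. i \<le> j} = {1..j}" using Des_subset[of n \<beta>] by force
    then show "(\<Sum>i = 1..n. if i \<le> j then 1 else 0) = j" by (simp add: sum.If_cases)
  qed
  finally have 1: "(\<Sum>i = 1..n. card {j \<in> Des n \<beta>. i \<le> j}) = maj n \<beta>" .
  have "{1..n} \<inter> {i. \<beta> (int i) < 0} = {i \<in> {1..n}. \<beta> (int i) < 0}" by auto
  then have 2: "(\<Sum>i = 1..n. if \<beta> (int i) < 0 then 1 else 0) = neg n \<beta>"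
    by (simp add: neg_def sum.If_cases)
  show ?thesis unfolding fmaj_def flag_def sum.distrib sum_distrib_left[symmetric] 1 2 ..
qed

lemma Des_iff:
  assumes G: "\<beta> \<in> hyperoctahedral n" and i: "1 \<le> i" "i < n"
  shows "i \<in> Des n \<beta> \<longleftrightarrow> (if \<beta> (int i) < 0 \<longleftrightarrow> \<beta> (int (Suc i)) < 0
     then abs_perm \<beta> (Suc i) < abs_perm \<beta> i else \<beta> (int (Suc i)) < 0)"
  using hyper_nonzero[OF G, of i] hyper_nonzero[OF G, of "Suc i"] i
  by (auto simp: Des_def neg_first_less_def abs_perm_def)

lemma flag_Suc:
  assumes "1 \<le> i" "i < n"
  shows "flag n \<beta> i + (if \<beta> (int (Suc i)) < 0 then 1 else 0) =
    flag n \<beta> (Suc i) + (if i \<in> Des n \<beta> then 2 else 0) + (if \<beta> (int i) < 0 then 1 else 0)"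
proof -
  have fin: "finite (Des n \<beta>)" using finite_subset[OF Des_subset] by simp
  have "{j \<in> Des n \<beta>. i \<le> j} = {j \<in> Des n \<beta>. Suc i \<le> j} \<union> (if i \<in> Des n \<beta> then {i} else {})"
    by (auto simp: le_Suc_eq less_eq_Suc_le[symmetric] order.order_iff_strict)
  then have "card {j \<in> Des n \<beta>. i \<le> j} = card {j \<in> Des n \<beta>. Suc i \<le> j} + (if i \<in> Des n \<beta> then 1 else 0)"
    using fin by (auto simp: card_insert_if)
  then show ?thesis unfolding flag_def by auto
qed

lemma flag_last: "flag n \<beta> n = (if \<beta> (int n) < 0 then 1 else 0)"
proof -
  have "{j \<in> Des n \<beta>. n \<le> j} = {}" using Des_subset[of n \<beta>] by fastforce
  then have "card {j \<in> Des n \<beta>. n \<le> j} = 0" by (simp only: card.empty)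
  then show ?thesis unfolding flag_def by simp
qed

lemma step_chain:
  assumes "\<And>i. 1 \<le> i \<Longrightarrow> i < n \<Longrightarrow> P i (Suc i)" "\<And>i j k. P i j \<Longrightarrow> P j k \<Longrightarrow> P i k"
    and "1 \<le> i" "i < j" "j \<le> (n::nat)"
  shows "P i j"
  using assms(4,5)
proof (induction j)
  case (Suc j)
  then show ?case using assms(1)[of j] assms(2)[of i j "Suc j"] assms(1)[of i] assms(3)
    by (cases "i = j") auto
qed simp

text \<open>
  A flag vector is constant only along ascents between entries of equal sign, and there
  the absolute values increase.
\<close>

lemma flag_decreasing:
  assumes G: "\<beta> \<in> hyperoctahedral n" and ij: "i \<in> {1..n}" "j \<in> {1..n}" "i < j"
  shows "flag n \<beta> j \<le> flag n \<beta> i \<and> (flag n \<beta> i = flag n \<beta> j \<longrightarrow> abs_perm \<beta> i < abs_perm \<beta> j)"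
proof -
  define P where "P i j \<longleftrightarrow> flag n \<beta> j \<le> flag n \<beta> i \<and> (flag n \<beta> i = flag n \<beta> j \<longrightarrow> abs_perm \<beta> i < abs_perm \<beta> j)" for i j
  have "P i (Suc i)" if i: "1 \<le> i" "i < n" for i
  proof -
    have "abs_perm \<beta> i \<noteq> abs_perm \<beta> (Suc i)" using abs_perm_inj[OF G] i by (auto dest: inj_onD)
    then show ?thesis using flag_Suc[OF i, of \<beta>] Des_iff[OF G i] unfolding P_def
      by (auto split: if_splits)
  qed
  moreover have "P i k" if "P i j" "P j k" for i j k
    using that unfolding P_def by auto
  ultimately have "P i j"
    by (rule step_chain[of n P]) (use ij in auto)
  then show ?thesis by (simp add: P_def)
qed

text \<open>
  Among the decreasing sequences with the parities prescribed by the signs of \<open>\<beta>\<close> that are constant only where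
  \<open>|\<beta>|\<close> increases, the flag vector is the smallest, and the difference is again decreasing:
  parity upgrades a strict decrease between equal signs to a decrease by two, which is all
  that a descent demands, and at a change of sign a decrease by one suffices.
\<close>

lemma flag_minimal:
  assumes G: "\<beta> \<in> hyperoctahedral n"
    and par: "\<forall>i\<in>{1..n}. odd (A i) \<longleftrightarrow> \<beta> (int i) < 0"
    and dec: "\<forall>i. 1 \<le> i \<and> i < n \<longrightarrow> A (Suc i) \<le> A i \<and> (A i = A (Suc i) \<longrightarrow> abs_perm \<beta> i < abs_perm \<beta> (Suc i))"
    and i: "i \<in> {1..n}"
  shows "flag n \<beta> i \<le> A i" "even (A i - flag n \<beta> i)"
    and "j \<in> {1..n} \<Longrightarrow> i < j \<Longrightarrow> A j - flag n \<beta> j \<le> A i - flag n \<beta> i"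
proof -
  have step: "flag n \<beta> i + A (Suc i) \<le> A i + flag n \<beta> (Suc i)" if i: "1 \<le> i" "i < n" for i
  proof -
    have "abs_perm \<beta> i \<noteq> abs_perm \<beta> (Suc i)" using abs_perm_inj[OF G] i by (auto dest: inj_onD)
    moreover have "A (Suc i) < A i \<Longrightarrow> (odd (A i) \<longleftrightarrow> odd (A (Suc i))) \<Longrightarrow> A (Suc i) + 2 \<le> A i"
      by presburger
    ultimately show ?thesis
      using flag_Suc[OF i, of \<beta>] Des_iff[OF G i] dec[rule_format, of i] bspec[OF par, of i] bspec[OF par, of "Suc i"] i
      by (cases "A i = A (Suc i)"; cases "\<beta> (int i) < 0"; cases "\<beta> (int (Suc i)) < 0") (auto split: if_splits)
  qed
  have chain: "flag n \<beta> i + A j \<le> A i + flag n \<beta> j" if "i \<in> {1..n}" "j \<in> {1..n}" "i < j" for i j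
    by (rule step_chain[of n "\<lambda>i j. flag n \<beta> i + A j \<le> A i + flag n \<beta> j"]) (use step that in auto)
  have le: "flag n \<beta> i \<le> A i" if "i \<in> {1..n}" for i
  proof -
    have "flag n \<beta> n \<le> A n" using that bspec[OF par, of n] odd_pos[of "A n"] unfolding flag_last by auto
    then show ?thesis using chain[OF that, of n] that by (cases "i = n") auto
  qed
  show "flag n \<beta> i \<le> A i" using le i .
  show "even (A i - flag n \<beta> i)" using le[OF i] bspec[OF par i] odd_flag[of n \<beta> i] by auto
  show "A j - flag n \<beta> j \<le> A i - flag n \<beta> i" if "j \<in> {1..n}" "i < j"
    using le[OF i] le[OF that(1)] chain[OF i that] by linarith
qed

abbreviation inv_flag :: "nat \<Rightarrow> (int \<Rightarrow> int) \<Rightarrow> nat \<Rightarrow> nat" where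
  "inv_flag n \<beta> i \<equiv> flag n (hinv \<beta>) (abs_perm \<beta> i)"

lemma sum_inv_flag: "\<beta> \<in> hyperoctahedral n \<Longrightarrow> (\<Sum>i = 1..n. inv_flag n \<beta> i) = fmaj n (hinv \<beta>)"
  using sum.reindex_bij_betw[OF hyper_bij, of \<beta> n "flag n (hinv \<beta>)"] sum_flag by simp

lemma compatible_flag:
  assumes G: "\<beta> \<in> hyperoctahedral n"
  shows "compatible n (abs_perm \<beta>) (flag n \<beta>) (inv_flag n \<beta>)"
  unfolding compatible_def
proof (intro ballI conjI impI)
  fix i j assume i: "i \<in> {1..n}" and j: "j \<in> {1..n}"
  { assume "i < j"
    then show "flag n \<beta> j \<le> flag n \<beta> i" using flag_decreasing[OF G i j] by blast }
  { assume "i < j" "flag n \<beta> i = flag n \<beta> j"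
    then show "abs_perm \<beta> i < abs_perm \<beta> j" using flag_decreasing[OF G i j] by blast }
  note d = flag_decreasing[OF hyper_inv[OF G] abs_perm_in[OF G i] abs_perm_in[OF G j]]
  { assume "abs_perm \<beta> i < abs_perm \<beta> j"
    then show "inv_flag n \<beta> j \<le> inv_flag n \<beta> i" using d by blast }
  { assume "abs_perm \<beta> i < abs_perm \<beta> j" "inv_flag n \<beta> i = inv_flag n \<beta> j"
    then show "i < j" using d abs_perm_inv[OF G] by simp }
qed

lemma compatible_add:
  assumes "compatible n \<sigma> a b"
    and l: "\<And>i j. i \<in> {1..n} \<Longrightarrow> j \<in> {1..n} \<Longrightarrow> i < j \<Longrightarrow> l j \<le> l i"
    and m: "\<And>i j. i \<in> {1..n} \<Longrightarrow> j \<in> {1..n} \<Longrightarrow> \<sigma> i < \<sigma> j \<Longrightarrow> m j \<le> m i"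
  shows "compatible n \<sigma> (\<lambda>i. a i + l i) (\<lambda>i. b i + m i)"
  unfolding compatible_def
proof (intro ballI)
  fix i j assume i: "i \<in> {1..n}" and j: "j \<in> {1..n}"
  show "(i < j \<longrightarrow> a j + l j \<le> a i + l i \<and> (a i + l i = a j + l j \<longrightarrow> \<sigma> i < \<sigma> j)) \<and>
       (\<sigma> i < \<sigma> j \<longrightarrow> b j + m j \<le> b i + m i \<and> (b i + m i = b j + m j \<longrightarrow> i < j))"
    using assms(1)[unfolded compatible_def, rule_format, OF i j] l[OF i j] m[OF i j] by auto
qed

text \<open>
  The standardization of \<open>c\<close>: larger values come first and ties are broken from left to right.
\<close>

definition rank :: "nat \<Rightarrow> (nat \<Rightarrow> nat) \<Rightarrow> nat \<Rightarrow> nat" where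
  "rank n c i = card {j \<in> {1..n}. c i < c j \<or> c j = c i \<and> j \<le> i}"

lemma rank_less:
  assumes "i \<in> {1..n}" "j \<in> {1..n}"
  shows "rank n c i < rank n c j \<longleftrightarrow> c j < c i \<or> c i = c j \<and> i < j"
proof -
  have *: "rank n c i < rank n c j" if "j \<in> {1..n}" "c j < c i \<or> c i = c j \<and> i < j" for i j
    unfolding rank_def using that by (intro psubset_card_mono) auto
  show ?thesis
    using *[of j i] *[of i j] assms by (cases i j rule: linorder_cases; cases "c i" "c j" rule: linorder_cases) auto
qed

lemma rank_bij: "bij_betw (rank n c) {1..n} {1..n}"
proof -
  have inj: "inj_on (rank n c) {1..n}"
  proof (rule inj_onI)
    fix i j assume "i \<in> {1..n}" "j \<in> {1..n}" "rank n c i = rank n c j"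
    then show "i = j" using rank_less[of i n j c] rank_less[of j n i c]
      by (cases i j rule: linorder_cases; cases "c i" "c j" rule: linorder_cases) auto
  qed
  have "rank n c ` {1..n} \<subseteq> {1..n}"
  proof (rule image_subsetI)
    fix i assume i: "i \<in> {1..n}"
    have "rank n c i \<le> card {1..n}" unfolding rank_def by (rule card_mono) auto
    moreover have "rank n c i > 0" unfolding rank_def using i by (auto simp: card_gt_0_iff)
    ultimately show "rank n c i \<in> {1..n}" by simp
  qed
  then show ?thesis using inj by (simp add: bij_betw_def endo_inj_surj)
qed

definition sort_desc :: "nat \<Rightarrow> (nat \<Rightarrow> nat) \<Rightarrow> nat \<Rightarrow> nat" where
  "sort_desc n u k = u (inv_into {1..n} (rank n u) k)"

lemma sort_desc_rank: "i \<in> {1..n} \<Longrightarrow> sort_desc n u (rank n u i) = u i"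
  unfolding sort_desc_def using bij_betw_inv_into_left[OF rank_bij] by simp

lemma sort_desc_decreasing:
  assumes "i \<in> {1..n}" "j \<in> {1..n}" "i < j"
  shows "sort_desc n u j \<le> sort_desc n u i"
proof -
  let ?r = "inv_into {1..n} (rank n u)"
  have "rank n u (?r i) < rank n u (?r j)"
    using bij_betw_inv_into_right[OF rank_bij] assms by metis
  moreover have "?r i \<in> {1..n}" "?r j \<in> {1..n}"
    using bij_betw_apply[OF bij_betw_inv_into[OF rank_bij]] assms by blast+
  ultimately show ?thesis unfolding sort_desc_def using rank_less[of "?r i" n "?r j" u] by auto
qed

lemma diagram_permute:
  assumes "bij_betw p {1..n} {1..n}"
  shows "diagram n (\<lambda>i. A (p i)) (\<lambda>i. B (p i)) = diagram n A B"
proof -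
  have "image_mset p (mset_set {1..n}) = mset_set {1..n}"
    using assms by (simp add: bij_betw_def image_mset_mset_set)
  then show ?thesis unfolding diagram_def
    by (metis (no_types, lifting) image_mset.compositionality image_mset_cong comp_apply)
qed

lemma diagram_cong:
  "(\<And>i. i \<in> {1..n} \<Longrightarrow> A i = A' i \<and> B i = B' i) \<Longrightarrow> diagram n A B = diagram n A' B'"
  unfolding diagram_def by (rule image_mset_cong) auto

text \<open>
  The even increments that may be added to the two flag vectors of \<open>\<beta>\<close> without destroying
  compatibility with \<open>|\<beta>|\<close>.
\<close>

definition decomposes :: "nat \<Rightarrow> (int \<Rightarrow> int) \<Rightarrow> (nat \<Rightarrow> nat) \<Rightarrow> (nat \<Rightarrow> nat) \<Rightarrow> bool" where
  "decomposes n \<beta> l m \<longleftrightarrow> (\<forall>i\<in>{1..n}. even (l i) \<and> even (m i)) \<and>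
     (\<forall>i\<in>{1..n}. \<forall>j\<in>{1..n}. (i < j \<longrightarrow> l j \<le> l i) \<and> (abs_perm \<beta> i < abs_perm \<beta> j \<longrightarrow> m j \<le> m i))"

text \<open>
  Sorting the pairs lexicographically and standardizing the second entries gives \<open>|\<beta>|\<close>; the
  common parity of the two entries of each pair gives the signs. Minimality of the flag vector is
  then applied to \<open>\<beta>\<close> with the first entries and to $\beta^{-1}$ with the second ones.
\<close>

lemma decomposition_exists:
  assumes par: "\<And>i. i \<in> {1..n} \<Longrightarrow> even (A i + B i)"
  obtains \<beta> l m where "\<beta> \<in> hyperoctahedral n" "decomposes n \<beta> l m"
    "diagram n A B = diagram n (\<lambda>i. flag n \<beta> i + l i) (\<lambda>i. inv_flag n \<beta> i + m i)"
proof -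
  \<comment> \<open>Coding pairs as numbers in base \<open>K\<close> makes the lexicographic order the order of numbers.\<close>
  define K where "K = Suc (\<Sum>i = 1..n. B i)"
  define c where "c i = A i * K + B i" for i
  have BK: "B i < K" if "i \<in> {1..n}" for i
    using member_le_sum[of i "{1..n}" B] that unfolding K_def by simp
  have c_le: "A j \<le> A i \<and> (A i = A j \<longrightarrow> B j \<le> B i)" if "i \<in> {1..n}" "j \<in> {1..n}" "c j \<le> c i" for i j
  proof -
    have "\<not> A i < A j"
    proof
      assume "A i < A j"
      then have "Suc (A i) * K \<le> A j * K" by (intro mult_le_mono1) simp
      then show False using BK[OF that(1)] that(3) unfolding c_def by simp
    qed
    then show ?thesis using that(3) unfolding c_def by auto
  qed
  define p where "p = inv_into {1..n} (rank n c)"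
  have p: "bij_betw p {1..n} {1..n}" unfolding p_def by (rule bij_betw_inv_into[OF rank_bij])
  have rp: "rank n c (p i) = i" if "i \<in> {1..n}" for i
    unfolding p_def using rank_bij that by (rule bij_betw_inv_into_right)
  have pin: "p i \<in> {1..n}" if "i \<in> {1..n}" for i using p that by (rule bij_betw_apply)
  define A1 where "A1 i = A (p i)" for i
  define B1 where "B1 i = B (p i)" for i
  have sorted: "A1 j \<le> A1 i \<and> (A1 i = A1 j \<longrightarrow> B1 j \<le> B1 i)" if "i \<in> {1..n}" "j \<in> {1..n}" "i < j" for i j
  proof -
    have "rank n c (p i) < rank n c (p j)" using rp that by simp
    then have "c (p j) \<le> c (p i)" using rank_less[OF pin pin, OF that(1,2)] by auto
    then show ?thesis using c_le[OF pin pin, OF that(1,2)] unfolding A1_def B1_def by simp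
  qed
  define \<sigma> where "\<sigma> = rank n B1"
  have \<sigma>: "bij_betw \<sigma> {1..n} {1..n}" unfolding \<sigma>_def by (rule rank_bij)
  have \<sigma>_less: "\<sigma> i < \<sigma> j \<longleftrightarrow> B1 j < B1 i \<or> B1 i = B1 j \<and> i < j" if "i \<in> {1..n}" "j \<in> {1..n}" for i j
    unfolding \<sigma>_def by (rule rank_less[OF that])
  define \<beta> where "\<beta> = signed_perm n \<sigma> (\<lambda>i. odd (A1 i))"
  have G: "\<beta> \<in> hyperoctahedral n" unfolding \<beta>_def by (rule signed_perm_hyper[OF \<sigma>])
  have pmb: "abs_perm \<beta> i = \<sigma> i" if "i \<in> {1..n}" for i unfolding \<beta>_def by (rule abs_perm_signed_perm[OF \<sigma> that])
  have negb: "\<beta> (int i) < 0 \<longleftrightarrow> odd (A1 i)" if "i \<in> {1..n}" for i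
    unfolding \<beta>_def by (rule signed_perm_neg[OF \<sigma> that])
  have par1: "odd (A1 i) \<longleftrightarrow> odd (B1 i)" if "i \<in> {1..n}" for i
    using par[OF pin[OF that]] unfolding A1_def B1_def by auto
  have dec1: "\<forall>i. 1 \<le> i \<and> i < n \<longrightarrow> A1 (Suc i) \<le> A1 i \<and> (A1 i = A1 (Suc i) \<longrightarrow> abs_perm \<beta> i < abs_perm \<beta> (Suc i))"
  proof (intro allI impI)
    fix i assume "1 \<le> i \<and> i < n"
    then show "A1 (Suc i) \<le> A1 i \<and> (A1 i = A1 (Suc i) \<longrightarrow> abs_perm \<beta> i < abs_perm \<beta> (Suc i))"
      using sorted[of i "Suc i"] \<sigma>_less[of i "Suc i"] pmb[of i] pmb[of "Suc i"] by auto
  qed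
  have "\<forall>i\<in>{1..n}. odd (A1 i) \<longleftrightarrow> \<beta> (int i) < 0" using negb by blast
  note min1 = flag_minimal[OF G this dec1]
  define A2 where "A2 k = B1 (abs_perm (hinv \<beta>) k)" for k
  note iG = hyper_inv[OF G]
  have neg2: "hinv \<beta> (int k) < 0 \<longleftrightarrow> odd (A2 k)" if "k \<in> {1..n}" for k
    using inv_neg_iff[OF G abs_perm_in[OF iG that]] abs_perm_inv'[OF G that] negb[OF abs_perm_in[OF iG that]]
      par1[OF abs_perm_in[OF iG that]] unfolding A2_def by simp
  have dec2: "\<forall>k. 1 \<le> k \<and> k < n \<longrightarrow>
      A2 (Suc k) \<le> A2 k \<and> (A2 k = A2 (Suc k) \<longrightarrow> abs_perm (hinv \<beta>) k < abs_perm (hinv \<beta>) (Suc k))"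
  proof (intro allI impI)
    fix k assume that: "1 \<le> k \<and> k < n"
    have k: "k \<in> {1..n}" "Suc k \<in> {1..n}" using that by auto
    note ik = abs_perm_in[OF iG k(1)] abs_perm_in[OF iG k(2)]
    have "\<sigma> (abs_perm (hinv \<beta>) k) < \<sigma> (abs_perm (hinv \<beta>) (Suc k))"
      using pmb[OF ik(1)] pmb[OF ik(2)] abs_perm_inv'[OF G k(1)] abs_perm_inv'[OF G k(2)] by simp
    then show "A2 (Suc k) \<le> A2 k \<and> (A2 k = A2 (Suc k) \<longrightarrow> abs_perm (hinv \<beta>) k < abs_perm (hinv \<beta>) (Suc k))"
      using \<sigma>_less[OF ik] unfolding A2_def by auto
  qed
  have "\<forall>i\<in>{1..n}. odd (A2 i) \<longleftrightarrow> hinv \<beta> (int i) < 0" using neg2 by blast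
  note min2 = flag_minimal[OF iG this dec2]
  define l where "l i = A1 i - flag n \<beta> i" for i
  define m where "m i = B1 i - inv_flag n \<beta> i" for i
  have A2pm: "A2 (abs_perm \<beta> i) = B1 i" for i using abs_perm_inv[OF G] unfolding A2_def by simp
  have "decomposes n \<beta> l m" unfolding decomposes_def
  proof (intro conjI ballI impI)
    fix i assume i: "i \<in> {1..n}"
    show "even (l i)" using min1(2)[OF i] unfolding l_def by simp
    show "even (m i)" using min2(2)[OF abs_perm_in[OF G i]] unfolding m_def A2pm by simp
    fix j assume j: "j \<in> {1..n}"
    { assume "i < j"
      then show "l j \<le> l i" using min1(3)[OF i j] unfolding l_def by simp }
    { assume "abs_perm \<beta> i < abs_perm \<beta> j"
      then show "m j \<le> m i" using min2(3)[OF abs_perm_in[OF G i] abs_perm_in[OF G j]] unfolding m_def A2pm by simp }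
  qed
  moreover have "diagram n A B = diagram n (\<lambda>i. flag n \<beta> i + l i) (\<lambda>i. inv_flag n \<beta> i + m i)"
  proof -
    have "diagram n A B = diagram n A1 B1" unfolding A1_def B1_def by (rule diagram_permute[OF p, symmetric])
    also have "\<dots> = diagram n (\<lambda>i. flag n \<beta> i + l i) (\<lambda>i. inv_flag n \<beta> i + m i)"
    proof (rule diagram_cong)
      fix i assume i: "i \<in> {1..n}"
      show "A1 i = flag n \<beta> i + l i \<and> B1 i = inv_flag n \<beta> i + m i"
        using min1(1)[OF i] min2(1)[OF abs_perm_in[OF G i]] unfolding l_def m_def A2pm by simp
    qed
    finally show ?thesis .
  qed
  ultimately show ?thesis using that G by blast
qed

text \<open>
  The superlevel sets of a decreasing sequence are initial segments, so their sizes determine it.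
\<close>

lemma decreasing_unique:
  fixes c c' :: "nat \<Rightarrow> nat"
  assumes c: "\<And>i j. i \<in> {1..n} \<Longrightarrow> j \<in> {1..n} \<Longrightarrow> i < j \<Longrightarrow> c j \<le> c i"
    and c': "\<And>i j. i \<in> {1..n} \<Longrightarrow> j \<in> {1..n} \<Longrightarrow> i < j \<Longrightarrow> c' j \<le> c' i"
    and eq: "\<And>s. card {i \<in> {1..n}. s \<le> c i} = card {i \<in> {1..n}. s \<le> c' i}"
    and i: "i \<in> {1..n}"
  shows "c i = c' i"
proof -
  have *: "s \<le> c i \<longleftrightarrow> i \<le> card {j \<in> {1..n}. s \<le> c j}"
    if d: "\<And>i j. i \<in> {1..n} \<Longrightarrow> j \<in> {1..n} \<Longrightarrow> i < j \<Longrightarrow> c j \<le> c i" for s :: nat and c :: "nat \<Rightarrow> nat"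
  proof
    assume s: "s \<le> c i"
    have "s \<le> c j" if "j \<in> {1..i}" for j
      using d[of j i] s that i by (cases "j = i") auto
    then have "{1..i} \<subseteq> {j \<in> {1..n}. s \<le> c j}" using i by auto
    then have "card {1..i} \<le> card {j \<in> {1..n}. s \<le> c j}" by (intro card_mono) auto
    then show "i \<le> card {j \<in> {1..n}. s \<le> c j}" by simp
  next
    assume le: "i \<le> card {j \<in> {1..n}. s \<le> c j}"
    show "s \<le> c i"
    proof (rule ccontr)
      assume s: "\<not> s \<le> c i"
      have "j < i" if "j \<in> {1..n}" "s \<le> c j" for j
        using d[of i j] s that i by (cases i j rule: linorder_cases) auto
      then have "{j \<in> {1..n}. s \<le> c j} \<subseteq> {1..<i}" by auto
      then have "card {j \<in> {1..n}. s \<le> c j} \<le> card {1..<i}" by (intro card_mono) auto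
      then show False using le i by (simp, linarith)
    qed
  qed
  have "c i \<le> c' i" using *[of c "c i", OF c] *[of c' "c i", OF c'] eq by simp
  moreover have "c' i \<le> c i" using *[of c "c' i", OF c] *[of c' "c' i", OF c'] eq by simp
  ultimately show ?thesis by simp
qed

text \<open>
  The lexicographically sorted list of a multiset is unique, and so is its standardization.
\<close>

lemma compatible_unique:
  assumes cp: "compatible n \<sigma> a b" "compatible n \<sigma>' a' b'"
    and bij: "bij_betw \<sigma> {1..n} {1..n}" "bij_betw \<sigma>' {1..n} {1..n}"
    and eq: "diagram n a b = diagram n a' b'" and i: "i \<in> {1..n}"
  shows "a i = a' i \<and> b i = b' i \<and> \<sigma> i = \<sigma>' i"
proof -
  define K where "K = Suc ((\<Sum>i = 1..n. b i) + (\<Sum>i = 1..n. b' i))"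
  have bK: "b i < K \<and> b' i < K" if "i \<in> {1..n}" for i
    using member_le_sum[of i "{1..n}" b] member_le_sum[of i "{1..n}" b'] that unfolding K_def by simp
  have dec: "a j * K + b j \<le> a i * K + b i"
    if "compatible n \<sigma> a b" "\<And>i. i \<in> {1..n} \<Longrightarrow> b i < K" "i \<in> {1..n}" "j \<in> {1..n}" "i < j" for i j \<sigma> a b
  proof (cases "a i = a j")
    case True
    then show ?thesis using that(1,3-) unfolding compatible_def by simp
  next
    case False
    then have "a j < a i" using that(1,3-) unfolding compatible_def by (metis order_less_le)
    then have "Suc (a j) * K \<le> a i * K" by (intro mult_le_mono1) simp
    then show ?thesis using that(2)[OF that(4)] by simp
  qed
  have code: "a i * K + b i = a' i * K + b' i" if "i \<in> {1..n}" for i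
  proof (rule decreasing_unique[OF _ _ _ that])
    show "card {i \<in> {1..n}. s \<le> a i * K + b i} = card {i \<in> {1..n}. s \<le> a' i * K + b' i}" for s
      using card_diagram[of n "\<lambda>x. s \<le> fst x * K + snd x" a b] card_diagram[of n "\<lambda>x. s \<le> fst x * K + snd x" a' b'] eq
      by simp
  qed (use dec[OF cp(1)] dec[OF cp(2)] bK in blast)+
  have ab: "a i = a' i \<and> b i = b' i" if "i \<in> {1..n}" for i
  proof -
    have "(a i * K + b i) div K = a i" "(a' i * K + b' i) div K = a' i" using bK[OF that] by simp_all
    then have "a i = a' i" using code[OF that] by simp
    then show ?thesis using code[OF that] by simp
  qed
  have less: "\<sigma> i < \<sigma> j \<longleftrightarrow> b j < b i \<or> b i = b j \<and> i < j"
    if "compatible n \<sigma> a b" "bij_betw \<sigma> {1..n} {1..n}" "i \<in> {1..n}" "j \<in> {1..n}" for i j \<sigma> a b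
  proof -
    have c: "\<sigma> i < \<sigma> j \<Longrightarrow> b j \<le> b i \<and> (b i = b j \<longrightarrow> i < j)" "\<sigma> j < \<sigma> i \<Longrightarrow> b i \<le> b j \<and> (b j = b i \<longrightarrow> j < i)"
      using that(1,3,4) unfolding compatible_def by blast+
    have "\<sigma> i = \<sigma> j \<Longrightarrow> i = j" using inj_onD[OF bij_betw_imp_inj_on[OF that(2)]] that(3,4) by blast
    then show ?thesis using c by (cases "\<sigma> i" "\<sigma> j" rule: linorder_cases) auto
  qed
  have pos: "\<sigma> i = card {j \<in> {1..n}. \<not> \<sigma> i < \<sigma> j}" if "bij_betw \<sigma> {1..n} {1..n}" for \<sigma>
  proof -
    have "bij_betw \<sigma> {j \<in> {1..n}. \<not> \<sigma> i < \<sigma> j} {1..\<sigma> i}"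
    proof (rule bij_betw_imageI)
      show "inj_on \<sigma> {j \<in> {1..n}. \<not> \<sigma> i < \<sigma> j}"
        using bij_betw_imp_inj_on[OF that] by (auto intro: inj_on_subset)
      have im: "\<sigma> ` {1..n} = {1..n}" using that by (simp add: bij_betw_def)
      have si: "\<sigma> i \<in> {1..n}" using that i by (rule bij_betw_apply)
      show "\<sigma> ` {j \<in> {1..n}. \<not> \<sigma> i < \<sigma> j} = {1..\<sigma> i}"
      proof (intro subset_antisym subsetI)
        fix y assume "y \<in> \<sigma> ` {j \<in> {1..n}. \<not> \<sigma> i < \<sigma> j}"
        then obtain j where "j \<in> {1..n}" "\<not> \<sigma> i < \<sigma> j" "y = \<sigma> j" by blast
        then show "y \<in> {1..\<sigma> i}" using bij_betw_apply[OF that, of j] by auto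
      next
        fix y assume y: "y \<in> {1..\<sigma> i}"
        then have "y \<in> \<sigma> ` {1..n}" using im si by auto
        then show "y \<in> \<sigma> ` {j \<in> {1..n}. \<not> \<sigma> i < \<sigma> j}" using y by auto
      qed
    qed
    then show ?thesis by (simp add: bij_betw_same_card)
  qed
  have "{j \<in> {1..n}. \<not> \<sigma> i < \<sigma> j} = {j \<in> {1..n}. \<not> \<sigma>' i < \<sigma>' j}"
    using less[OF cp(1) bij(1) i] less[OF cp(2) bij(2) i] ab i by (auto simp del: atLeastAtMost_iff)
  then show ?thesis using ab[OF i] pos[OF bij(1)] pos[OF bij(2)] by simp
qed

lemma compatible_decomposes:
  assumes "\<beta> \<in> hyperoctahedral n" "decomposes n \<beta> l m"
  shows "compatible n (abs_perm \<beta>) (\<lambda>i. flag n \<beta> i + l i) (\<lambda>i. inv_flag n \<beta> i + m i)"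
  by (rule compatible_add[OF compatible_flag[OF assms(1)]]) (use assms(2) in \<open>auto simp: decomposes_def\<close>)

lemma decomposition_unique:
  assumes G: "\<beta> \<in> hyperoctahedral n" "\<beta>' \<in> hyperoctahedral n"
    and d: "decomposes n \<beta> l m" "decomposes n \<beta>' l' m'"
    and eq: "diagram n (\<lambda>i. flag n \<beta> i + l i) (\<lambda>i. inv_flag n \<beta> i + m i) =
      diagram n (\<lambda>i. flag n \<beta>' i + l' i) (\<lambda>i. inv_flag n \<beta>' i + m' i)"
  shows "\<beta> = \<beta>'" and "i \<in> {1..n} \<Longrightarrow> l i = l' i \<and> m i = m' i"
proof -
  note u = compatible_unique[OF compatible_decomposes[OF G(1) d(1)] compatible_decomposes[OF G(2) d(2)]
      hyper_bij[OF G(1)] hyper_bij[OF G(2)] eq]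
  show b: "\<beta> = \<beta>'"
  proof (rule hyper_eqI[OF G])
    fix i assume i: "i \<in> {1..n}"
    have "even (l i)" "even (l' i)" using d i unfolding decomposes_def by blast+
    then have "odd (flag n \<beta> i) \<longleftrightarrow> odd (flag n \<beta>' i)" using u[OF i] by (metis even_add)
    then have "\<beta> (int i) < 0 \<longleftrightarrow> \<beta>' (int i) < 0" by (simp add: odd_flag)
    moreover have "abs_perm \<beta> i = abs_perm \<beta>' i" using u[OF i] by simp
    ultimately show "\<beta> (int i) = \<beta>' (int i)" by (auto simp: abs_perm_def)
  qed
  show "l i = l' i \<and> m i = m' i" if "i \<in> {1..n}" using u[OF that] unfolding b by simp
qed

section \<open>Polynomials, substitution and the action\<close>

abbreviation coeff_of :: "mpoly \<Rightarrow> monomial \<Rightarrow> rat" where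
  "coeff_of \<equiv> Poly_Mapping.lookup"

abbreviation polys :: "nat \<Rightarrow> mpoly set" where
  "polys n \<equiv> carrier (poly_ring n)"

lemma polys_iff: "p \<in> polys n \<longleftrightarrow>
    (\<forall>m\<in>Poly_Mapping.keys p. Poly_Mapping.keys m \<subseteq> X ` {1..n} \<union> Y ` {1..n})"
  by (simp add: poly_ring_def)

lemma const_simps:
  "const 0 = 0" "const 1 = 1" "const (c + d) = const c + const d" "const (c * d) = const c * const d"
  "const (- c) = - const c" "const (of_int k) = of_int k" "const (of_nat l) = of_nat l"
  by (simp_all add: const_def single_add mult_single single_uminus)

lemma coeff_const_mult: "coeff_of (const c * p) m = c * coeff_of p m"
proof -
  have "const c * p = Poly_Mapping.map ((*) c) p"
    by (simp add: const_def mult_map_scale_conv_mult)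
  then show ?thesis by (simp add: Poly_Mapping.map.rep_eq "when_def")
qed

lemma poly_sum_single: "p = (\<Sum>m\<in>Poly_Mapping.keys p. Poly_Mapping.single m (coeff_of p m))"
  by (rule poly_mapping_eqI) (simp add: lookup_sum lookup_single when_def in_keys_iff)

lemma single_eq_const: "Poly_Mapping.single m c = const c * Poly_Mapping.single m 1"
  by (simp add: const_def mult_single)

definition mon_value :: "(var \<Rightarrow> mpoly) \<Rightarrow> monomial \<Rightarrow> mpoly" where
  "mon_value f m = (\<Prod>v\<in>Poly_Mapping.keys m. f v ^ Poly_Mapping.lookup m v)"

lemma mon_value_superset:
  assumes "finite S" "Poly_Mapping.keys m \<subseteq> S"
  shows "mon_value f m = (\<Prod>v\<in>S. f v ^ Poly_Mapping.lookup m v)"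
  unfolding mon_value_def using assms by (intro prod.mono_neutral_left) (auto simp: in_keys_iff)

lemma mon_value_add: "mon_value f (m + m') = mon_value f m * mon_value f m'"
proof -
  let ?S = "Poly_Mapping.keys m \<union> Poly_Mapping.keys m'"
  have "Poly_Mapping.keys (m + m') \<subseteq> ?S" by (rule keys_add)
  then show ?thesis
    by (simp add: mon_value_superset[of ?S] lookup_add power_add prod.distrib)
qed

lemma mon_value_variable: "mon_value variable m = Poly_Mapping.single m 1"
proof -
  have pow: "variable v ^ k = Poly_Mapping.single (Poly_Mapping.single v k) 1" for v k
    by (induction k) (auto simp: variable_def mult_single single_add[symmetric] add.commute)
  have "(\<Prod>v\<in>S. Poly_Mapping.single (g v) (1::rat)) = Poly_Mapping.single (\<Sum>v\<in>S. g v) 1"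
    if "finite S" for S :: "var set" and g :: "var \<Rightarrow> monomial"
    using that by (induction S rule: finite_induct) (auto simp: mult_single)
  moreover have "(\<Sum>v\<in>Poly_Mapping.keys m. Poly_Mapping.single v (Poly_Mapping.lookup m v)) = m"
    by (rule poly_mapping_eqI) (auto simp: lookup_sum lookup_single when_def in_keys_iff sum.delta')
  ultimately show ?thesis unfolding mon_value_def pow by simp
qed

lemma substitute_superset:
  assumes "finite S" "Poly_Mapping.keys p \<subseteq> S"
  shows "substitute f p = (\<Sum>m\<in>S. const (coeff_of p m) * mon_value f m)"
  unfolding substitute_def mon_value_def[symmetric]
  using assms by (intro sum.mono_neutral_left) (auto simp: in_keys_iff const_simps)

lemma substitute_single: "substitute f (Poly_Mapping.single m c) = const c * mon_value f m"
  by (subst substitute_superset[of "{m}"]) auto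

lemma substitute_add: "substitute f (p + p') = substitute f p + substitute f p'"
proof -
  let ?S = "Poly_Mapping.keys p \<union> Poly_Mapping.keys p'"
  have "Poly_Mapping.keys (p + p') \<subseteq> ?S" by (rule keys_add)
  then show ?thesis
    by (simp add: substitute_superset[of ?S] lookup_add const_simps distrib_right sum.distrib)
qed

lemma substitute_zero: "substitute f 0 = 0"
  by (simp add: substitute_def)

lemma substitute_sum: "substitute f (sum g S) = (\<Sum>i\<in>S. substitute f (g i))"
  by (induction S rule: infinite_finite_induct) (auto simp: substitute_add substitute_zero)

lemma substitute_const: "substitute f (const c) = const c"
  unfolding const_def by (simp add: substitute_single mon_value_def) (simp add: const_def)

lemma substitute_mult: "substitute f (p * p') = substitute f p * substitute f p'"
proof -
  let ?s = "\<lambda>p m. Poly_Mapping.single m (coeff_of p m)"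
  have "substitute f (p * p') = substitute f ((\<Sum>m\<in>Poly_Mapping.keys p. ?s p m) * (\<Sum>m\<in>Poly_Mapping.keys p'. ?s p' m))"
    using poly_sum_single[of p] poly_sum_single[of p'] by simp
  also have "\<dots> = (\<Sum>m\<in>Poly_Mapping.keys p. \<Sum>m'\<in>Poly_Mapping.keys p'. substitute f (?s p m * ?s p' m'))"
    by (simp add: sum_product substitute_sum)
  also have "\<dots> = (\<Sum>m\<in>Poly_Mapping.keys p. \<Sum>m'\<in>Poly_Mapping.keys p'. substitute f (?s p m) * substitute f (?s p' m'))"
    by (simp add: mult_single substitute_single mon_value_add const_simps mult_ac)
  also have "\<dots> = substitute f p * substitute f p'"
    by (simp add: sum_product[symmetric] substitute_sum[symmetric] poly_sum_single[symmetric])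
  finally show ?thesis .
qed

lemma substitute_power: "substitute f (p ^ k) = substitute f p ^ k"
  using substitute_const[of f 1] by (induction k) (auto simp: substitute_mult const_simps)

lemma substitute_prod: "substitute f (prod g S) = (\<Prod>i\<in>S. substitute f (g i))"
  using substitute_const[of f 1]
  by (induction S rule: infinite_finite_induct) (auto simp: substitute_mult const_simps)

lemma substitute_substitute: "substitute f (substitute g p) = substitute (\<lambda>v. substitute f (g v)) p"
  unfolding substitute_def[of g p] substitute_def[of "\<lambda>v. substitute f (g v)" p]
  by (simp add: substitute_sum substitute_mult substitute_const substitute_prod substitute_power)

lemma substitute_variable: "substitute f (variable v) = f v"
  by (simp add: variable_def substitute_single mon_value_def const_simps)

text \<open>
  Taking the constant coefficient is the substitution of zero for all variables.
\<close>

lemma constant_coeff_mult: "coeff_of (p * p') 0 = coeff_of p 0 * coeff_of p' 0"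
proof -
  have *: "substitute (\<lambda>v. 0) p = const (coeff_of p 0)" for p
  proof -
    have "mon_value (\<lambda>v. 0) m = (if m = 0 then 1 else 0)" for m
    proof (cases "m = 0")
      case False
      then obtain v where "v \<in> Poly_Mapping.keys m" by fastforce
      then have "\<exists>v\<in>Poly_Mapping.keys m. (0::mpoly) ^ Poly_Mapping.lookup m v = 0"
        by (intro bexI[of _ v]) (auto simp: in_keys_iff zero_power)
      then show ?thesis using False unfolding mon_value_def by (simp add: prod_zero)
    qed (simp add: mon_value_def)
    then have "substitute (\<lambda>v. 0) p =
        (\<Sum>m\<in>insert 0 (Poly_Mapping.keys p). const (coeff_of p m) * (if m = 0 then 1 else 0))"
      by (subst substitute_superset[of "insert 0 (Poly_Mapping.keys p)"]) auto
    also have "\<dots> = (\<Sum>m\<in>{0}. const (coeff_of p m) * (if m = 0 then 1 else 0))"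
      by (rule sum.mono_neutral_right) auto
    finally show ?thesis by simp
  qed
  have "const (coeff_of (p * p') 0) = const (coeff_of p 0 * coeff_of p' 0)"
    unfolding const_simps(4) *[symmetric] by (rule substitute_mult)
  then have "coeff_of (const (coeff_of (p * p') 0)) 0 = coeff_of (const (coeff_of p 0 * coeff_of p' 0)) 0"
    by (rule arg_cong)
  then show ?thesis by (simp add: const_def)
qed

definition xy_exp :: "nat \<Rightarrow> (nat \<Rightarrow> nat) \<Rightarrow> (nat \<Rightarrow> nat) \<Rightarrow> monomial" where
  "xy_exp n a b = (\<Sum>i = 1..n. Poly_Mapping.single (X i) (a i) + Poly_Mapping.single (Y i) (b i))"

definition xy_mono :: "nat \<Rightarrow> (nat \<Rightarrow> nat) \<Rightarrow> (nat \<Rightarrow> nat) \<Rightarrow> mpoly" where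
  "xy_mono n a b = Poly_Mapping.single (xy_exp n a b) 1"

abbreviation xe :: "monomial \<Rightarrow> nat \<Rightarrow> nat" where "xe m i \<equiv> Poly_Mapping.lookup m (X i)"
abbreviation ye :: "monomial \<Rightarrow> nat \<Rightarrow> nat" where "ye m i \<equiv> Poly_Mapping.lookup m (Y i)"

lemma xy_exp_X: "xe (xy_exp n a b) j = (if j \<in> {1..n} then a j else 0)"
  and xy_exp_Y: "ye (xy_exp n a b) j = (if j \<in> {1..n} then b j else 0)"
  by (simp_all add: xy_exp_def lookup_sum lookup_add lookup_single when_def sum.delta sum.delta')

lemma keys_xy_exp: "Poly_Mapping.keys (xy_exp n a b) \<subseteq> X ` {1..n} \<union> Y ` {1..n}"
proof
  fix v assume "v \<in> Poly_Mapping.keys (xy_exp n a b)"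
  then show "v \<in> X ` {1..n} \<union> Y ` {1..n}"
    by (cases v) (auto simp: in_keys_iff xy_exp_X xy_exp_Y split: if_splits)
qed

lemma xy_exp_eqI:
  assumes "Poly_Mapping.keys m \<subseteq> X ` {1..n} \<union> Y ` {1..n}"
    and "\<And>i. i \<in> {1..n} \<Longrightarrow> xe m i = a i \<and> ye m i = b i"
  shows "m = xy_exp n a b"
proof (rule poly_mapping_eqI)
  fix v
  show "Poly_Mapping.lookup m v = Poly_Mapping.lookup (xy_exp n a b) v"
  proof (cases "v \<in> X ` {1..n} \<union> Y ` {1..n}")
    case True
    then show ?thesis using assms(2) by (auto simp: xy_exp_X xy_exp_Y)
  next
    case False
    then have "v \<notin> Poly_Mapping.keys m" "v \<notin> Poly_Mapping.keys (xy_exp n a b)"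
      using assms(1) keys_xy_exp by blast+
    then show ?thesis by (simp add: in_keys_iff)
  qed
qed

lemma xy_exp_eq_iff: "xy_exp n a b = xy_exp n a' b' \<longleftrightarrow> (\<forall>i\<in>{1..n}. a i = a' i \<and> b i = b' i)"
proof
  assume eq: "xy_exp n a b = xy_exp n a' b'"
  show "\<forall>i\<in>{1..n}. a i = a' i \<and> b i = b' i"
  proof
    fix i assume "i \<in> {1..n}"
    then show "a i = a' i \<and> b i = b' i"
      using xy_exp_X[of n a b i] xy_exp_Y[of n a b i] xy_exp_X[of n a' b' i] xy_exp_Y[of n a' b' i] eq by simp
  qed
next
  assume "\<forall>i\<in>{1..n}. a i = a' i \<and> b i = b' i"
  then show "xy_exp n a b = xy_exp n a' b'" unfolding xy_exp_def by (intro sum.cong) auto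
qed

lemma xy_exp_add: "xy_exp n (\<lambda>i. a i + a' i) (\<lambda>i. b i + b' i) = xy_exp n a b + xy_exp n a' b'"
  by (simp add: xy_exp_def single_add sum.distrib algebra_simps)

lemma xy_exp_exponents: "Poly_Mapping.keys m \<subseteq> X ` {1..n} \<union> Y ` {1..n} \<Longrightarrow> xy_exp n (xe m) (ye m) = m"
  by (rule xy_exp_eqI[symmetric]) auto

lemma xy_mono_add: "xy_mono n (\<lambda>i. a i + a' i) (\<lambda>i. b i + b' i) = xy_mono n a b * xy_mono n a' b'"
  by (simp add: xy_mono_def xy_exp_add mult_single)

lemma poly_sum_xy_mono:
  assumes "p \<in> polys n"
  shows "p = (\<Sum>m\<in>Poly_Mapping.keys p. const (coeff_of p m) * xy_mono n (xe m) (ye m))"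
proof -
  have "(\<Sum>m\<in>Poly_Mapping.keys p. const (coeff_of p m) * xy_mono n (xe m) (ye m)) =
      (\<Sum>m\<in>Poly_Mapping.keys p. Poly_Mapping.single m (coeff_of p m))"
    using assms unfolding polys_iff
    by (intro sum.cong refl) (simp add: xy_mono_def xy_exp_exponents single_eq_const[symmetric])
  then show ?thesis using poly_sum_single[of p] by simp
qed

lemma mon_value_xy_exp:
  "mon_value f (xy_exp n a b) = (\<Prod>i = 1..n. f (X i) ^ a i) * (\<Prod>i = 1..n. f (Y i) ^ b i)"
proof -
  have "mon_value f (xy_exp n a b) = (\<Prod>v\<in>X ` {1..n} \<union> Y ` {1..n}. f v ^ Poly_Mapping.lookup (xy_exp n a b) v)"
    by (rule mon_value_superset[OF _ keys_xy_exp]) auto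
  also have "\<dots> = (\<Prod>v\<in>X ` {1..n}. f v ^ Poly_Mapping.lookup (xy_exp n a b) v) *
      (\<Prod>v\<in>Y ` {1..n}. f v ^ Poly_Mapping.lookup (xy_exp n a b) v)"
    by (rule prod.union_disjoint) auto
  also have "\<dots> = (\<Prod>i = 1..n. f (X i) ^ a i) * (\<Prod>i = 1..n. f (Y i) ^ b i)"
    by (simp add: prod.reindex inj_on_def xy_exp_X xy_exp_Y)
  finally show ?thesis .
qed

lemma polys_closed:
  "0 \<in> polys n" "1 \<in> polys n" "const c \<in> polys n" "xy_mono n a b \<in> polys n"
  "p \<in> polys n \<Longrightarrow> p' \<in> polys n \<Longrightarrow> p + p' \<in> polys n"
  "p \<in> polys n \<Longrightarrow> p' \<in> polys n \<Longrightarrow> p * p' \<in> polys n"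
  "p \<in> polys n \<Longrightarrow> - p \<in> polys n"
proof -
  show "0 \<in> polys n" "1 \<in> polys n" by (simp_all add: polys_iff)
  show c: "const c \<in> polys n" for c by (auto simp: polys_iff const_def split: if_splits)
  show "xy_mono n a b \<in> polys n" using keys_xy_exp by (simp add: polys_iff xy_mono_def)
  show "p + p' \<in> polys n" if "p \<in> polys n" "p' \<in> polys n"
    using that keys_add[of p p'] unfolding polys_iff by blast
  have mult: "p * p' \<in> polys n" if "p \<in> polys n" "p' \<in> polys n" for p p'
    unfolding polys_iff
  proof
    fix m assume "m \<in> Poly_Mapping.keys (p * p')"
    then obtain k l where "k \<in> Poly_Mapping.keys p" "l \<in> Poly_Mapping.keys p'" "m = k + l"
      using keys_mult[of p p'] by blast
    then show "Poly_Mapping.keys m \<subseteq> X ` {1..n} \<union> Y ` {1..n}"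
      using that keys_add[of k l] unfolding polys_iff by blast
  qed
  show "p * p' \<in> polys n" if "p \<in> polys n" "p' \<in> polys n" using mult that .
  show "- p \<in> polys n" if "p \<in> polys n"
    using mult[OF c[of "- 1"] that] by (simp add: const_simps)
qed

lemma polys_sum: "(\<And>i. i \<in> S \<Longrightarrow> g i \<in> polys n) \<Longrightarrow> sum g S \<in> polys n"
  by (induction S rule: infinite_finite_induct) (auto simp: polys_closed)

lemma poly_ring_ops [simp]:
  "x \<otimes>\<^bsub>poly_ring n\<^esub> y = x * y" "\<one>\<^bsub>poly_ring n\<^esub> = 1" "\<zero>\<^bsub>poly_ring n\<^esub> = 0" "x \<oplus>\<^bsub>poly_ring n\<^esub> y = x + y"
  by (simp_all add: poly_ring_def)

lemma cring_poly_ring: "cring (poly_ring n)"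
proof (rule cringI)
  show "abelian_group (poly_ring n)"
  proof (rule abelian_groupI)
    fix x assume "x \<in> polys n"
    then show "\<exists>y\<in>polys n. y \<oplus>\<^bsub>poly_ring n\<^esub> x = \<zero>\<^bsub>poly_ring n\<^esub>"
      using polys_closed(7)[of x n] by (intro bexI[of _ "- x"]) auto
  next
    fix x y show "x \<oplus>\<^bsub>poly_ring n\<^esub> y = y \<oplus>\<^bsub>poly_ring n\<^esub> x" by (simp add: add.commute)
  qed (simp_all add: polys_closed add.assoc)
  show "Group.comm_monoid (poly_ring n)"
  proof (rule comm_monoidI)
    fix x y show "x \<otimes>\<^bsub>poly_ring n\<^esub> y = y \<otimes>\<^bsub>poly_ring n\<^esub> x" by (simp add: mult.commute)
  qed (simp_all add: polys_closed mult.assoc)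
qed (simp add: distrib_right)

lemma
  shows act_add: "act \<alpha> \<gamma> (p + p') = act \<alpha> \<gamma> p + act \<alpha> \<gamma> p'"
    and act_mult: "act \<alpha> \<gamma> (p * p') = act \<alpha> \<gamma> p * act \<alpha> \<gamma> p'"
    and act_const: "act \<alpha> \<gamma> (const c) = const c"
    and act_zero: "act \<alpha> \<gamma> 0 = 0"
    and act_sum: "act \<alpha> \<gamma> (sum g S) = (\<Sum>i\<in>S. act \<alpha> \<gamma> (g i))"
  by (simp_all add: act_def substitute_add substitute_mult substitute_const substitute_zero substitute_sum)

lemma act_act:
  assumes "\<alpha>' \<in> hyperoctahedral n" "\<gamma>' \<in> hyperoctahedral n"
  shows "act \<alpha>' \<gamma>' (act \<alpha> \<gamma> p) = act (\<alpha>' \<circ> \<alpha>) (\<gamma>' \<circ> \<gamma>) p"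
proof -
  have of_int: "substitute f (of_int k) = of_int k" for f k
    using substitute_const[of f "of_int k"] by (simp add: const_simps)
  have sg: "of_int (sgn z) * (of_int (sgn (\<beta> (int (nat \<bar>z\<bar>)))) * (v::mpoly)) = of_int (sgn (\<beta> z)) * v"
    and ab: "nat \<bar>\<beta> (int (nat \<bar>z\<bar>))\<bar> = nat \<bar>\<beta> z\<bar>"
    if "\<beta> \<in> hyperoctahedral n" for \<beta> z v
    using hyper_odd[OF that, of z] hyper_zero[OF that]
    by (cases z "0::int" rule: linorder_cases; simp add: sgn_minus)+
  have "substitute (signed_variable \<alpha>' \<gamma>') (signed_variable \<alpha> \<gamma> v) =
      signed_variable (\<alpha>' \<circ> \<alpha>) (\<gamma>' \<circ> \<gamma>) v" for v
    using sg[OF assms(1)] sg[OF assms(2)] ab[OF assms(1)] ab[OF assms(2)]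
    by (cases v) (simp_all add: substitute_mult of_int substitute_variable)
  then show ?thesis unfolding act_def substitute_substitute by simp
qed

definition mono_sign :: "nat \<Rightarrow> (int \<Rightarrow> int) \<Rightarrow> (nat \<Rightarrow> nat) \<Rightarrow> int" where
  "mono_sign n \<alpha> a = (\<Prod>i = 1..n. sgn (\<alpha> (int i)) ^ a i)"

lemma act_xy_mono:
  assumes "\<alpha> \<in> hyperoctahedral n" "\<gamma> \<in> hyperoctahedral n"
  shows "act \<alpha> \<gamma> (xy_mono n a b) = const (of_int (mono_sign n \<alpha> a * mono_sign n \<gamma> b)) *
    xy_mono n (\<lambda>k. a (abs_perm (hinv \<alpha>) k)) (\<lambda>k. b (abs_perm (hinv \<gamma>) k))"
proof -
  have re: "(\<Prod>i = 1..n. (of_int (sgn (\<beta> (int i))) * variable (V (abs_perm \<beta> i))) ^ a i) =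
    of_int (mono_sign n \<beta> a) * (\<Prod>k = 1..n. variable (V k) ^ a (abs_perm (hinv \<beta>) k))"
    if G: "\<beta> \<in> hyperoctahedral n" for \<beta> a and V :: "nat \<Rightarrow> var"
  proof -
    have "(\<Prod>k = 1..n. variable (V k) ^ a (abs_perm (hinv \<beta>) k)) =
        (\<Prod>i = 1..n. variable (V (abs_perm \<beta> i)) ^ a (abs_perm (hinv \<beta>) (abs_perm \<beta> i)))"
      by (rule prod.reindex_bij_betw[OF hyper_bij[OF G], symmetric])
    then show ?thesis using abs_perm_inv[OF G]
      by (simp add: power_mult_distrib prod.distrib mono_sign_def)
  qed
  have "act \<alpha> \<gamma> (xy_mono n a b) = mon_value (signed_variable \<alpha> \<gamma>) (xy_exp n a b)"
    by (simp add: act_def xy_mono_def substitute_single const_simps)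
  also have "\<dots> = (\<Prod>i = 1..n. (of_int (sgn (\<alpha> (int i))) * variable (X (abs_perm \<alpha> i))) ^ a i) *
     (\<Prod>i = 1..n. (of_int (sgn (\<gamma> (int i))) * variable (Y (abs_perm \<gamma> i))) ^ b i)"
    by (simp add: mon_value_xy_exp abs_perm_def)
  also have "\<dots> = of_int (mono_sign n \<alpha> a * mono_sign n \<gamma> b) *
      mon_value variable (xy_exp n (\<lambda>k. a (abs_perm (hinv \<alpha>) k)) (\<lambda>k. b (abs_perm (hinv \<gamma>) k)))"
    unfolding re[OF assms(1), of X] re[OF assms(2), of Y] mon_value_xy_exp by (simp add: mult_ac)
  finally show ?thesis by (simp add: mon_value_variable xy_mono_def const_simps)
qed

lemma mono_sign_cong: "(\<And>i. i \<in> {1..n} \<Longrightarrow> a i = a' i) \<Longrightarrow> mono_sign n \<alpha> a = mono_sign n \<alpha> a'"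
  unfolding mono_sign_def by (rule prod.cong) auto

lemma xy_mono_cong: "(\<And>i. i \<in> {1..n} \<Longrightarrow> a i = a' i \<and> b i = b' i) \<Longrightarrow> xy_mono n a b = xy_mono n a' b'"
  unfolding xy_mono_def using xy_exp_eq_iff[of n a b a' b'] by simp

lemma mono_sign_even:
  assumes "\<alpha> \<in> hyperoctahedral n" "\<And>i. i \<in> {1..n} \<Longrightarrow> even (a i)"
  shows "mono_sign n \<alpha> a = 1"
  unfolding mono_sign_def
proof (rule prod.neutral, rule ballI)
  fix i assume i: "i \<in> {1..n}"
  have "sgn (\<alpha> (int i)) = 1 \<or> sgn (\<alpha> (int i)) = - 1"
    using hyper_nonzero[OF assms(1) i] by (auto simp: sgn_if)
  then show "sgn (\<alpha> (int i)) ^ a i = 1" using assms(2)[OF i] by auto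
qed

lemma mono_sign_add: "mono_sign n \<alpha> a * mono_sign n \<alpha> b = mono_sign n \<alpha> (\<lambda>i. a i + b i)"
  by (simp add: mono_sign_def power_add prod.distrib)

lemma mono_sign_pos:
  assumes "\<And>i. i \<in> {1..n} \<Longrightarrow> \<alpha> (int i) > 0"
  shows "mono_sign n \<alpha> a = 1"
  unfolding mono_sign_def using assms by (intro prod.neutral) auto

lemma act_polys:
  assumes "\<alpha> \<in> hyperoctahedral n" "\<gamma> \<in> hyperoctahedral n" "p \<in> polys n"
  shows "act \<alpha> \<gamma> p \<in> polys n"
  by (subst poly_sum_xy_mono[OF assms(3)])
    (simp add: act_sum act_mult act_const act_xy_mono[OF assms(1,2)] polys_sum polys_closed)

text \<open>
  The action permutes monomials up to sign, so it permutes coefficients up to sign.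
\<close>

lemma coeff_act:
  assumes G: "\<alpha> \<in> hyperoctahedral n" "\<gamma> \<in> hyperoctahedral n" and p: "p \<in> polys n"
  shows "coeff_of (act \<alpha> \<gamma> p) (xy_exp n (\<lambda>k. a (abs_perm (hinv \<alpha>) k)) (\<lambda>k. b (abs_perm (hinv \<gamma>) k))) =
    of_int (mono_sign n \<alpha> a * mono_sign n \<gamma> b) * coeff_of p (xy_exp n a b)"
proof -
  let ?E = "xy_exp n (\<lambda>k. a (abs_perm (hinv \<alpha>) k)) (\<lambda>k. b (abs_perm (hinv \<gamma>) k))"
  have perm: "(\<forall>k\<in>{1..n}. f (abs_perm (hinv \<beta>) k) = g (abs_perm (hinv \<beta>) k)) \<longleftrightarrow> (\<forall>i\<in>{1..n}. f i = g i)"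
    if "\<beta> \<in> hyperoctahedral n" for \<beta> and f g :: "nat \<Rightarrow> nat"
    using abs_perm_inv[OF that] abs_perm_in[OF that] abs_perm_in[OF hyper_inv[OF that]] by metis
  have eq: "xy_exp n (\<lambda>k. xe m (abs_perm (hinv \<alpha>) k)) (\<lambda>k. ye m (abs_perm (hinv \<gamma>) k)) = ?E \<longleftrightarrow> m = xy_exp n a b"
    if m: "m \<in> Poly_Mapping.keys p" for m
  proof -
    have "xy_exp n (\<lambda>k. xe m (abs_perm (hinv \<alpha>) k)) (\<lambda>k. ye m (abs_perm (hinv \<gamma>) k)) = ?E \<longleftrightarrow>
        (\<forall>i\<in>{1..n}. xe m i = a i) \<and> (\<forall>i\<in>{1..n}. ye m i = b i)"
      unfolding xy_exp_eq_iff ball_conj_distrib perm[OF G(1), of "xe m" a] perm[OF G(2), of "ye m" b] ..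
    also have "\<dots> \<longleftrightarrow> m = xy_exp n a b"
      using p m xy_exp_eqI[of m n a b] unfolding polys_iff by (auto simp: xy_exp_X xy_exp_Y)
    finally show ?thesis .
  qed
  have "coeff_of (act \<alpha> \<gamma> p) ?E = (\<Sum>m\<in>Poly_Mapping.keys p. coeff_of p m *
     (of_int (mono_sign n \<alpha> (xe m) * mono_sign n \<gamma> (ye m)) *
      coeff_of (xy_mono n (\<lambda>k. xe m (abs_perm (hinv \<alpha>) k)) (\<lambda>k. ye m (abs_perm (hinv \<gamma>) k))) ?E))"
    by (subst poly_sum_xy_mono[OF p])
      (simp only: act_sum act_mult act_const act_xy_mono[OF G] lookup_sum coeff_const_mult)
  also have "\<dots> = (\<Sum>m\<in>Poly_Mapping.keys p. if m = xy_exp n a b then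
      coeff_of p m * of_int (mono_sign n \<alpha> (xe m) * mono_sign n \<gamma> (ye m)) else 0)"
    by (intro sum.cong refl) (simp add: xy_mono_def lookup_single when_def eq)
  also have "\<dots> = coeff_of p (xy_exp n a b) * of_int (mono_sign n \<alpha> (xe (xy_exp n a b)) * mono_sign n \<gamma> (ye (xy_exp n a b)))"
    by (simp add: sum.delta in_keys_iff)
  also have "mono_sign n \<alpha> (xe (xy_exp n a b)) = mono_sign n \<alpha> a"
    by (rule mono_sign_cong) (simp add: xy_exp_X)
  also have "mono_sign n \<gamma> (ye (xy_exp n a b)) = mono_sign n \<gamma> b"
    by (rule mono_sign_cong) (simp add: xy_exp_Y)
  finally show ?thesis by simp
qed

section \<open>The diagonal invariants as a free module over the invariants of the product\<close>

text \<open>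
  The Reynolds operator of the diagonal action, without the division by the order of the group.
\<close>

definition reynolds :: "nat \<Rightarrow> mpoly \<Rightarrow> mpoly" where
  "reynolds n p = (\<Sum>\<beta>\<in>hyperoctahedral n. act \<beta> \<beta> p)"

definition biinvariants :: "nat \<Rightarrow> mpoly set" where
  "biinvariants n = {p \<in> polys n. \<forall>\<alpha>\<in>hyperoctahedral n. \<forall>\<gamma>\<in>hyperoctahedral n. act \<alpha> \<gamma> p = p}"

definition basis_poly :: "nat \<Rightarrow> (int \<Rightarrow> int) \<Rightarrow> mpoly" where
  "basis_poly n \<beta> = reynolds n (xy_mono n (flag n \<beta>) (inv_flag n \<beta>))"

lemma abs_perm_id: "abs_perm id k = k" "abs_perm (hinv id) k = k"
  by (simp_all add: abs_perm_def)

lemma card_hyper_pos: "card (hyperoctahedral n) > 0"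
  using finite_hyperoctahedral hyper_id by (auto simp: card_gt_0_iff)

lemma
  shows reynolds_add: "reynolds n (p + p') = reynolds n p + reynolds n p'"
    and reynolds_zero: "reynolds n 0 = 0"
    and reynolds_const_mult: "reynolds n (const c * p) = const c * reynolds n p"
    and reynolds_sum: "reynolds n (sum g S) = (\<Sum>i\<in>S. reynolds n (g i))"
proof -
  show *: "reynolds n (p + p') = reynolds n p + reynolds n p'" for p p'
    by (simp add: reynolds_def act_add sum.distrib)
  show z: "reynolds n 0 = 0" by (simp add: reynolds_def act_zero)
  show "reynolds n (const c * p) = const c * reynolds n p"
    by (simp add: reynolds_def act_mult act_const sum_distrib_left)
  show "reynolds n (sum g S) = (\<Sum>i\<in>S. reynolds n (g i))"
    by (induction S rule: infinite_finite_induct) (auto simp: * z)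
qed

lemma reynolds_polys: "p \<in> polys n \<Longrightarrow> reynolds n p \<in> polys n"
  unfolding reynolds_def by (intro polys_sum act_polys)

lemma
  assumes G: "\<beta> \<in> hyperoctahedral n"
  shows bij_comp_right: "bij_betw (\<lambda>\<alpha>. \<alpha> \<circ> \<beta>) (hyperoctahedral n) (hyperoctahedral n)"
    and bij_comp_left: "bij_betw (\<lambda>\<alpha>. \<beta> \<circ> \<alpha>) (hyperoctahedral n) (hyperoctahedral n)"
proof -
  have 1: "\<beta> \<circ> hinv \<beta> = id" "hinv \<beta> \<circ> \<beta> = id" using inv_hyper[OF G] by (auto simp: fun_eq_iff)
  note iG = hyper_inv[OF G]
  show "bij_betw (\<lambda>\<alpha>. \<alpha> \<circ> \<beta>) (hyperoctahedral n) (hyperoctahedral n)"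
    by (rule bij_betw_byWitness[where f' = "\<lambda>\<alpha>. \<alpha> \<circ> hinv \<beta>"])
      (auto simp: comp_assoc 1 intro: hyper_comp G iG)
  show "bij_betw (\<lambda>\<alpha>. \<beta> \<circ> \<alpha>) (hyperoctahedral n) (hyperoctahedral n)"
    by (rule bij_betw_byWitness[where f' = "\<lambda>\<alpha>. hinv \<beta> \<circ> \<alpha>"])
      (auto simp: comp_assoc[symmetric] 1 intro: hyper_comp G iG)
qed

lemma
  assumes G: "\<beta> \<in> hyperoctahedral n"
  shows reynolds_act: "reynolds n (act \<beta> \<beta> p) = reynolds n p"
    and act_reynolds: "act \<beta> \<beta> (reynolds n p) = reynolds n p"
proof -
  have "reynolds n (act \<beta> \<beta> p) = (\<Sum>\<alpha>\<in>hyperoctahedral n. act (\<alpha> \<circ> \<beta>) (\<alpha> \<circ> \<beta>) p)"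
    unfolding reynolds_def by (intro sum.cong refl act_act[where n = n])
  also have "\<dots> = reynolds n p"
    unfolding reynolds_def by (rule sum.reindex_bij_betw[OF bij_comp_right[OF G], of "\<lambda>\<alpha>. act \<alpha> \<alpha> p"])
  finally show "reynolds n (act \<beta> \<beta> p) = reynolds n p" .
  have "act \<beta> \<beta> (reynolds n p) = (\<Sum>\<alpha>\<in>hyperoctahedral n. act (\<beta> \<circ> \<alpha>) (\<beta> \<circ> \<alpha>) p)"
    unfolding reynolds_def act_sum by (intro sum.cong refl act_act[where n = n] G)
  also have "\<dots> = reynolds n p"
    unfolding reynolds_def by (rule sum.reindex_bij_betw[OF bij_comp_left[OF G], of "\<lambda>\<alpha>. act \<alpha> \<alpha> p"])
  finally show "act \<beta> \<beta> (reynolds n p) = reynolds n p" .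
qed

lemma reynolds_invariant:
  assumes "\<And>\<beta>. \<beta> \<in> hyperoctahedral n \<Longrightarrow> act \<beta> \<beta> p = p"
  shows "reynolds n p = const (of_nat (card (hyperoctahedral n))) * p"
  using assms by (simp add: reynolds_def const_simps)

lemma reynolds_mult: "a \<in> biinvariants n \<Longrightarrow> reynolds n (a * p) = a * reynolds n p"
  by (simp add: reynolds_def act_mult biinvariants_def sum_distrib_left)

lemma biinvariants_closed:
  "const c \<in> biinvariants n" "0 \<in> biinvariants n"
  "a \<in> biinvariants n \<Longrightarrow> b \<in> biinvariants n \<Longrightarrow> a + b \<in> biinvariants n"
  "a \<in> biinvariants n \<Longrightarrow> b \<in> biinvariants n \<Longrightarrow> a * b \<in> biinvariants n"
  by (auto simp: biinvariants_def polys_closed act_add act_mult act_const act_zero)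

definition symmetrize :: "nat \<Rightarrow> mpoly \<Rightarrow> mpoly" where
  "symmetrize n p = (\<Sum>\<alpha>\<in>hyperoctahedral n. \<Sum>\<gamma>\<in>hyperoctahedral n. act \<alpha> \<gamma> p)"

lemma symmetrize_biinvariant:
  assumes "p \<in> polys n"
  shows "symmetrize n p \<in> biinvariants n"
proof -
  have "act \<alpha> \<gamma> (symmetrize n p) = symmetrize n p"
    if G: "\<alpha> \<in> hyperoctahedral n" "\<gamma> \<in> hyperoctahedral n" for \<alpha> \<gamma>
  proof -
    have "act \<alpha> \<gamma> (symmetrize n p) =
        (\<Sum>\<alpha>'\<in>hyperoctahedral n. \<Sum>\<gamma>'\<in>hyperoctahedral n. act (\<alpha> \<circ> \<alpha>') (\<gamma> \<circ> \<gamma>') p)"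
      unfolding symmetrize_def act_sum by (intro sum.cong refl act_act[where n = n] G)
    also have "\<dots> = (\<Sum>\<alpha>'\<in>hyperoctahedral n. \<Sum>\<gamma>'\<in>hyperoctahedral n. act (\<alpha> \<circ> \<alpha>') \<gamma>' p)"
      by (rule sum.cong[OF refl], rule sum.reindex_bij_betw[OF bij_comp_left[OF G(2)]])
    also have "\<dots> = symmetrize n p"
      unfolding symmetrize_def by (rule sum.reindex_bij_betw[OF bij_comp_left[OF G(1)]])
    finally show ?thesis .
  qed
  then show ?thesis using assms unfolding biinvariants_def
    by (simp add: symmetrize_def polys_sum act_polys)
qed

definition sign_flip :: "nat \<Rightarrow> nat \<Rightarrow> int \<Rightarrow> int" where
  "sign_flip n i = signed_perm n (\<lambda>j. j) (\<lambda>j. j = i)"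

lemma
  shows sign_flip_hyper: "sign_flip n i \<in> hyperoctahedral n"
    and abs_perm_inv_sign_flip: "k \<in> {1..n} \<Longrightarrow> abs_perm (hinv (sign_flip n i)) k = k"
    and mono_sign_flip: "i \<in> {1..n} \<Longrightarrow> mono_sign n (sign_flip n i) a = (- 1) ^ a i"
proof -
  have b: "bij_betw (\<lambda>j. j) {1..n} {1..n}" by (simp add: bij_betw_def)
  show G: "sign_flip n i \<in> hyperoctahedral n" unfolding sign_flip_def by (rule signed_perm_hyper[OF b])
  have abs_perm: "abs_perm (sign_flip n i) k = k" if "k \<in> {1..n}" for k
    unfolding sign_flip_def by (rule abs_perm_signed_perm[OF b that])
  show "abs_perm (hinv (sign_flip n i)) k = k" if "k \<in> {1..n}"
    using abs_perm_inv[OF G, of k] abs_perm[OF that] by simp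
  show "mono_sign n (sign_flip n i) a = (- 1) ^ a i" if i: "i \<in> {1..n}"
  proof -
    have "mono_sign n (sign_flip n i) a = (\<Prod>j = 1..n. if j = i then (- 1) ^ a i else 1)"
      unfolding mono_sign_def by (rule prod.cong) (auto simp: sign_flip_def signed_perm_def)
    then show ?thesis using i by (simp add: prod.delta)
  qed
qed

text \<open>
  The sign change in position \<open>i\<close> sends the monomial to its negative.
\<close>

lemma reynolds_xy_mono_odd:
  assumes i: "i \<in> {1..n}" and odd: "odd (a i + b i)"
  shows "reynolds n (xy_mono n a b) = 0"
proof -
  let ?s = "sign_flip n i"
  have "act ?s ?s (xy_mono n a b) = const (- 1) * xy_mono n a b"
  proof -
    have "mono_sign n ?s a * mono_sign n ?s b = - 1"
      using odd unfolding mono_sign_flip[OF i] power_add[symmetric] by simp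
    moreover have "xy_mono n (\<lambda>k. a (abs_perm (hinv ?s) k)) (\<lambda>k. b (abs_perm (hinv ?s) k)) = xy_mono n a b"
      by (rule xy_mono_cong) (simp add: abs_perm_inv_sign_flip)
    ultimately show ?thesis unfolding act_xy_mono[OF sign_flip_hyper sign_flip_hyper] by simp
  qed
  then have "reynolds n (xy_mono n a b) = const (- 1) * reynolds n (xy_mono n a b)"
    using reynolds_act[OF sign_flip_hyper, of n i "xy_mono n a b"] by (simp add: reynolds_const_mult)
  then have "coeff_of (reynolds n (xy_mono n a b)) m = - coeff_of (reynolds n (xy_mono n a b)) m" for m
    using coeff_const_mult[of "- 1" "reynolds n (xy_mono n a b)" m] by simp
  then show ?thesis by (intro poly_mapping_eqI) simp
qed

text \<open>
  Monomials with the same diagram differ by a simultaneous permutation of the \<open>x\<close> and the \<open>y\<close>.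
\<close>

lemma reynolds_diagram:
  assumes "diagram n a b = diagram n a' b'"
  shows "reynolds n (xy_mono n a b) = reynolds n (xy_mono n a' b')"
proof -
  obtain p where p: "p permutes {1..n}" "\<And>i. i \<in> {1..n} \<Longrightarrow> a i = a' (p i) \<and> b i = b' (p i)"
    using image_mset_eq_implies_permutes[OF finite_atLeastAtMost assms[unfolded diagram_def]]
    by (metis prod.inject)
  have bij: "bij_betw p {1..n} {1..n}" using p(1) by (rule permutes_imp_bij)
  define s where "s = signed_perm n p (\<lambda>_. False)"
  have G: "s \<in> hyperoctahedral n" unfolding s_def by (rule signed_perm_hyper[OF bij])
  have "s (int i) > 0" if "i \<in> {1..n}" for i
    using hyper_nonzero[OF G that] signed_perm_neg[OF bij that, of "\<lambda>_. False"] unfolding s_def by auto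
  then have sg: "mono_sign n s c = 1" for c by (rule mono_sign_pos)
  have "xy_mono n (\<lambda>k. a (abs_perm (hinv s) k)) (\<lambda>k. b (abs_perm (hinv s) k)) = xy_mono n a' b'"
  proof (rule xy_mono_cong)
    fix k assume k: "k \<in> {1..n}"
    note h = abs_perm_in[OF hyper_inv[OF G] k]
    have "p (abs_perm (hinv s) k) = k"
      using abs_perm_inv'[OF G k] abs_perm_signed_perm[OF bij h] unfolding s_def by simp
    then show "a (abs_perm (hinv s) k) = a' k \<and> b (abs_perm (hinv s) k) = b' k" using p(2)[OF h] by simp
  qed
  then have "act s s (xy_mono n a b) = xy_mono n a' b'"
    by (simp add: act_xy_mono[OF G G] sg const_simps)
  then show ?thesis using reynolds_act[OF G, of "xy_mono n a b"] by simp
qed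

lemma
  assumes par: "\<forall>i\<in>{1..n}. even (a i + b i)"
  shows coeff_reynolds_eq_0: "diagram n a b \<noteq> diagram n a' b' \<Longrightarrow> coeff_of (reynolds n (xy_mono n a b)) (xy_exp n a' b') = 0"
    and coeff_reynolds_nonneg: "coeff_of (reynolds n (xy_mono n a b)) (xy_exp n a' b') \<ge> 0"
    and coeff_reynolds_pos: "coeff_of (reynolds n (xy_mono n a b)) (xy_exp n a b) > 0"
proof -
  define c :: "_ \<Rightarrow> _ \<Rightarrow> _ \<Rightarrow> rat" where "c a' b' \<beta> =
    (if xy_exp n (\<lambda>k. a (abs_perm (hinv \<beta>) k)) (\<lambda>k. b (abs_perm (hinv \<beta>) k)) = xy_exp n a' b' then 1 else 0)" for a' b' \<beta>
  have coeff: "coeff_of (reynolds n (xy_mono n a b)) (xy_exp n a' b') = (\<Sum>\<beta>\<in>hyperoctahedral n. c a' b' \<beta>)" for a' b'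
  proof -
    have "coeff_of (act \<beta> \<beta> (xy_mono n a b)) (xy_exp n a' b') = c a' b' \<beta>" if G: "\<beta> \<in> hyperoctahedral n" for \<beta>
      using mono_sign_even[OF G bspec[OF par]] unfolding act_xy_mono[OF G G] mono_sign_add c_def
      by (simp add: coeff_const_mult xy_mono_def lookup_single when_def)
    then show ?thesis by (simp add: reynolds_def lookup_sum)
  qed
  show "coeff_of (reynolds n (xy_mono n a b)) (xy_exp n a' b') \<ge> 0"
    unfolding coeff by (rule sum_nonneg) (simp add: c_def)
  show "coeff_of (reynolds n (xy_mono n a b)) (xy_exp n a' b') = 0" if "diagram n a b \<noteq> diagram n a' b'"
    unfolding coeff
  proof (rule sum.neutral, rule ballI)
    fix \<beta> assume G: "\<beta> \<in> hyperoctahedral n"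
    have "diagram n (\<lambda>k. a (abs_perm (hinv \<beta>) k)) (\<lambda>k. b (abs_perm (hinv \<beta>) k)) = diagram n a b"
      by (rule diagram_permute[OF hyper_bij[OF hyper_inv[OF G]]])
    then have "xy_exp n (\<lambda>k. a (abs_perm (hinv \<beta>) k)) (\<lambda>k. b (abs_perm (hinv \<beta>) k)) \<noteq> xy_exp n a' b'"
      using that diagram_cong[of n "\<lambda>k. a (abs_perm (hinv \<beta>) k)" a' "\<lambda>k. b (abs_perm (hinv \<beta>) k)" b']
      unfolding xy_exp_eq_iff by metis
    then show "c a' b' \<beta> = 0" by (simp add: c_def)
  qed
  have "c a b id = 1"
  proof -
    show ?thesis by (simp add: c_def abs_perm_id)
  qed
  moreover have "c a b id \<le> (\<Sum>\<beta>\<in>hyperoctahedral n. c a b \<beta>)"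
    by (rule member_le_sum[OF hyper_id _ finite_hyperoctahedral]) (simp add: c_def)
  ultimately show "coeff_of (reynolds n (xy_mono n a b)) (xy_exp n a b) > 0" unfolding coeff by simp
qed

text \<open>
  Combinations of the basis elements with coefficients from the invariants of $B_n\times B_n$.
  The predicate \<open>P\<close> restricts the \<open>\<beta>\<close> whose coefficient may have a constant term: with \<open>P\<close>
  always false this is $A_+R^{B_n}$, and for a bidegree it keeps track of the basis
  elements that survive modulo the ideal.
\<close>

definition basis_span :: "nat \<Rightarrow> ((int \<Rightarrow> int) \<Rightarrow> bool) \<Rightarrow> mpoly set" where
  "basis_span n P = {p. \<exists>a. (\<forall>\<beta>\<in>hyperoctahedral n. a \<beta> \<in> biinvariants n \<and> (coeff_of (a \<beta>) 0 \<noteq> 0 \<longrightarrow> P \<beta>)) \<and>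
     p = (\<Sum>\<beta>\<in>hyperoctahedral n. a \<beta> * basis_poly n \<beta>)}"

lemma basis_spanI:
  assumes "\<And>\<beta>. \<beta> \<in> hyperoctahedral n \<Longrightarrow> a \<beta> \<in> biinvariants n"
    and "\<And>\<beta>. \<beta> \<in> hyperoctahedral n \<Longrightarrow> coeff_of (a \<beta>) 0 \<noteq> 0 \<Longrightarrow> P \<beta>"
    and "p = (\<Sum>\<beta>\<in>hyperoctahedral n. a \<beta> * basis_poly n \<beta>)"
  shows "p \<in> basis_span n P"
  unfolding basis_span_def using assms by blast

lemma basis_span_zero: "0 \<in> basis_span n P"
  by (rule basis_spanI[of n "\<lambda>_. 0"]) (auto simp: biinvariants_closed)

lemma basis_span_add:
  assumes "p \<in> basis_span n P" "p' \<in> basis_span n P"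
  shows "p + p' \<in> basis_span n P"
proof -
  obtain a where a: "\<forall>\<beta>\<in>hyperoctahedral n. a \<beta> \<in> biinvariants n \<and> (coeff_of (a \<beta>) 0 \<noteq> 0 \<longrightarrow> P \<beta>)"
     "p = (\<Sum>\<beta>\<in>hyperoctahedral n. a \<beta> * basis_poly n \<beta>)"
    using assms(1) unfolding basis_span_def by blast
  obtain b where b: "\<forall>\<beta>\<in>hyperoctahedral n. b \<beta> \<in> biinvariants n \<and> (coeff_of (b \<beta>) 0 \<noteq> 0 \<longrightarrow> P \<beta>)"
     "p' = (\<Sum>\<beta>\<in>hyperoctahedral n. b \<beta> * basis_poly n \<beta>)"
    using assms(2) unfolding basis_span_def by blast
  show ?thesis
  proof (rule basis_spanI[of n "\<lambda>\<beta>. a \<beta> + b \<beta>"])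
    fix \<beta> assume G: "\<beta> \<in> hyperoctahedral n"
    show "a \<beta> + b \<beta> \<in> biinvariants n" using a(1) b(1) G biinvariants_closed(3) by blast
    assume "coeff_of (a \<beta> + b \<beta>) 0 \<noteq> 0"
    then have "coeff_of (a \<beta>) 0 \<noteq> 0 \<or> coeff_of (b \<beta>) 0 \<noteq> 0" by (auto simp: lookup_add)
    then show "P \<beta>" using a(1) b(1) G by blast
  qed (simp add: a(2) b(2) distrib_right sum.distrib)
qed

lemma basis_span_sum: "(\<And>i. i \<in> S \<Longrightarrow> g i \<in> basis_span n P) \<Longrightarrow> sum g S \<in> basis_span n P"
  by (induction S rule: infinite_finite_induct) (auto simp: basis_span_zero basis_span_add)

lemma basis_span_mult:
  assumes "p \<in> basis_span n P" "c \<in> biinvariants n" "\<And>\<beta>. coeff_of c 0 \<noteq> 0 \<Longrightarrow> P \<beta> \<Longrightarrow> Q \<beta>"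
  shows "c * p \<in> basis_span n Q"
proof -
  obtain a where a: "\<forall>\<beta>\<in>hyperoctahedral n. a \<beta> \<in> biinvariants n \<and> (coeff_of (a \<beta>) 0 \<noteq> 0 \<longrightarrow> P \<beta>)"
     "p = (\<Sum>\<beta>\<in>hyperoctahedral n. a \<beta> * basis_poly n \<beta>)"
    using assms(1) unfolding basis_span_def by blast
  show ?thesis
  proof (rule basis_spanI[of n "\<lambda>\<beta>. c * a \<beta>"])
    fix \<beta> assume G: "\<beta> \<in> hyperoctahedral n"
    show "c * a \<beta> \<in> biinvariants n" using a(1) G assms(2) biinvariants_closed(4) by blast
    assume "coeff_of (c * a \<beta>) 0 \<noteq> 0"
    then have "coeff_of c 0 \<noteq> 0" "coeff_of (a \<beta>) 0 \<noteq> 0" by (auto simp: constant_coeff_mult)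
    then show "Q \<beta>" using a(1) G assms(3) by blast
  qed (simp add: a(2) sum_distrib_left mult.assoc)
qed

lemma basis_span_const_mult: "p \<in> basis_span n P \<Longrightarrow> const c * p \<in> basis_span n P"
  by (rule basis_span_mult) (auto simp: biinvariants_closed)

lemma xy_exp_0_iff: "xy_exp n a b = 0 \<longleftrightarrow> (\<forall>i\<in>{1..n}. a i = 0 \<and> b i = 0)"
proof -
  have "xy_exp n (\<lambda>_. 0) (\<lambda>_. 0) = 0" by (simp add: xy_exp_def)
  then show ?thesis using xy_exp_eq_iff[of n a b "\<lambda>_. 0" "\<lambda>_. 0"] by simp
qed

text \<open>
  Induction on the weight. The symmetrized monomial of the increments times the basis element of
  \<open>\<beta>\<close> is a positive multiple of the given averaged monomial plus averaged monomials of
  smaller weight and the same bidegree. The factor has a constant term only if all increments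
  vanish, in which case the bidegree is that of the basis element.
\<close>

lemma reynolds_xy_mono_in_basis_span:
  "reynolds n (xy_mono n A B) \<in>
    basis_span n (\<lambda>\<beta>. fmaj n \<beta> = (\<Sum>i = 1..n. A i) \<and> fmaj n (hinv \<beta>) = (\<Sum>i = 1..n. B i))"
proof (induction "weight n A B" arbitrary: A B rule: less_induct)
  case less
  let ?P = "\<lambda>\<beta>. fmaj n \<beta> = (\<Sum>i = 1..n. A i) \<and> fmaj n (hinv \<beta>) = (\<Sum>i = 1..n. B i)"
  let ?G = "hyperoctahedral n"
  show ?case
  proof (cases "\<forall>i\<in>{1..n}. even (A i + B i)")
    case False
    then show ?thesis using reynolds_xy_mono_odd[of _ n A B] basis_span_zero by fastforce
  next
    case True
    then obtain \<beta> l m where G: "\<beta> \<in> ?G" and dec: "decomposes n \<beta> l m"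
      and dia: "diagram n A B = diagram n (\<lambda>i. flag n \<beta> i + l i) (\<lambda>i. inv_flag n \<beta> i + m i)"
      using decomposition_exists[of n A B] by blast
    let ?a = "flag n \<beta>" and ?b = "inv_flag n \<beta>"
    define U where "U x i = ?a i + l (abs_perm (hinv (fst x)) i)" for x :: "(int \<Rightarrow> int) \<times> (int \<Rightarrow> int)" and i
    define V where "V x i = ?b i + m (abs_perm (hinv (snd x)) i)" for x :: "(int \<Rightarrow> int) \<times> (int \<Rightarrow> int)" and i
    define N where "N = symmetrize n (xy_mono n l m)"
    have Nb: "N \<in> biinvariants n" unfolding N_def by (intro symmetrize_biinvariant polys_closed)
    have even: "even (l i)" "even (m i)" if "i \<in> {1..n}" for i using dec that unfolding decomposes_def by blast+
    have N: "N = (\<Sum>x\<in>?G \<times> ?G. xy_mono n (\<lambda>i. l (abs_perm (hinv (fst x)) i)) (\<lambda>i. m (abs_perm (hinv (snd x)) i)))"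
    proof -
      have "act \<alpha> \<gamma> (xy_mono n l m) = xy_mono n (\<lambda>i. l (abs_perm (hinv \<alpha>) i)) (\<lambda>i. m (abs_perm (hinv \<gamma>) i))"
        if "\<alpha> \<in> ?G" "\<gamma> \<in> ?G" for \<alpha> \<gamma>
        using mono_sign_even[OF that(1) even(1)] mono_sign_even[OF that(2) even(2)]
        by (simp add: act_xy_mono[OF that] const_simps)
      then show ?thesis unfolding N_def symmetrize_def sum.cartesian_product
        by (intro sum.cong) auto
    qed
    have prod: "N * basis_poly n \<beta> = (\<Sum>x\<in>?G \<times> ?G. reynolds n (xy_mono n (U x) (V x)))"
    proof -
      have "N * basis_poly n \<beta> = reynolds n (N * xy_mono n ?a ?b)"
        unfolding basis_poly_def reynolds_mult[OF Nb] ..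
      also have "N * xy_mono n ?a ?b = (\<Sum>x\<in>?G \<times> ?G. xy_mono n (U x) (V x))"
        unfolding N sum_distrib_right U_def V_def xy_mono_add by (simp add: mult.commute)
      finally show ?thesis by (simp add: reynolds_sum)
    qed
    define E where "E = {x \<in> ?G \<times> ?G. diagram n (U x) (V x) = diagram n A B}"
    have finG: "finite (?G \<times> ?G)" using finite_hyperoctahedral by simp
    have sums: "(\<Sum>i = 1..n. A i) = (\<Sum>i = 1..n. ?a i) + (\<Sum>i = 1..n. l i)"
        "(\<Sum>i = 1..n. B i) = (\<Sum>i = 1..n. ?b i) + (\<Sum>i = 1..n. m i)"
      using sum_diagram[of fst A B n] sum_diagram[of fst "\<lambda>i. ?a i + l i" "\<lambda>i. ?b i + m i" n]
        sum_diagram[of snd A B n] sum_diagram[of snd "\<lambda>i. ?a i + l i" "\<lambda>i. ?b i + m i" n] dia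
      by (simp_all add: sum.distrib)
    have rest: "reynolds n (xy_mono n (U x) (V x)) \<in> basis_span n ?P" if x: "x \<in> ?G \<times> ?G - E" for x
    proof -
      have xG: "hinv (fst x) \<in> ?G" "hinv (snd x) \<in> ?G" using x hyper_inv by auto
      have "weight n (U x) (V x) < weight n (\<lambda>i. ?a i + l i) (\<lambda>i. ?b i + m i) \<or>
          diagram n (U x) (V x) = diagram n (\<lambda>i. ?a i + l i) (\<lambda>i. ?b i + m i)"
        unfolding U_def V_def
        by (rule leading_diagram[OF compatible_flag[OF G] abs_perm_inj[OF G] _ _ hyper_bij[OF xG(1)] hyper_bij[OF xG(2)]])
          (use dec in \<open>auto simp: decomposes_def\<close>)
      then have w: "weight n (U x) (V x) < weight n A B"
        using x dia weight_diagram[OF dia] unfolding E_def by auto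
      have "(\<Sum>i = 1..n. U x i) = (\<Sum>i = 1..n. A i)" "(\<Sum>i = 1..n. V x i) = (\<Sum>i = 1..n. B i)"
        unfolding U_def V_def sum.distrib sums
        using sum.reindex_bij_betw[OF hyper_bij[OF xG(1)], of l] sum.reindex_bij_betw[OF hyper_bij[OF xG(2)], of m]
        by simp_all
      then show ?thesis using less[OF w] by simp
    qed
    have "(id, id) \<in> E"
    proof -
      have "U (id, id) = (\<lambda>i. ?a i + l i)" "V (id, id) = (\<lambda>i. ?b i + m i)"
        unfolding U_def V_def by (auto simp: abs_perm_id)
      then show ?thesis unfolding E_def using dia hyper_id by auto
    qed
    then have cE: "card E > 0" using finG unfolding E_def by (auto simp: card_gt_0_iff)
    have split: "N * basis_poly n \<beta> = const (of_nat (card E)) * reynolds n (xy_mono n A B) +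
        (\<Sum>x\<in>?G \<times> ?G - E. reynolds n (xy_mono n (U x) (V x)))"
    proof -
      have "(\<Sum>x\<in>E. reynolds n (xy_mono n (U x) (V x))) = (\<Sum>x\<in>E. reynolds n (xy_mono n A B))"
        by (rule sum.cong) (auto simp: E_def intro: reynolds_diagram)
      moreover have "(\<Sum>x\<in>?G \<times> ?G. reynolds n (xy_mono n (U x) (V x))) =
          (\<Sum>x\<in>?G \<times> ?G - E. reynolds n (xy_mono n (U x) (V x))) + (\<Sum>x\<in>E. reynolds n (xy_mono n (U x) (V x)))"
        by (rule sum.subset_diff[OF _ finG]) (auto simp: E_def)
      ultimately show ?thesis unfolding prod by (simp add: const_simps add.commute)
    qed
    have lead: "N * basis_poly n \<beta> \<in> basis_span n ?P"
    proof (rule basis_spanI[of n "\<lambda>\<beta>'. if \<beta>' = \<beta> then N else 0"])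
      fix \<beta>' assume "\<beta>' \<in> ?G"
      show "(if \<beta>' = \<beta> then N else 0) \<in> biinvariants n" using Nb biinvariants_closed by simp
      assume "coeff_of (if \<beta>' = \<beta> then N else 0) 0 \<noteq> 0"
      then have b: "\<beta>' = \<beta>" and N0: "coeff_of N 0 \<noteq> 0" by (auto split: if_splits)
      then obtain x where x: "x \<in> ?G \<times> ?G" "coeff_of (xy_mono n (\<lambda>i. l (abs_perm (hinv (fst x)) i)) (\<lambda>i. m (abs_perm (hinv (snd x)) i))) 0 \<noteq> 0"
        unfolding N lookup_sum by (meson sum.neutral)
      then have z: "\<forall>i\<in>{1..n}. l (abs_perm (hinv (fst x)) i) = 0 \<and> m (abs_perm (hinv (snd x)) i) = 0"
        unfolding xy_mono_def lookup_single when_def xy_exp_0_iff by (meson)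
      have xG: "fst x \<in> ?G" "snd x \<in> ?G" using x by auto
      have "l i = 0 \<and> m i = 0" if "i \<in> {1..n}" for i
        using z abs_perm_in[OF xG(1) that] abs_perm_in[OF xG(2) that] abs_perm_inv[OF xG(1), of i] abs_perm_inv[OF xG(2), of i] by metis
      then show "?P \<beta>'" unfolding b sums sum_flag sum_inv_flag[OF G] by simp
    next
      have "(\<Sum>\<beta>'\<in>?G. (if \<beta>' = \<beta> then N else 0) * basis_poly n \<beta>') =
          (\<Sum>\<beta>'\<in>?G. if \<beta>' = \<beta> then N * basis_poly n \<beta>' else 0)" by (intro sum.cong) auto
      then show "N * basis_poly n \<beta> = (\<Sum>\<beta>'\<in>?G. (if \<beta>' = \<beta> then N else 0) * basis_poly n \<beta>')"
        using G finite_hyperoctahedral by (simp add: sum.delta)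
    qed
    have "reynolds n (xy_mono n A B) = const (1 / of_nat (card E)) * (N * basis_poly n \<beta> +
        const (- 1) * (\<Sum>x\<in>?G \<times> ?G - E. reynolds n (xy_mono n (U x) (V x))))"
    proof -
      have "const (1 / of_nat (card E)) * const (of_nat (card E)) = 1"
        unfolding const_simps(4)[symmetric] using cE by (simp add: const_simps)
      then have "const (1 / of_nat (card E)) * (const (of_nat (card E)) * reynolds n (xy_mono n A B)) = reynolds n (xy_mono n A B)"
        by (simp add: mult.assoc[symmetric])
      then show ?thesis unfolding split by (simp add: const_simps)
    qed
    also have "\<dots> \<in> basis_span n ?P"
      by (intro basis_span_const_mult basis_span_add lead basis_span_sum rest)
    finally show ?thesis .
  qed
qed

lemma biinvariant_even:
  assumes a: "a \<in> biinvariants n" and nz: "coeff_of a (xy_exp n u v) \<noteq> 0" and i: "i \<in> {1..n}"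
  shows "even (u i)" "even (v i)"
proof -
  let ?s = "sign_flip n i"
  have ap: "a \<in> polys n" "\<And>\<alpha> \<gamma>. \<alpha> \<in> hyperoctahedral n \<Longrightarrow> \<gamma> \<in> hyperoctahedral n \<Longrightarrow> act \<alpha> \<gamma> a = a"
    using a by (auto simp: biinvariants_def)
  have idk: "mono_sign n id c = 1" for c
    by (simp add: mono_sign_def)
  have e1: "xy_exp n (\<lambda>k. u (abs_perm (hinv ?s) k)) (\<lambda>k. v (abs_perm (hinv id) k)) = xy_exp n u v"
    and e2: "xy_exp n (\<lambda>k. u (abs_perm (hinv id) k)) (\<lambda>k. v (abs_perm (hinv ?s) k)) = xy_exp n u v"
    by (simp_all add: xy_exp_eq_iff abs_perm_inv_sign_flip abs_perm_id)
  show "even (u i)"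
    using coeff_act[OF sign_flip_hyper[of n i] hyper_id ap(1), where a = u and b = v] nz
    unfolding ap(2)[OF sign_flip_hyper hyper_id] e1 mono_sign_flip[OF i] idk by (cases "even (u i)") auto
  show "even (v i)"
    using coeff_act[OF hyper_id sign_flip_hyper[of n i] ap(1), where a = u and b = v] nz
    unfolding ap(2)[OF hyper_id sign_flip_hyper] e2 mono_sign_flip[OF i] idk by (cases "even (v i)") auto
qed

lemma biinvariant_symmetric:
  assumes a: "a \<in> biinvariants n" and p: "bij_betw p {1..n} {1..n}" "bij_betw p' {1..n} {1..n}"
  shows "coeff_of a (xy_exp n (\<lambda>i. l (p i)) (\<lambda>i. m (p' i))) = coeff_of a (xy_exp n l m)"
proof -
  have ap: "a \<in> polys n" "\<And>\<alpha> \<gamma>. \<alpha> \<in> hyperoctahedral n \<Longrightarrow> \<gamma> \<in> hyperoctahedral n \<Longrightarrow> act \<alpha> \<gamma> a = a"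
    using a by (auto simp: biinvariants_def)
  define s where "s p = signed_perm n p (\<lambda>_. False)" for p
  have s: "s p \<in> hyperoctahedral n" "mono_sign n (s p) c = 1" "k \<in> {1..n} \<Longrightarrow> p (abs_perm (hinv (s p)) k) = k"
    if bij: "bij_betw p {1..n} {1..n}" for p c k
  proof -
    show G: "s p \<in> hyperoctahedral n" unfolding s_def by (rule signed_perm_hyper[OF bij])
    have "s p (int i) > 0" if "i \<in> {1..n}" for i
      using hyper_nonzero[OF G that] signed_perm_neg[OF bij that, of "\<lambda>_. False"] unfolding s_def by auto
    then show "mono_sign n (s p) c = 1" by (rule mono_sign_pos)
    assume k: "k \<in> {1..n}"
    show "p (abs_perm (hinv (s p)) k) = k"
      using abs_perm_inv'[OF G k] abs_perm_signed_perm[OF bij abs_perm_in[OF hyper_inv[OF G] k]] unfolding s_def by simp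
  qed
  have "xy_exp n (\<lambda>k. l (p (abs_perm (hinv (s p)) k))) (\<lambda>k. m (p' (abs_perm (hinv (s p')) k))) = xy_exp n l m"
    unfolding xy_exp_eq_iff using s(3)[OF p(1)] s(3)[OF p(2)] by simp
  then show ?thesis
    using coeff_act[OF s(1)[OF p(1)] s(1)[OF p(2)] ap(1), of "\<lambda>i. l (p i)" "\<lambda>i. m (p' i)"]
    unfolding ap(2)[OF s(1)[OF p(1)] s(1)[OF p(2)]] s(2)[OF p(1)] s(2)[OF p(2)] by simp
qed

text \<open>
  Expanding a relation in averaged monomials gives one summand for each \<open>\<beta>\<close> and each monomial of
  its coefficient. Consider a summand of maximal weight. By symmetry of the coefficient its
  sorted version also occurs, so by \<open>leading_diagram\<close> its diagram is that of a decomposition. All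
  summands with the same diagram then come from the same triple and carry the same
  coefficient; since averaged monomials have nonnegative coefficients, they cannot cancel.
\<close>

lemma basis_independent:
  assumes a: "\<And>\<beta>. \<beta> \<in> hyperoctahedral n \<Longrightarrow> a \<beta> \<in> biinvariants n"
    and zero: "(\<Sum>\<beta>\<in>hyperoctahedral n. a \<beta> * basis_poly n \<beta>) = 0"
    and \<beta>: "\<beta> \<in> hyperoctahedral n"
  shows "a \<beta> = 0"
proof (rule ccontr)
  assume "a \<beta> \<noteq> 0"
  let ?G = "hyperoctahedral n"
  define S where "S = Sigma ?G (\<lambda>\<beta>. Poly_Mapping.keys (a \<beta>))"
  have finS: "finite S" unfolding S_def using finite_hyperoctahedral by auto
  have "Poly_Mapping.keys (a \<beta>) \<noteq> {}" using \<open>a \<beta> \<noteq> 0\<close> poly_sum_single[of "a \<beta>"] by auto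
  then obtain k where "k \<in> Poly_Mapping.keys (a \<beta>)" by blast
  then have "(\<beta>, k) \<in> S" unfolding S_def using \<beta> by blast
  then have "S \<noteq> {}" by blast
  \<comment> \<open>A pair \<open>x\<close> of \<open>\<beta>\<close> and a monomial of \<open>a \<beta>\<close> stands for the summand \<open>c x\<close> times the average of the monomial with exponents \<open>U x\<close> and \<open>V x\<close>.\<close>
  define U where "U x i = flag n (fst x) i + xe (snd x) i" for x :: "(int \<Rightarrow> int) \<times> monomial" and i
  define V where "V x i = inv_flag n (fst x) i + ye (snd x) i" for x :: "(int \<Rightarrow> int) \<times> monomial" and i
  define w where "w x = weight n (U x) (V x)" for x
  define c where "c x = coeff_of (a (fst x)) (snd x)" for x
  have "Max (w ` S) \<in> w ` S" using finS \<open>S \<noteq> {}\<close> by (intro Max_in) auto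
  then obtain y where y: "y \<in> S" "w y = Max (w ` S)" by (metis imageE)
  have max: "w x \<le> w y" if "x \<in> S" for x using that y(2) finS by simp
  have SG: "fst x \<in> ?G" "snd x \<in> Poly_Mapping.keys (a (fst x))" "xy_exp n (xe (snd x)) (ye (snd x)) = snd x"
    if "x \<in> S" for x
  proof -
    show 1: "fst x \<in> ?G" "snd x \<in> Poly_Mapping.keys (a (fst x))" using that unfolding S_def by auto
    then show "xy_exp n (xe (snd x)) (ye (snd x)) = snd x"
      using a[OF 1(1)] by (intro xy_exp_exponents) (auto simp: biinvariants_def polys_iff)
  qed
  have even: "even (xe (snd x) i)" "even (ye (snd x) i)" if "x \<in> S" "i \<in> {1..n}" for x i
    using biinvariant_even[OF a[OF SG(1)[OF that(1)]] _ that(2), of "xe (snd x)" "ye (snd x)"] SG[OF that(1)]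
    by (auto simp: in_keys_iff)
  have par: "\<forall>i\<in>{1..n}. even (U x i + V x i)" if "x \<in> S" for x
  proof
    fix i assume i: "i \<in> {1..n}"
    show "even (U x i + V x i)"
      using even[OF that i] odd_flag[of n "fst x" i] odd_flag[of n "hinv (fst x)" "abs_perm (fst x) i"]
        inv_neg_iff[OF SG(1)[OF that] i] unfolding U_def V_def by auto
  qed
  have top: "\<exists>l m. decomposes n (fst x) l m \<and> c x = coeff_of (a (fst x)) (xy_exp n l m) \<and>
      diagram n (U x) (V x) = diagram n (\<lambda>i. flag n (fst x) i + l i) (\<lambda>i. inv_flag n (fst x) i + m i)"
    if x: "x \<in> S" "w x = w y" for x
  proof -
    let ?\<beta> = "fst x"
    note G = SG(1)[OF x(1)]
    define l p where "l = sort_desc n (xe (snd x))" and "p = rank n (xe (snd x))"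
    have p: "bij_betw p {1..n} {1..n}" "\<And>i. i \<in> {1..n} \<Longrightarrow> xe (snd x) i = l (p i)"
        "\<And>i j. i \<in> {1..n} \<Longrightarrow> j \<in> {1..n} \<Longrightarrow> i < j \<Longrightarrow> l j \<le> l i"
      unfolding l_def p_def by (rule rank_bij, rule sort_desc_rank[symmetric], assumption, rule sort_desc_decreasing)
    define m' p' where "m' = sort_desc n (ye (snd x))" and "p' = rank n (ye (snd x))"
    have p': "bij_betw p' {1..n} {1..n}" "\<And>i. i \<in> {1..n} \<Longrightarrow> ye (snd x) i = m' (p' i)"
        "\<And>i j. i \<in> {1..n} \<Longrightarrow> j \<in> {1..n} \<Longrightarrow> i < j \<Longrightarrow> m' j \<le> m' i"
      unfolding m'_def p'_def by (rule rank_bij, rule sort_desc_rank[symmetric], assumption, rule sort_desc_decreasing)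
    define m where "m i = m' (abs_perm ?\<beta> i)" for i
    define r where "r i = abs_perm (hinv ?\<beta>) (p' i)" for i
    have r: "bij_betw r {1..n} {1..n}"
      using bij_betw_trans[OF p'(1) hyper_bij[OF hyper_inv[OF G]]] by (simp add: r_def[abs_def] o_def)
    have yr: "ye (snd x) i = m (r i)" if "i \<in> {1..n}" for i
      using p'(2)[OF that] abs_perm_inv'[OF G bij_betw_apply[OF p'(1) that]] by (simp add: m_def r_def)
    have ex: "xy_exp n (\<lambda>i. l (p i)) (\<lambda>i. m (r i)) = snd x"
    proof -
      have "xy_exp n (\<lambda>i. l (p i)) (\<lambda>i. m (r i)) = xy_exp n (xe (snd x)) (ye (snd x))"
        unfolding xy_exp_eq_iff using p(2) yr by simp
      then show ?thesis using SG(3)[OF x(1)] by simp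
    qed
    have cx: "c x = coeff_of (a ?\<beta>) (xy_exp n l m)"
      using biinvariant_symmetric[OF a[OF G] p(1) r, of l m] unfolding ex c_def by simp
    have m_dec: "m j \<le> m i" if "i \<in> {1..n}" "j \<in> {1..n}" "abs_perm ?\<beta> i < abs_perm ?\<beta> j" for i j
      using p'(3)[OF abs_perm_in[OF G that(1)] abs_perm_in[OF G that(2)] that(3)] by (simp add: m_def)
    let ?z = "(?\<beta>, xy_exp n l m)"
    have "c x \<noteq> 0" using SG(2)[OF x(1)] by (simp add: c_def in_keys_iff)
    then have z: "?z \<in> S" using cx G unfolding S_def by (simp add: in_keys_iff)
    have dec: "decomposes n ?\<beta> l m"
      unfolding decomposes_def
    proof (intro conjI ballI impI)
      fix i assume i: "i \<in> {1..n}"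
      show "even (l i)" "even (m i)" using even[OF z i] i by (simp_all add: xy_exp_X xy_exp_Y)
    qed (use p(3) m_dec in blast)+
    have eqz: "weight n (\<lambda>i. flag n ?\<beta> i + l i) (\<lambda>i. inv_flag n ?\<beta> i + m i) = w ?z"
      unfolding w_def by (rule weight_diagram, rule diagram_cong) (simp add: U_def V_def xy_exp_X xy_exp_Y)
    have dx: "diagram n (\<lambda>i. flag n ?\<beta> i + l (p i)) (\<lambda>i. inv_flag n ?\<beta> i + m (r i)) = diagram n (U x) (V x)"
      by (rule diagram_cong) (simp add: U_def V_def p(2) yr)
    have "\<not> weight n (\<lambda>i. flag n ?\<beta> i + l (p i)) (\<lambda>i. inv_flag n ?\<beta> i + m (r i)) <
        weight n (\<lambda>i. flag n ?\<beta> i + l i) (\<lambda>i. inv_flag n ?\<beta> i + m i)"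
      unfolding weight_diagram[OF dx] eqz using max[OF z] x(2) by (simp add: w_def)
    moreover have "weight n (\<lambda>i. flag n ?\<beta> i + l (p i)) (\<lambda>i. inv_flag n ?\<beta> i + m (r i)) <
        weight n (\<lambda>i. flag n ?\<beta> i + l i) (\<lambda>i. inv_flag n ?\<beta> i + m i) \<or>
        diagram n (\<lambda>i. flag n ?\<beta> i + l (p i)) (\<lambda>i. inv_flag n ?\<beta> i + m (r i)) =
        diagram n (\<lambda>i. flag n ?\<beta> i + l i) (\<lambda>i. inv_flag n ?\<beta> i + m i)"
      by (rule leading_diagram[OF compatible_flag[OF G] abs_perm_inj[OF G] _ _ p(1) r]) (erule (2) p(3), erule (2) m_dec)
    ultimately have "diagram n (U x) (V x) = diagram n (\<lambda>i. flag n ?\<beta> i + l i) (\<lambda>i. inv_flag n ?\<beta> i + m i)"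
      using dx by simp
    then show ?thesis using dec cx by blast
  qed
  \<comment> \<open>Only summands with the diagram of \<open>y\<close> contribute to the coefficient at the monomial of \<open>y\<close>.\<close>
  define R where "R x = coeff_of (reynolds n (xy_mono n (U x) (V x))) (xy_exp n (U y) (V y))" for x
  have same: "c x = c y" if x: "x \<in> S" and R: "R x \<noteq> 0" for x
  proof -
    have d: "diagram n (U x) (V x) = diagram n (U y) (V y)"
      using coeff_reynolds_eq_0[OF par[OF x]] R unfolding R_def by blast
    then have "w x = w y" unfolding w_def by (rule weight_diagram)
    then obtain l m where x': "decomposes n (fst x) l m" "c x = coeff_of (a (fst x)) (xy_exp n l m)"
      "diagram n (U x) (V x) = diagram n (\<lambda>i. flag n (fst x) i + l i) (\<lambda>i. inv_flag n (fst x) i + m i)"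
      using top[OF x] by blast
    obtain l' m' where y': "decomposes n (fst y) l' m'" "c y = coeff_of (a (fst y)) (xy_exp n l' m')"
      "diagram n (U y) (V y) = diagram n (\<lambda>i. flag n (fst y) i + l' i) (\<lambda>i. inv_flag n (fst y) i + m' i)"
      using top[OF y(1)] by blast
    note u = decomposition_unique[OF SG(1)[OF x] SG(1)[OF y(1)] x'(1) y'(1)]
    have deq: "diagram n (\<lambda>i. flag n (fst x) i + l i) (\<lambda>i. inv_flag n (fst x) i + m i) =
        diagram n (\<lambda>i. flag n (fst y) i + l' i) (\<lambda>i. inv_flag n (fst y) i + m' i)"
      using d x'(3) y'(3) by simp
    have "xy_exp n l m = xy_exp n l' m'" unfolding xy_exp_eq_iff using u(2)[OF deq] by blast
    then show ?thesis using x'(2) y'(2) u(1)[OF deq] by simp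
  qed
  have "(\<Sum>x\<in>S. const (c x) * reynolds n (xy_mono n (U x) (V x))) = 0"
  proof -
    have "a \<beta> * basis_poly n \<beta> = (\<Sum>m\<in>Poly_Mapping.keys (a \<beta>). const (c (\<beta>, m)) * reynolds n (xy_mono n (U (\<beta>, m)) (V (\<beta>, m))))"
      if G: "\<beta> \<in> ?G" for \<beta>
    proof -
      have ap: "a \<beta> \<in> polys n" using a[OF G] by (simp add: biinvariants_def)
      have "a \<beta> * basis_poly n \<beta> = reynolds n (a \<beta> * xy_mono n (flag n \<beta>) (inv_flag n \<beta>))"
        unfolding basis_poly_def reynolds_mult[OF a[OF G]] ..
      also have "\<dots> = reynolds n ((\<Sum>m\<in>Poly_Mapping.keys (a \<beta>). const (coeff_of (a \<beta>) m) * xy_mono n (xe m) (ye m)) *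
          xy_mono n (flag n \<beta>) (inv_flag n \<beta>))"
        by (rule arg_cong[OF poly_sum_xy_mono[OF ap]])
      also have "\<dots> = reynolds n (\<Sum>m\<in>Poly_Mapping.keys (a \<beta>). const (c (\<beta>, m)) * xy_mono n (U (\<beta>, m)) (V (\<beta>, m)))"
        unfolding U_def V_def xy_mono_add sum_distrib_right c_def by (simp add: mult_ac)
      finally show ?thesis by (simp add: reynolds_sum reynolds_const_mult)
    qed
    then have "0 = (\<Sum>\<beta>\<in>?G. \<Sum>m\<in>Poly_Mapping.keys (a \<beta>). const (c (\<beta>, m)) * reynolds n (xy_mono n (U (\<beta>, m)) (V (\<beta>, m))))"
      using zero by simp
    also have "\<dots> = (\<Sum>x\<in>S. const (c x) * reynolds n (xy_mono n (U x) (V x)))"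
      unfolding S_def using finite_hyperoctahedral by (subst sum.Sigma) (auto simp: case_prod_beta)
    finally show ?thesis by simp
  qed
  then have "coeff_of (\<Sum>x\<in>S. const (c x) * reynolds n (xy_mono n (U x) (V x))) (xy_exp n (U y) (V y)) = 0" by simp
  then have "0 = (\<Sum>x\<in>S. c x * R x)" by (simp add: lookup_sum coeff_const_mult R_def)
  also have "\<dots> = (\<Sum>x\<in>S. c y * R x)" using same by (intro sum.cong) auto
  also have "\<dots> = c y * (\<Sum>x\<in>S. R x)" by (simp add: sum_distrib_left)
  finally have "c y = 0 \<or> (\<Sum>x\<in>S. R x) = 0" by simp
  moreover have "R y \<le> (\<Sum>x\<in>S. R x)"
    unfolding R_def by (rule member_le_sum[OF y(1) _ finS]) (use coeff_reynolds_nonneg par in blast)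
  moreover have "R y > 0" unfolding R_def by (rule coeff_reynolds_pos[OF par[OF y(1)]])
  ultimately have "c y = 0" by simp
  then show False using SG(2)[OF y(1)] by (simp add: c_def in_keys_iff)
qed

section \<open>The quotient and its Hilbert series\<close>

abbreviation positive_invariants :: "nat \<Rightarrow> mpoly set" where
  "positive_invariants n \<equiv> {p \<in> biinvariants n. coeff_of p 0 = 0}"

lemma invariant_ideal_eq: "invariant_ideal n = genideal (poly_ring n) (positive_invariants n)"
  unfolding invariant_ideal_def biinvariants_def by (rule arg_cong[where f = "genideal (poly_ring n)"]) auto

lemma ring_poly_ring: "ring (poly_ring n)"
  using cring_poly_ring by (rule cring.axioms(1))

lemma ideal_invariant_ideal: "ideal (invariant_ideal n) (poly_ring n)"
  unfolding invariant_ideal_eq by (rule ring.genideal_ideal[OF ring_poly_ring]) (auto simp: biinvariants_def)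

text \<open>
  Closure under negation comes for free, because the constants belong to the ring.
\<close>

lemma invariant_ideal_induct:
  assumes sub: "J \<subseteq> polys n" and gen: "positive_invariants n \<subseteq> J"
    and add: "\<And>p p'. p \<in> J \<Longrightarrow> p' \<in> J \<Longrightarrow> p + p' \<in> J"
    and mult: "\<And>p r. p \<in> J \<Longrightarrow> r \<in> polys n \<Longrightarrow> r * p \<in> J"
  shows "invariant_ideal n \<subseteq> J"
proof -
  have zero: "0 \<in> J" using gen biinvariants_closed(2) by force
  have uminus: "- p \<in> J" if "p \<in> J" for p
    using mult[OF that, of "const (- 1)"] polys_closed by (simp add: const_simps)
  have minv: "inv\<^bsub>add_monoid (poly_ring n)\<^esub> p = - p" if "p \<in> polys n" for p
  proof -
    interpret R: ring "poly_ring n" by (rule ring_poly_ring)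
    have "\<ominus>\<^bsub>poly_ring n\<^esub> p = - p"
      by (rule R.minus_equality) (use that polys_closed in auto)
    then show ?thesis by (simp add: a_inv_def)
  qed
  have "ideal J (poly_ring n)"
  proof (rule idealI[OF ring_poly_ring])
    show "subgroup J (add_monoid (poly_ring n))"
      by (rule subgroup.intro) (use sub add zero uminus minv in auto)
  qed (use mult in \<open>auto simp: mult.commute\<close>)
  then show ?thesis unfolding invariant_ideal_eq by (rule ring.genideal_minimal[OF ring_poly_ring _ gen])
qed

lemma
  shows ideal_sub: "invariant_ideal n \<subseteq> polys n"
    and ideal_gen: "positive_invariants n \<subseteq> invariant_ideal n"
    and ideal_zero: "0 \<in> invariant_ideal n"
    and ideal_add: "p \<in> invariant_ideal n \<Longrightarrow> p' \<in> invariant_ideal n \<Longrightarrow> p + p' \<in> invariant_ideal n"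
    and ideal_mult: "p \<in> invariant_ideal n \<Longrightarrow> r \<in> polys n \<Longrightarrow> r * p \<in> invariant_ideal n"
    and ideal_uminus: "p \<in> invariant_ideal n \<Longrightarrow> - p \<in> invariant_ideal n"
    and ideal_sum: "(\<And>i. i \<in> S \<Longrightarrow> g i \<in> invariant_ideal n) \<Longrightarrow> sum g S \<in> invariant_ideal n"
proof -
  interpret I: ideal "invariant_ideal n" "poly_ring n" by (rule ideal_invariant_ideal)
  show "invariant_ideal n \<subseteq> polys n" using I.a_subset .
  show gen: "positive_invariants n \<subseteq> invariant_ideal n"
    unfolding invariant_ideal_eq by (rule ring.genideal_self[OF ring_poly_ring]) (auto simp: biinvariants_def)
  show z: "0 \<in> invariant_ideal n" using gen biinvariants_closed(2) by force
  show add: "p + p' \<in> invariant_ideal n" if "p \<in> invariant_ideal n" "p' \<in> invariant_ideal n" for p p'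
    using additive_subgroup.a_closed[OF I.additive_subgroup_axioms that] by simp
  show mult: "r * p \<in> invariant_ideal n" if "p \<in> invariant_ideal n" "r \<in> polys n" for p r
    using I.I_l_closed[OF that] by simp
  show "- p \<in> invariant_ideal n" if "p \<in> invariant_ideal n"
    using mult[OF that, of "const (- 1)"] polys_closed by (simp add: const_simps)
  show "sum g S \<in> invariant_ideal n" if "\<And>i. i \<in> S \<Longrightarrow> g i \<in> invariant_ideal n"
    using that by (induction S rule: infinite_finite_induct) (auto simp: z add)
qed

lemma act_ideal:
  assumes G: "\<beta> \<in> hyperoctahedral n" and p: "p \<in> invariant_ideal n"
  shows "act \<beta> \<beta> p \<in> invariant_ideal n"
proof -
  have "invariant_ideal n \<subseteq> {p \<in> polys n. act \<beta> \<beta> p \<in> invariant_ideal n}"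
  proof (rule invariant_ideal_induct)
    show "positive_invariants n \<subseteq> {p \<in> polys n. act \<beta> \<beta> p \<in> invariant_ideal n}"
      using ideal_gen[of n] G by (auto simp: biinvariants_def)
  qed (use G in \<open>auto simp: polys_closed act_add act_mult act_polys intro: ideal_add ideal_mult\<close>)
  then show ?thesis using p by blast
qed

lemma constant_coeff_ideal:
  assumes "p \<in> invariant_ideal n"
  shows "coeff_of p 0 = 0"
proof -
  have "invariant_ideal n \<subseteq> {p \<in> polys n. coeff_of p 0 = 0}"
    by (rule invariant_ideal_induct)
      (auto simp: biinvariants_def polys_closed lookup_add constant_coeff_mult)
  then show ?thesis using assms by blast
qed

lemma basis_span_mono: "(\<And>\<beta>. P \<beta> \<Longrightarrow> Q \<beta>) \<Longrightarrow> p \<in> basis_span n P \<Longrightarrow> p \<in> basis_span n Q"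
  unfolding basis_span_def by blast

lemma reynolds_in_basis_span:
  assumes p: "p \<in> polys n"
    and deg: "\<And>m \<beta>. m \<in> Poly_Mapping.keys p \<Longrightarrow> fmaj n \<beta> = (\<Sum>i = 1..n. xe m i) \<Longrightarrow>
      fmaj n (hinv \<beta>) = (\<Sum>i = 1..n. ye m i) \<Longrightarrow> P \<beta>"
  shows "reynolds n p \<in> basis_span n P"
proof -
  have "reynolds n p = (\<Sum>m\<in>Poly_Mapping.keys p. const (coeff_of p m) * reynolds n (xy_mono n (xe m) (ye m)))"
    by (subst poly_sum_xy_mono[OF p]) (simp add: reynolds_sum reynolds_const_mult)
  also have "\<dots> \<in> basis_span n P"
  proof (intro basis_span_sum basis_span_const_mult)
    fix m assume m: "m \<in> Poly_Mapping.keys p"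
    show "reynolds n (xy_mono n (xe m) (ye m)) \<in> basis_span n P"
      by (rule basis_span_mono[OF _ reynolds_xy_mono_in_basis_span]) (use deg[OF m] in blast)
  qed
  finally show ?thesis .
qed

text \<open>
  The elements \<open>p\<close> for which all averages of \<open>r p\<close> lie in $A_+R^{B_n}$ form an ideal, and by
  \<open>A\<close>-linearity of the average it contains the generators.
\<close>

lemma reynolds_ideal:
  assumes p: "p \<in> invariant_ideal n"
  shows "reynolds n p \<in> basis_span n (\<lambda>_. False)"
proof -
  let ?J = "{p \<in> polys n. \<forall>r\<in>polys n. reynolds n (r * p) \<in> basis_span n (\<lambda>_. False)}"
  have "invariant_ideal n \<subseteq> ?J"
  proof (rule invariant_ideal_induct)
    show "positive_invariants n \<subseteq> ?J"
    proof
      fix p assume p: "p \<in> positive_invariants n"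
      have "reynolds n (r * p) \<in> basis_span n (\<lambda>_. False)" if r: "r \<in> polys n" for r
      proof -
        have "reynolds n (r * p) = p * reynolds n r" using p by (simp add: mult.commute reynolds_mult)
        moreover have "reynolds n r \<in> basis_span n (\<lambda>_. True)" by (rule reynolds_in_basis_span[OF r]) simp
        ultimately show ?thesis using p by (auto intro: basis_span_mult)
      qed
      then show "p \<in> ?J" using p by (auto simp: biinvariants_def)
    qed
    show "p + p' \<in> ?J" if "p \<in> ?J" "p' \<in> ?J" for p p'
      using that by (auto simp: polys_closed distrib_left reynolds_add intro: basis_span_add)
    show "r * p \<in> ?J" if p: "p \<in> ?J" and r: "r \<in> polys n" for p r
    proof -
      have "reynolds n (s * (r * p)) \<in> basis_span n (\<lambda>_. False)" if "s \<in> polys n" for s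
        using p polys_closed(6)[OF that r] by (simp add: mult.assoc[symmetric])
      then show ?thesis using p r by (simp add: polys_closed)
    qed
  qed auto
  then have "reynolds n (1 * p) \<in> basis_span n (\<lambda>_. False)" using p polys_closed(2)[of n] by blast
  then show ?thesis by simp
qed

lemma basis_poly_invariant: "\<beta>' \<in> hyperoctahedral n \<Longrightarrow> act \<beta>' \<beta>' (basis_poly n \<beta>) = basis_poly n \<beta>"
  unfolding basis_poly_def by (rule act_reynolds)

lemma basis_poly_polys: "basis_poly n \<beta> \<in> polys n"
  unfolding basis_poly_def by (intro reynolds_polys polys_closed)

definition combination :: "nat \<Rightarrow> (int \<Rightarrow> int) set \<Rightarrow> ((int \<Rightarrow> int) \<Rightarrow> rat) \<Rightarrow> mpoly" where
  "combination n B c = (\<Sum>\<beta>\<in>B. const (c \<beta>) * basis_poly n \<beta>)"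

lemma combination_polys: "combination n B c \<in> polys n"
  unfolding combination_def by (intro polys_sum polys_closed basis_poly_polys)

lemma combination_invariant:
  "\<beta> \<in> hyperoctahedral n \<Longrightarrow> act \<beta> \<beta> (combination n B c) = combination n B c"
  by (simp add: combination_def act_sum act_mult act_const basis_poly_invariant)

text \<open>
  Averaging multiplies a combination by the order of the group and moves it from the ideal into
  $A_+R^{B_n}$. By freeness each scalar then equals an element without constant term.
\<close>

lemma combination_independent:
  assumes B: "B \<subseteq> hyperoctahedral n" and I: "combination n B c \<in> invariant_ideal n" and \<beta>: "\<beta> \<in> B"
  shows "c \<beta> = 0"
proof -
  let ?G = "hyperoctahedral n"
  define N where "N = (of_nat (card ?G) :: rat)"
  have "N \<noteq> 0" unfolding N_def using card_hyper_pos[of n] by simp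
  define c' where "c' \<beta> = (if \<beta> \<in> B then c \<beta> else 0)" for \<beta>
  have "combination n B c = (\<Sum>\<beta>\<in>B. const (c' \<beta>) * basis_poly n \<beta>)"
    unfolding combination_def by (rule sum.cong) (auto simp: c'_def)
  also have "\<dots> = (\<Sum>\<beta>\<in>?G. const (c' \<beta>) * basis_poly n \<beta>)"
    by (rule sum.mono_neutral_left[OF finite_hyperoctahedral B]) (auto simp: c'_def const_simps)
  finally have comb: "combination n B c = (\<Sum>\<beta>\<in>?G. const (c' \<beta>) * basis_poly n \<beta>)" .
  obtain a where a: "\<forall>\<beta>\<in>?G. a \<beta> \<in> biinvariants n \<and> (coeff_of (a \<beta>) 0 \<noteq> 0 \<longrightarrow> False)"
      "reynolds n (combination n B c) = (\<Sum>\<beta>\<in>?G. a \<beta> * basis_poly n \<beta>)"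
    using reynolds_ideal[OF I] unfolding basis_span_def by blast
  have "reynolds n (combination n B c) = const N * combination n B c"
    unfolding N_def by (rule reynolds_invariant) (rule combination_invariant)
  then have eq: "(\<Sum>\<beta>\<in>?G. const N * const (c' \<beta>) * basis_poly n \<beta>) = (\<Sum>\<beta>\<in>?G. a \<beta> * basis_poly n \<beta>)"
    unfolding a(2) by (simp add: comb sum_distrib_left mult.assoc)
  have zero: "(\<Sum>\<beta>\<in>?G. (const (N * c' \<beta>) + const (- 1) * a \<beta>) * basis_poly n \<beta>) = 0"
    using eq by (simp add: const_simps algebra_simps sum_subtractf)
  have "const (N * c' \<beta>) + const (- 1) * a \<beta> = 0"
    by (rule basis_independent[OF _ zero]) (use a(1) B \<beta> in \<open>auto intro!: biinvariants_closed\<close>)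
  then have "coeff_of (const (N * c' \<beta>) + const (- 1) * a \<beta>) 0 = 0" by simp
  moreover have "coeff_of (a \<beta>) 0 = 0" using a(1) B \<beta> by blast
  ultimately have "N * c' \<beta> = 0" by (simp add: lookup_add coeff_const_mult) (simp add: const_def)
  then show ?thesis using \<open>N \<noteq> 0\<close> \<beta> by (simp add: c'_def)
qed

text \<open>
  Modulo the ideal, \<open>p\<close> is its average up to a scalar, and the average may be reduced to the
  constant terms of its coefficients; only basis elements of the right bidegree have one.
\<close>

lemma combination_spans:
  assumes p: "p \<in> bihomogeneous n k j"
    and inv: "\<And>\<beta>. \<beta> \<in> hyperoctahedral n \<Longrightarrow> act \<beta> \<beta> p - p \<in> invariant_ideal n"
  shows "\<exists>c. combination n {\<beta> \<in> hyperoctahedral n. fmaj n \<beta> = k \<and> fmaj n (hinv \<beta>) = j} c - p \<in> invariant_ideal n"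
proof -
  let ?G = "hyperoctahedral n" and ?P = "\<lambda>\<beta>. fmaj n \<beta> = k \<and> fmaj n (hinv \<beta>) = j"
  have pp: "p \<in> polys n" using p by (simp add: bihomogeneous_def)
  have "reynolds n p \<in> basis_span n ?P"
    by (rule reynolds_in_basis_span[OF pp]) (use p in \<open>auto simp: bihomogeneous_def\<close>)
  then obtain a where a: "\<forall>\<beta>\<in>?G. a \<beta> \<in> biinvariants n \<and> (coeff_of (a \<beta>) 0 \<noteq> 0 \<longrightarrow> ?P \<beta>)"
      "reynolds n p = (\<Sum>\<beta>\<in>?G. a \<beta> * basis_poly n \<beta>)"
    unfolding basis_span_def by blast
  define N where "N = (of_nat (card ?G) :: rat)"
  have N: "N \<noteq> 0" unfolding N_def using card_hyper_pos[of n] by simp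
  define c where "c \<beta> = coeff_of (a \<beta>) 0" for \<beta>
  have "reynolds n p - const N * p \<in> invariant_ideal n"
  proof -
    have "reynolds n p - const N * p = (\<Sum>\<beta>\<in>?G. act \<beta> \<beta> p - p)"
      by (simp add: reynolds_def sum_subtractf N_def const_simps)
    then show ?thesis using inv by (simp add: ideal_sum)
  qed
  moreover have "combination n ?G c - reynolds n p \<in> invariant_ideal n"
  proof -
    have "(const (c \<beta>) + const (- 1) * a \<beta>) * basis_poly n \<beta> \<in> invariant_ideal n" if "\<beta> \<in> ?G" for \<beta>
    proof -
      have "const (c \<beta>) + const (- 1) * a \<beta> \<in> biinvariants n"
        using a(1) that by (intro biinvariants_closed) auto
      moreover have "coeff_of (const (c \<beta>) + const (- 1) * a \<beta>) 0 = 0"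
        by (simp add: lookup_add coeff_const_mult c_def) (simp add: const_def)
      ultimately have "const (c \<beta>) + const (- 1) * a \<beta> \<in> invariant_ideal n" using ideal_gen by blast
      from ideal_mult[OF this basis_poly_polys[of n \<beta>]] show ?thesis by (simp add: mult.commute)
    qed
    moreover have "combination n ?G c - reynolds n p =
        (\<Sum>\<beta>\<in>?G. (const (c \<beta>) + const (- 1) * a \<beta>) * basis_poly n \<beta>)"
      unfolding combination_def a(2) by (simp add: sum_subtractf[symmetric] const_simps algebra_simps)
    ultimately show ?thesis by (simp add: ideal_sum)
  qed
  ultimately have "(combination n ?G c - reynolds n p) + (reynolds n p - const N * p) \<in> invariant_ideal n"
    by (intro ideal_add)
  then have "combination n ?G c - const N * p \<in> invariant_ideal n" by simp
  from ideal_mult[OF this polys_closed(3)[of "1 / N" n]]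
  have "const (1 / N) * combination n ?G c - p \<in> invariant_ideal n"
    using N by (simp add: right_diff_distrib mult.assoc[symmetric] const_simps(4)[symmetric] const_simps(2))
  moreover have "const (1 / N) * combination n ?G c = combination n {\<beta> \<in> ?G. ?P \<beta>} (\<lambda>\<beta>. c \<beta> / N)"
  proof -
    have "combination n ?G c = combination n {\<beta> \<in> ?G. ?P \<beta>} c"
      unfolding combination_def
      by (rule sum.mono_neutral_right[OF finite_hyperoctahedral]) (use a(1) in \<open>auto simp: c_def const_simps\<close>)
    then show ?thesis
      by (simp add: combination_def sum_distrib_left mult.assoc[symmetric] const_simps(4)[symmetric])
  qed
  ultimately show ?thesis by auto
qed

lemma coset_eq: "coset n p = (\<lambda>h. h + p) ` invariant_ideal n"
  unfolding coset_def a_r_coset_def' by auto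

lemma coset_eq_iff: "coset n p = coset n p' \<longleftrightarrow> p - p' \<in> invariant_ideal n"
proof
  assume eq: "coset n p = coset n p'"
  have "p \<in> coset n p" unfolding coset_eq using ideal_zero by force
  then obtain h where "h \<in> invariant_ideal n" "p = h + p'" unfolding eq unfolding coset_eq by blast
  then show "p - p' \<in> invariant_ideal n" by simp
next
  assume d: "p - p' \<in> invariant_ideal n"
  have *: "coset n p \<subseteq> coset n p'" if "p - p' \<in> invariant_ideal n" for p p'
  proof
    fix x assume "x \<in> coset n p"
    then obtain h where h: "h \<in> invariant_ideal n" "x = h + p" unfolding coset_eq by blast
    then have "x = (h + (p - p')) + p'" by simp
    then show "x \<in> coset n p'" unfolding coset_eq using ideal_add[OF h(1) that] by blast
  qed
  have "p' - p \<in> invariant_ideal n" using ideal_uminus[OF d] by simp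
  then show "coset n p = coset n p'" using *[OF d] *[of p' p] by blast
qed

lemma act_coset:
  assumes G: "\<beta> \<in> hyperoctahedral n"
  shows "act \<beta> \<beta> ` coset n p \<subseteq> coset n (act \<beta> \<beta> p)"
  unfolding coset_eq using act_ideal[OF G] by (auto simp: act_add)

text \<open>
  Surjectivity of the action on the coset follows from the action of the inverse.
\<close>

lemma act_coset_invariant:
  assumes "\<And>\<beta>. \<beta> \<in> hyperoctahedral n \<Longrightarrow> act \<beta> \<beta> p = p" "p \<in> polys n" and G: "\<beta> \<in> hyperoctahedral n"
  shows "act \<beta> \<beta> ` coset n p = coset n p"
proof
  show "act \<beta> \<beta> ` coset n p \<subseteq> coset n p" using act_coset[OF G, of p] assms(1)[OF G] by simp
  show "coset n p \<subseteq> act \<beta> \<beta> ` coset n p"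
  proof
    fix x assume x: "x \<in> coset n p"
    note iG = hyper_inv[OF G]
    have "act (hinv \<beta>) (hinv \<beta>) x \<in> coset n p" using act_coset[OF iG, of p] assms(1)[OF iG] x by auto
    moreover have "act \<beta> \<beta> (act (hinv \<beta>) (hinv \<beta>) x) = x"
    proof -
      have "\<beta> \<circ> hinv \<beta> = id" using inv_hyper[OF G] by (auto simp: fun_eq_iff)
      moreover have "x \<in> polys n" using x assms(2) ideal_sub[of n] unfolding coset_eq
        by (auto intro: polys_closed)
      moreover have "act id id x = x" if "x \<in> polys n" for x
      proof -
        have "act id id (xy_mono n a b) = xy_mono n a b" for a b
          by (simp only: act_xy_mono[OF hyper_id hyper_id] abs_perm_id) (simp add: mono_sign_def const_simps)
        then have "act id id (\<Sum>m\<in>Poly_Mapping.keys x. const (coeff_of x m) * xy_mono n (xe m) (ye m)) =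
            (\<Sum>m\<in>Poly_Mapping.keys x. const (coeff_of x m) * xy_mono n (xe m) (ye m))"
          by (simp add: act_sum act_mult act_const)
        then show ?thesis unfolding poly_sum_xy_mono[OF that, symmetric] .
      qed
      ultimately show ?thesis using act_act[OF G G] by simp
    qed
    ultimately show "x \<in> act \<beta> \<beta> ` coset n p" by (metis image_eqI)
  qed
qed

lemma carrier_coinvariants: "carrier (coinvariants n) = coset n ` polys n"
  by (auto simp: coinvariants_def FactRing_def A_RCOSETS_def' coset_def)

lemma
  shows coset_mult: "p \<in> polys n \<Longrightarrow> p' \<in> polys n \<Longrightarrow>
      coset n p \<otimes>\<^bsub>coinvariants n\<^esub> coset n p' = coset n (p * p')"
    and coset_add: "p \<in> polys n \<Longrightarrow> p' \<in> polys n \<Longrightarrow>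
      coset n p \<oplus>\<^bsub>coinvariants n\<^esub> coset n p' = coset n (p + p')"
    and coset_one: "\<one>\<^bsub>coinvariants n\<^esub> = coset n 1"
    and coset_zero: "\<zero>\<^bsub>coinvariants n\<^esub> = coset n 0"
proof -
  interpret I: ideal "invariant_ideal n" "poly_ring n" by (rule ideal_invariant_ideal)
  show "coset n p \<otimes>\<^bsub>coinvariants n\<^esub> coset n p' = coset n (p * p')" if "p \<in> polys n" "p' \<in> polys n"
    using I.rcoset_mult_add[OF that] by (simp add: coinvariants_def FactRing_def coset_def)
  show "coset n p \<oplus>\<^bsub>coinvariants n\<^esub> coset n p' = coset n (p + p')" if "p \<in> polys n" "p' \<in> polys n"
    using I.a_rcos_sum[OF that] by (simp add: coinvariants_def FactRing_def coset_def)
  show "\<one>\<^bsub>coinvariants n\<^esub> = coset n 1" by (simp add: coinvariants_def FactRing_def coset_def)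
  show "\<zero>\<^bsub>coinvariants n\<^esub> = coset n 0" by (simp add: coinvariants_def FactRing_def coset_eq)
qed

lemma ring_coinvariants: "ring (coinvariants n)"
  unfolding coinvariants_def by (rule ideal.quotient_is_ring[OF ideal_invariant_ideal])

lemma subfield_scalars: "subfield (scalars n) (coinvariants n)"
proof -
  interpret R: ring "poly_ring n" by (rule ring_poly_ring)
  interpret Q: ring "coinvariants n" by (rule ring_coinvariants)
  have "subfield (range const) (poly_ring n)"
  proof (rule R.subfieldI)
    show "subcring (range const) (poly_ring n)"
    proof (rule R.subcringI)
      show "subring (range const) (poly_ring n)"
      proof (rule R.subringI)
        show "\<one>\<^bsub>poly_ring n\<^esub> \<in> range const" using const_simps(2) by (metis poly_ring_ops(2) rangeI)
        fix h assume "h \<in> range const"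
        then obtain c where h: "h = const c" by blast
        have "\<ominus>\<^bsub>poly_ring n\<^esub> h = const (- c)"
          by (rule R.minus_equality) (auto simp: h polys_closed const_simps)
        then show "\<ominus>\<^bsub>poly_ring n\<^esub> h \<in> range const" by simp
      qed (auto simp: polys_closed const_simps(3,4)[symmetric])
    qed (auto simp: mult.commute)
    have c: "c = 0" if "const c = 0" for c
      using that unfolding const_def by (metis lookup_single_eq lookup_zero)
    show "Units (poly_ring n\<lparr>carrier := range const\<rparr>) = range const - {\<zero>\<^bsub>poly_ring n\<^esub>}"
    proof (intro subset_antisym subsetI)
      fix x assume "x \<in> Units (poly_ring n\<lparr>carrier := range const\<rparr>)"
      then show "x \<in> range const - {\<zero>\<^bsub>poly_ring n\<^esub>}" by (auto simp: Units_def)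
    next
      fix x assume x: "x \<in> range const - {\<zero>\<^bsub>poly_ring n\<^esub>}"
      then obtain c where c: "x = const c" by blast
      then have "c \<noteq> 0" using x const_simps(1) by auto
      then have "const (1 / c) * const c = 1" "const c * const (1 / c) = 1"
        by (simp_all add: const_simps(4)[symmetric] const_simps(2))
      then show "x \<in> Units (poly_ring n\<lparr>carrier := range const\<rparr>)"
        unfolding Units_def c by auto
    qed
  qed
  moreover have "ring_hom_ring (poly_ring n) (coinvariants n) (coset n)"
    by (rule ring_hom_ringI[OF ring_poly_ring ring_coinvariants])
      (auto simp: carrier_coinvariants coset_mult coset_add coset_one)
  moreover have "\<one>\<^bsub>coinvariants n\<^esub> \<noteq> \<zero>\<^bsub>coinvariants n\<^esub>"
    unfolding coset_one coset_zero coset_eq_iff using constant_coeff_ideal[of 1 n] by auto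
  ultimately show ?thesis unfolding scalars_def
    by (metis ring_hom_ring.img_is_subfield(2))
qed

lemma dimension_combinations:
  assumes "B \<subseteq> hyperoctahedral n"
  shows "ring.dimension (coinvariants n) (card B) (scalars n) (range (\<lambda>c. coset n (combination n B c)))"
proof -
  interpret Q: ring "coinvariants n" by (rule ring_coinvariants)
  have "finite B" using assms finite_hyperoctahedral finite_subset by blast
  then show ?thesis using assms
  proof (induction B rule: finite_induct)
    case empty
    have "range (\<lambda>c. coset n (combination n {} c)) = {\<zero>\<^bsub>coinvariants n\<^esub>}"
      by (auto simp: combination_def coset_zero)
    then show ?case by simp
  next
    case (insert \<beta> B)
    let ?E = "range (\<lambda>c. coset n (combination n B c))"
    let ?v = "coset n (basis_poly n \<beta>)"
    have comb_ins: "combination n (insert \<beta> B) c = const (c \<beta>) * basis_poly n \<beta> + combination n B c" for c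
      unfolding combination_def using insert by simp
    have comb_upd: "combination n B (c(\<beta> := r)) = combination n B c" for c r
      unfolding combination_def using insert(2) by (intro sum.cong) auto
    have v: "?v \<in> carrier (coinvariants n)" unfolding carrier_coinvariants by (simp add: basis_poly_polys)
    have "?v \<notin> ?E"
    proof
      assume "?v \<in> ?E"
      then obtain c where "coset n (basis_poly n \<beta>) = coset n (combination n B c)" by blast
      then have "- (basis_poly n \<beta> - combination n B c) \<in> invariant_ideal n"
        unfolding coset_eq_iff by (rule ideal_uminus)
      moreover have "combination n (insert \<beta> B) (c(\<beta> := - 1)) = - (basis_poly n \<beta> - combination n B c)"
        unfolding comb_ins by (simp add: comb_upd const_simps)
      ultimately have "combination n (insert \<beta> B) (c(\<beta> := - 1)) \<in> invariant_ideal n" by simp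
      from combination_independent[OF insert(4) this, of \<beta>] show False by simp
    qed
    moreover have "Q.dimension (card B) (scalars n) ?E" using insert by simp
    ultimately have "Q.dimension (Suc (card B)) (scalars n) (Q.line_extension (scalars n) ?v ?E)"
      using v by (intro Q.Suc_dim)
    moreover have "Q.line_extension (scalars n) ?v ?E = range (\<lambda>c. coset n (combination n (insert \<beta> B) c))"
    proof (intro subset_antisym subsetI)
      have el: "coset n (const r) \<otimes>\<^bsub>coinvariants n\<^esub> ?v \<oplus>\<^bsub>coinvariants n\<^esub> coset n (combination n B c) =
          coset n (const r * basis_poly n \<beta> + combination n B c)" for r c
        by (simp add: coset_mult coset_add polys_closed basis_poly_polys combination_polys)
      fix x
      { assume "x \<in> Q.line_extension (scalars n) ?v ?E"
        then obtain r c where "x = coset n (const r) \<otimes>\<^bsub>coinvariants n\<^esub> ?v \<oplus>\<^bsub>coinvariants n\<^esub> coset n (combination n B c)"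
          unfolding Q.line_extension_mem_iff scalars_def by blast
        then have "x = coset n (const r * basis_poly n \<beta> + combination n B c)" by (simp only: el)
        moreover have "combination n (insert \<beta> B) (c(\<beta> := r)) = const r * basis_poly n \<beta> + combination n B c"
          unfolding comb_ins by (simp add: comb_upd)
        ultimately show "x \<in> range (\<lambda>c. coset n (combination n (insert \<beta> B) c))" by (metis rangeI) }
      { assume "x \<in> range (\<lambda>c. coset n (combination n (insert \<beta> B) c))"
        then obtain c where "x = coset n (const (c \<beta>)) \<otimes>\<^bsub>coinvariants n\<^esub> ?v \<oplus>\<^bsub>coinvariants n\<^esub> coset n (combination n B c)"
          unfolding comb_ins el by blast
        then show "x \<in> Q.line_extension (scalars n) ?v ?E"
          unfolding Q.line_extension_mem_iff scalars_def by blast }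
    qed
    ultimately show ?case using insert by simp
  qed
qed

lemma basis_poly_bihomogeneous:
  assumes G: "\<beta> \<in> hyperoctahedral n"
  shows "basis_poly n \<beta> \<in> bihomogeneous n (fmaj n \<beta>) (fmaj n (hinv \<beta>))"
proof -
  have "(\<Sum>i = 1..n. xe m i) = fmaj n \<beta> \<and> (\<Sum>i = 1..n. ye m i) = fmaj n (hinv \<beta>)"
    if m: "m \<in> Poly_Mapping.keys (basis_poly n \<beta>)" for m
  proof -
    have "coeff_of (basis_poly n \<beta>) m \<noteq> 0" using m by (simp add: in_keys_iff)
    then obtain \<alpha> where A: "\<alpha> \<in> hyperoctahedral n"
        "coeff_of (act \<alpha> \<alpha> (xy_mono n (flag n \<beta>) (inv_flag n \<beta>))) m \<noteq> 0"
      unfolding basis_poly_def reynolds_def lookup_sum by (meson sum.neutral)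
    note iA = hyper_bij[OF hyper_inv[OF A(1)]]
    have m_eq: "m = xy_exp n (\<lambda>k. flag n \<beta> (abs_perm (hinv \<alpha>) k)) (\<lambda>k. inv_flag n \<beta> (abs_perm (hinv \<alpha>) k))"
      using A(2) unfolding act_xy_mono[OF A(1) A(1)] coeff_const_mult unfolding xy_mono_def lookup_single
      by (auto simp: when_def split: if_splits)
    show ?thesis unfolding m_eq
      using sum.reindex_bij_betw[OF iA, of "flag n \<beta>"] sum.reindex_bij_betw[OF iA, of "inv_flag n \<beta>"]
      by (simp add: xy_exp_X xy_exp_Y sum_flag sum_inv_flag[OF G] del: One_nat_def)
  qed
  then show ?thesis unfolding bihomogeneous_def using basis_poly_polys by blast
qed

lemma bihomogeneous_add:
  assumes "p \<in> bihomogeneous n k j" "p' \<in> bihomogeneous n k j"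
  shows "p + p' \<in> bihomogeneous n k j"
proof -
  have "m \<in> Poly_Mapping.keys p \<or> m \<in> Poly_Mapping.keys p'" if "m \<in> Poly_Mapping.keys (p + p')" for m
    using that keys_add[of p p'] by blast
  then show ?thesis using assms polys_closed(5) unfolding bihomogeneous_def by blast
qed

lemma bihomogeneous_const_mult:
  assumes "p \<in> bihomogeneous n k j"
  shows "const c * p \<in> bihomogeneous n k j"
proof -
  have "Poly_Mapping.keys (const c * p) \<subseteq> Poly_Mapping.keys p"
    by (auto simp: in_keys_iff coeff_const_mult)
  then show ?thesis using assms polys_closed(3,6) unfolding bihomogeneous_def by blast
qed

lemma combination_bihomogeneous:
  "combination n {\<beta> \<in> hyperoctahedral n. fmaj n \<beta> = k \<and> fmaj n (hinv \<beta>) = j} c \<in> bihomogeneous n k j"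
proof -
  have zero: "0 \<in> bihomogeneous n k j" by (simp add: bihomogeneous_def polys_closed)
  have closed: "sum g S \<in> bihomogeneous n k j" if "\<And>i. i \<in> S \<Longrightarrow> g i \<in> bihomogeneous n k j" for S and g :: "(int \<Rightarrow> int) \<Rightarrow> mpoly"
    using that by (induction S rule: infinite_finite_induct) (simp_all add: bihomogeneous_add zero)
  have summand: "const (c \<beta>) * basis_poly n \<beta> \<in> bihomogeneous n k j"
    if "\<beta> \<in> {\<beta> \<in> hyperoctahedral n. fmaj n \<beta> = k \<and> fmaj n (hinv \<beta>) = j}" for \<beta>
    using bihomogeneous_const_mult[OF basis_poly_bihomogeneous, of \<beta> n "c \<beta>"] that by simp
  show ?thesis unfolding combination_def by (rule closed, rule summand)
qed

lemma graded_invariants: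
  "diagonal_invariants n \<inter> bigraded_part n k j =
    range (\<lambda>c. coset n (combination n {\<beta> \<in> hyperoctahedral n. fmaj n \<beta> = k \<and> fmaj n (hinv \<beta>) = j} c))"
  (is "?L = range (\<lambda>c. coset n (combination n ?B c))")
proof (intro subset_antisym subsetI)
  fix x assume x: "x \<in> ?L"
  then obtain p where p: "p \<in> bihomogeneous n k j" "x = coset n p" unfolding bigraded_part_def by blast
  have inv: "act \<beta> \<beta> p - p \<in> invariant_ideal n" if G: "\<beta> \<in> hyperoctahedral n" for \<beta>
  proof -
    have "act \<beta> \<beta> ` coset n p = coset n p" using x p(2) G unfolding diagonal_invariants_def by blast
    moreover have "p \<in> coset n p" unfolding coset_eq using ideal_zero by force
    ultimately have "act \<beta> \<beta> p \<in> coset n p" by blast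
    then show ?thesis unfolding coset_eq by auto
  qed
  obtain c where "combination n ?B c - p \<in> invariant_ideal n" using combination_spans[OF p(1) inv] by blast
  then have "x = coset n (combination n ?B c)" unfolding p(2) coset_eq_iff[symmetric] by simp
  then show "x \<in> range (\<lambda>c. coset n (combination n ?B c))" by blast
next
  fix x assume "x \<in> range (\<lambda>c. coset n (combination n ?B c))"
  then obtain c where x: "x = coset n (combination n ?B c)" by blast
  have "x \<in> bigraded_part n k j" unfolding bigraded_part_def x using combination_bihomogeneous by blast
  moreover have "x \<in> diagonal_invariants n"
    unfolding diagonal_invariants_def carrier_coinvariants x
    using combination_polys act_coset_invariant[OF combination_invariant combination_polys] by blast
  ultimately show "x \<in> ?L" by blast
qed

theorem mainTheorem2:
  fixes n :: nat
  assumes "n \<ge> 1"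
  shows "hilbert_series n (diagonal_invariants n) =
           (\<Sum>\<beta>\<in>hyperoctahedral n. q ^ fmaj n \<beta> * t ^ fmaj n (inv_into UNIV \<beta>))"
proof (intro fps_ext)
  fix k j
  let ?B = "{\<beta> \<in> hyperoctahedral n. fmaj n \<beta> = k \<and> fmaj n (hinv \<beta>) = j}"
  interpret Q: ring "coinvariants n" by (rule ring_coinvariants)
  have "(Q.dim over (scalars n)) (range (\<lambda>c. coset n (combination n ?B c))) = card ?B"
    by (rule Q.dimI[OF subfield_scalars dimension_combinations]) auto
  then have "fps_nth (fps_nth (hilbert_series n (diagonal_invariants n)) k) j = int (card ?B)"
    by (simp add: hilbert_series_def graded_invariants over_def)
  also have "\<dots> = (\<Sum>\<beta>\<in>hyperoctahedral n. if fmaj n \<beta> = k \<and> fmaj n (hinv \<beta>) = j then 1 else 0)"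
    using finite_hyperoctahedral by (simp add: sum.If_cases Int_def)
  also have "\<dots> = fps_nth (fps_nth (\<Sum>\<beta>\<in>hyperoctahedral n. q ^ fmaj n \<beta> * t ^ fmaj n (hinv \<beta>)) k) j"
  proof -
    have "fps_nth (fps_nth (q ^ a * t ^ b) k) j = (if a = k \<and> b = j then 1 else 0)" for a b
      by (simp add: q_def t_def fps_const_power fps_X_power_nth)
    then show ?thesis by (simp add: fps_sum_nth)
  qed
  finally show "fps_nth (fps_nth (hilbert_series n (diagonal_invariants n)) k) j =
      fps_nth (fps_nth (\<Sum>\<beta>\<in>hyperoctahedral n. q ^ fmaj n \<beta> * t ^ fmaj n (hinv \<beta>)) k) j" .
qed

end
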